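(* Assume the setting described in the context, in which conditions (B1), (B2), (B3) and (C) hold. Then for every $a\in\big(0,\frac{\log\lambda(\delta)}{\delta}\big)$, letting $\theta_a\in(0,\delta)$ be such that $I(a):=\sup_{\theta\in(0,\delta)}[a\theta-\log\lambda(\theta)]=a\theta_a-\log\lambda(\theta_a)$, $$\mathbb P(S_N\ge aN)e^{I(a)N}=\frac{\ell(\Pi_{\theta_a}v)\sqrt{I''(a)}}{\theta_a\sqrt{2\pi N}}\big(1+o(1)\big)\quad\text{as }N\to\infty.$$
   Context: $(X_n)_{n\ge1}$ are real random variables, $S_N=X_1+\dots+X_N$, and $\lim_{N\to\infty}\mathbb E(S_N)/N=0$. There are $\delta>0$, a complex Banach space $\mathcal B$, $v\in\mathcal B$, $\ell\in\mathcal B'$ and bounded linear operators $\mathcal L_z$ on $\mathcal B$ with $\mathbb E(e^{zS_N})=\ell(\mathcal L_z^Nv)$ for all $N$ and all $z\in\mathbb C$ with $|\mathrm{Re}\,z|<\delta$, and: (B1) $z\mapsto\mathcal L_z$ is continuous on $|\mathrm{Re}\,z|<\delta$ and holomorphic on $|z|<\delta$. (B2) For each $\theta\in(-\delta,\delta)$, $\mathcal L_\theta$ has an isolated simple eigenvalue $\lambda(\theta)>0$, the rest of its spectrum lies in a disc of radius smaller than $\lambda(\theta)$, and $\lambda(0)=1$; $\Pi_\theta$ denotes the eigenprojection onto the eigenspace of $\lambda(\theta)$. (B3) For each $\theta\in(-\delta,\delta)$ and real $s\ne0$, the spectrum of $\mathcal L_{\theta+is}$ lies in $\{|z|<\lambda(\theta)\}$.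 (C) For all $\theta\in(-\delta,\delta)$: $(\log\lambda)''(\theta)>0$ and $\ell(\Pi_\theta v)>0$. $\lambda(\delta)$ denotes $\lim_{\theta\uparrow\delta}\lambda(\theta)$. *)

theory Defs
  imports "HOL-Probability.Probability" "HOL-Library.Landau_Symbols"
begin

class complex_banach = banach +
  fixes cscale :: "complex \<Rightarrow> 'a \<Rightarrow> 'a"  (infixr \<open>*\<^sub>C\<close> 75)
  assumes cscale_add_right: "c *\<^sub>C (x + y) = c *\<^sub>C x + c *\<^sub>C y"
    and cscale_add_left: "(c + d) *\<^sub>C x = c *\<^sub>C x + d *\<^sub>C x"
    and cscale_cscale: "c *\<^sub>C (d *\<^sub>C x) = (c * d) *\<^sub>C x"
    and cscale_of_real: "(complex_of_real r) *\<^sub>C x = r *\<^sub>R x"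
    and norm_cscale: "norm (c *\<^sub>C x) = cmod c * norm x"

definition clinear_op :: "('a::complex_banach \<Rightarrow>\<^sub>L 'a) \<Rightarrow> bool" where
  "clinear_op T \<longleftrightarrow> (\<forall>c x. blinfun_apply T (c *\<^sub>C x) = c *\<^sub>C blinfun_apply T x)"

definition clinear_functional :: "('a::complex_banach \<Rightarrow> complex) \<Rightarrow> bool" where
  "clinear_functional f \<longleftrightarrow> bounded_linear f \<and> (\<forall>c x. f (c *\<^sub>C x) = c * f x)"

definition cmul_op :: "complex \<Rightarrow> ('a::complex_banach \<Rightarrow>\<^sub>L 'a) \<Rightarrow> ('a \<Rightarrow>\<^sub>L 'a)" where
  "cmul_op c T = Blinfun (\<lambda>x. c *\<^sub>C blinfun_apply T x)"

definition op_holomorphic_on ::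
  "(complex \<Rightarrow> ('a::complex_banach \<Rightarrow>\<^sub>L 'a)) \<Rightarrow> complex set \<Rightarrow> bool" where
  "op_holomorphic_on F S \<longleftrightarrow>
     (\<forall>z\<in>S. \<exists>D. ((\<lambda>w. norm (F w - F z - cmul_op (w - z) D) / cmod (w - z)) \<longlongrightarrow> 0)
                   (at z within S))"

text \<open>Spectrum of a bounded operator restricted to an invariant set \<open>S\<close>:
  the \<open>\<mu>\<close> for which \<open>T - \<mu> I\<close> is not a bijection of \<open>S\<close>
  (for closed invariant subspaces of a Banach space this is the usual spectrum,
  by the bounded inverse theorem).\<close>

definition spectrum_on :: "'a set \<Rightarrow> ('a::complex_banach \<Rightarrow>\<^sub>L 'a) \<Rightarrow> complex set" where
  "spectrum_on S T = {\<mu>. \<not> bij_betw (\<lambda>x. blinfun_apply T x - \<mu> *\<^sub>C x) S S}"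

abbreviation op_spectrum :: "('a::complex_banach \<Rightarrow>\<^sub>L 'a) \<Rightarrow> complex set" where
  "op_spectrum T \<equiv> spectrum_on UNIV T"

definition simple_eigenprojection ::
  "('a::complex_banach \<Rightarrow>\<^sub>L 'a) \<Rightarrow> complex \<Rightarrow> ('a \<Rightarrow>\<^sub>L 'a) \<Rightarrow> bool" where
  "simple_eigenprojection T \<mu> P \<longleftrightarrow>
     clinear_op P \<and> P o\<^sub>L P = P \<and> P o\<^sub>L T = T o\<^sub>L P \<and>
     (\<exists>e. e \<noteq> 0 \<and> range (blinfun_apply P) = range (\<lambda>c. c *\<^sub>C e)) \<and>
     (\<forall>x\<in>range (blinfun_apply P). blinfun_apply T x = \<mu> *\<^sub>C x) \<and>
     \<mu> \<notin> spectrum_on {x. blinfun_apply P x = 0} T"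

end

theory Submission
  imports Defs "HOL-Complex_Analysis.Complex_Analysis"
begin

text \<open>
  Write \<open>\<psi> N z = ell (L z ^ N v)\<close>. Near the real axis \<open>L z\<close> keeps a dominating simple eigenvalue, so
  \<open>\<psi> N z = \<mu> z ^ N * c z + O(q ^ N)\<close> with \<open>\<mu>\<close>, \<open>c\<close> holomorphic and \<open>q\<close> smaller than \<open>lam \<theta>\<close>; on vertical
  lines away from the real axis \<open>\<psi> N\<close> is exponentially smaller. Jensen's inequality and the vanishing
  mean give \<open>ln lam \<ge> 0\<close>, so the slope of \<open>ln lam\<close> vanishes at \<open>0\<close> and the maximiser \<open>\<theta>\<close> is the point
  of slope \<open>a\<close>; moreover \<open>I'' a\<close> is the reciprocal of the second derivative \<open>\<sigma>\<^sup>2\<close> of \<open>ln lam\<close> at \<open>\<theta>\<close>.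
  Tilting by \<open>exp (\<theta> S)\<close> turns the tail probability into \<open>\<psi> N \<theta> exp (- \<theta> a N)\<close> times the integral of
  \<open>exp (- \<theta> t)\<close> over \<open>t \<ge> 0\<close> against the tilted law of \<open>S - a N\<close>. The characteristic functions of these
  laws are Gaussian to leading order, and a local limit theorem evaluates that integral as
  \<open>1 / (\<theta> \<sigma> sqrt (2 \<pi> N))\<close>. The local limit theorem multiplies the laws by a kernel with compactly
  supported Fourier transform, applies Levy's continuity theorem, and divides the kernel out again.
\<close>

section \<open>Bounded inverse theorem\<close>

text \<open>The spectral hypotheses are qualitative: a spectrum is a set where bijectivity fails,
  and eigenvalues and projections are given for real parameters alone. Quantitative bounds have to
  be produced from this. The bounded inverse theorem turns bijectivity into resolvent bounds, and
  these give the decay of powers. For complex parameters near the real axis no eigenvalue is given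
  at all; it is built as a uniform limit of holomorphic ratios and matched with \<open>lam\<close>
  on the real axis by comparing two expansions of \<open>\<psi>\<close>, which is where the
  nonvanishing of \<open>ell\<close> on the projected vector enters.

  (B3) controls a vertical line only on compact pieces, without uniformity at high frequency, so the
  characteristic functions cannot be integrated over the whole line. This forces a kernel with
  compactly supported Fourier transform. A Fejer kernel decays only quadratically, so dividing it
  out costs less than the weight exp (- \<theta> t) gains.\<close>

lemma approx_surj_imp_solution:
  fixes f :: "'a::banach \<Rightarrow> 'b::real_normed_vector"
  assumes f: "bounded_linear f" and C: "C \<ge> 0"
    and approx: "\<And>y. \<exists>x. norm x \<le> C * norm y \<and> norm (y - f x) \<le> norm y / 2"
  shows "\<exists>x. f x = y \<and> norm x \<le> 2 * C * norm y"
proof -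
  interpret f: bounded_linear f by (rule f)
  obtain g where g: "\<And>y. norm (g y) \<le> C * norm y" "\<And>y. norm (y - f (g y)) \<le> norm y / 2"
    using approx by metis
  \<comment> \<open>\<open>Y k\<close> is the residual after k corrections. It halves at each stage,
    so the corrections \<open>g (Y k)\<close> have norms at most C |y| / 2^k, which sum to 2 C
    |y|.\<close>
  define Y where "Y = rec_nat y (\<lambda>_ z. z - f (g z))"
  have Y0: "Y 0 = y" and YS: "\<And>k. Y (Suc k) = Y k - f (g (Y k))"
    by (simp_all add: Y_def)
  have Yb: "norm (Y k) \<le> norm y * (1/2)^k" for k
  proof (induction k)
    case (Suc k)
    have "norm (Y (Suc k)) \<le> norm (Y k) / 2" using g(2) YS by simp
    with Suc show ?case by simp
  qed (simp add: Y0)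
  have gb: "norm (g (Y k)) \<le> C * norm y * (1/2)^k" for k
    using order_trans[OF g(1)[of "Y k"] mult_left_mono[OF Yb C]] by (simp add: mult.assoc)
  have geo: "(\<lambda>k. C * norm y * (1/2)^k) sums (C * norm y * 2)"
    using sums_mult[OF geometric_sums[of "1/2::real"]] by simp
  have nsumm: "summable (\<lambda>k. norm (g (Y k)))"
    by (rule summable_comparison_test'[OF sums_summable[OF geo], of 0]) (use gb in simp)
  hence summ: "summable (\<lambda>k. g (Y k))" by (rule summable_norm_cancel)
  define x where "x = (\<Sum>k. g (Y k))"
  have part: "f (\<Sum>k<n. g (Y k)) = y - Y n" for n
    by (induction n) (simp_all add: Y0 YS f.zero f.add)
  have "Y \<longlonglongrightarrow> 0"
    by (rule Lim_null_comparison[where g="\<lambda>k. norm y * (1/2)^k"])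
      (use Yb in \<open>auto intro!: tendsto_mult_right_zero LIMSEQ_power_zero\<close>)
  hence "(\<lambda>n. y - Y n) \<longlonglongrightarrow> y - 0" by (intro tendsto_intros)
  moreover have "(\<lambda>n. f (\<Sum>k<n. g (Y k))) \<longlonglongrightarrow> f x"
    unfolding x_def by (intro f.tendsto summable_LIMSEQ summ)
  ultimately have "f x = y" using LIMSEQ_unique unfolding part by fastforce
  moreover have "norm x \<le> 2 * C * norm y"
  proof -
    have "norm x \<le> (\<Sum>k. norm (g (Y k)))" unfolding x_def by (rule summable_norm[OF nsumm])
    also have "\<dots> \<le> (\<Sum>k. C * norm y * (1/2)^k)"
      using gb nsumm geo by (intro suminf_le) (auto simp: sums_iff)
    finally show ?thesis using geo by (simp add: sums_iff mult_ac)
  qed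
  ultimately show ?thesis by blast
qed

text \<open>Baire category: the closures of the images of balls of integer radius cover the complete
  codomain, so one of them contains a ball. Differences of two points of that image approximate
  every small vector, and homogeneity removes the smallness.\<close>

lemma surj_imp_approx_surj:
  fixes f :: "'a::real_normed_vector \<Rightarrow> 'b::banach"
  assumes f: "bounded_linear f" and surj: "surj f"
  shows "\<exists>C\<ge>0. \<forall>y. \<exists>x. norm x \<le> C * norm y \<and> norm (y - f x) \<le> norm y / 2"
proof -
  interpret f: bounded_linear f by (rule f)
  let ?F = "\<lambda>n::nat. closure (f ` cball 0 (real n))"
  have "\<Union>(range ?F) = UNIV"
  proof (intro equalityI subset_UNIV subsetI)
    fix y
    obtain x where x: "y = f x" using surj by blast
    obtain n where "norm x \<le> real n" using real_arch_simple by blast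
    then have "y \<in> f ` cball 0 (real n)" using x by auto
    then show "y \<in> \<Union>(range ?F)" by (intro UnionI[of "?F n"] rangeI closure_subset[THEN subsetD])
  qed
  have "\<exists>n. interior (?F n) \<noteq> {}"
  proof (rule ccontr)
    assume "\<nexists>n. interior (?F n) \<noteq> {}"
    hence "closed T \<and> interior T = {}" if "T \<in> range ?F" for T
      using that by auto
    hence "Met_TC.mtopology interior_of \<Union>(range ?F) = {}"
      by (intro Met_TC.metric_Baire_category_alt countable_image countableI_type)
        (simp_all only: mcomplete_iff_complete complete_UNIV mtopology_is_euclidean
          euclidean_interior_of closed_closedin[symmetric])
    then show False unfolding \<open>\<Union>(range ?F) = UNIV\<close> by simp
  qed
  then obtain n y0 where "y0 \<in> interior (?F n)" by blast
  then obtain e where e: "e > 0" "ball y0 e \<subseteq> ?F n" by (auto simp: mem_interior)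
  have near: "\<exists>x. norm x \<le> 2 * real n \<and> norm (y - f x) < \<epsilon>" if y: "norm y < e" and "\<epsilon> > 0" for y \<epsilon>
  proof -
    have "y0 + y \<in> ?F n" "y0 \<in> ?F n" using e y by (auto simp: subset_eq dist_norm)
    then obtain u1 u2 where u: "u1 \<in> f ` cball 0 (real n)" "dist u1 (y0 + y) < \<epsilon>/2"
      "u2 \<in> f ` cball 0 (real n)" "dist u2 y0 < \<epsilon>/2"
      using half_gt_zero[OF \<open>\<epsilon> > 0\<close>] unfolding closure_approachable by blast
    then obtain x1 x2 where x: "norm x1 \<le> real n" "dist (f x1) (y0 + y) < \<epsilon>/2"
      "norm x2 \<le> real n" "dist (f x2) y0 < \<epsilon>/2"
      by auto
    have "norm (y - f (x1 - x2)) = norm ((f x2 - y0) - (f x1 - (y0 + y)))" by (simp add: f.diff algebra_simps)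
    also have "\<dots> < \<epsilon>" using x norm_triangle_ineq4[of "f x2 - y0" "f x1 - (y0 + y)"] by (simp add: dist_norm)
    finally have "norm (y - f (x1 - x2)) < \<epsilon>" .
    moreover have "norm (x1 - x2) \<le> 2 * real n" using x norm_triangle_ineq4[of x1 x2] by simp
    ultimately show ?thesis by blast
  qed
  have "\<exists>x. norm x \<le> (4 * real n / e) * norm y \<and> norm (y - f x) \<le> norm y / 2" for y
  proof (cases "y = 0")
    case True
    then show ?thesis by (intro exI[of _ 0]) (simp add: f.zero)
  next
    case False
    \<comment> \<open>Scaling \<open>y\<close> to norm e/2 puts it inside the radius where
      \<open>near\<close> applies. The accuracy requested there becomes half of
      \<open>norm y\<close> after scaling back, and the radius 2n divided by \<open>t\<close> gives
      the constant 4n/e.\<close>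
    define t where "t = e / (2 * norm y)"
    have t: "t > 0" using False e by (simp add: t_def)
    have "norm (t *\<^sub>R y) < e" using False e by (simp add: t_def)
    then obtain x where x: "norm x \<le> 2 * real n" "norm (t *\<^sub>R y - f x) < t * (norm y / 2)"
      using near[of "t *\<^sub>R y" "t * (norm y / 2)"] t False by auto
    have "t *\<^sub>R (y - f ((1/t) *\<^sub>R x)) = t *\<^sub>R y - f x" using t by (simp add: f.scaleR algebra_simps)
    hence "t * norm (y - f ((1/t) *\<^sub>R x)) = norm (t *\<^sub>R y - f x)" using t by (metis abs_of_pos norm_scaleR)
    hence "norm (y - f ((1/t) *\<^sub>R x)) \<le> norm y / 2" using x(2) t by (metis less_imp_le mult_less_cancel_left_pos)
    moreover have "norm ((1/t) *\<^sub>R x) \<le> (4 * real n / e) * norm y"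
    proof -
      have "norm ((1/t) *\<^sub>R x) \<le> (1/t) * (2 * real n)" using x(1) t by (auto intro!: divide_right_mono)
      also have "\<dots> = (4 * real n / e) * norm y" by (simp add: t_def)
      finally show ?thesis .
    qed
    ultimately show ?thesis by blast
  qed
  then show ?thesis using e by (intro exI[of _ "4 * real n / e"]) auto
qed

theorem bounded_inverse:
  fixes f :: "'a::banach \<Rightarrow> 'b::banach"
  assumes f: "bounded_linear f" and bij: "bij f"
  obtains K where "K > 0" "\<And>x. norm x \<le> K * norm (f x)"
proof -
  obtain C where C: "C \<ge> 0" "\<And>y. \<exists>x. norm x \<le> C * norm y \<and> norm (y - f x) \<le> norm y / 2"
    using surj_imp_approx_surj[OF f] bij by (auto simp: bij_def)
  have "norm x \<le> (2 * C + 1) * norm (f x)" for x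
  proof -
    obtain x' where x': "f x' = f x" "norm x' \<le> 2 * C * norm (f x)"
      using approx_surj_imp_solution[OF f C] by blast
    hence "x' = x" using bij by (auto simp: bij_def dest: injD)
    then show ?thesis using x'(2) norm_ge_zero[of "f x"] by (simp add: distrib_right add_increasing2)
  qed
  then show thesis using that[of "2 * C + 1"] C(1) by auto
qed

section \<open>Spectral radius\<close>

interpretation cscale: bounded_bilinear "cscale :: complex \<Rightarrow> 'a::complex_banach \<Rightarrow> 'a"
proof
  fix r :: real and c d :: complex and x y :: 'a
  show "(r *\<^sub>R c) *\<^sub>C x = r *\<^sub>R (c *\<^sub>C x)"
    by (metis cscale_cscale cscale_of_real scaleR_conv_of_real)
  show "c *\<^sub>C (r *\<^sub>R x) = r *\<^sub>R (c *\<^sub>C x)"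
    by (metis cscale_cscale cscale_of_real mult.commute)
  show "\<exists>K. \<forall>(a::complex) (b::'a). norm (a *\<^sub>C b) \<le> norm a * norm b * K"
    by (rule exI[of _ 1]) (simp add: norm_cscale)
qed (simp_all add: cscale_add_right cscale_add_left)

lemma cscale_one [simp]: "1 *\<^sub>C x = (x::'a::complex_banach)"
  using cscale_of_real[of 1 x] by simp

lemma cscale_eq_0_iff [simp]: "c *\<^sub>C x = 0 \<longleftrightarrow> c = 0 \<or> (x::'a::complex_banach) = 0"
  by (metis mult_eq_0_iff norm_cscale norm_eq_zero)

lemma bij_cscale: "c \<noteq> 0 \<Longrightarrow> bij (\<lambda>x::'a::complex_banach. c *\<^sub>C x)"
  by (rule bij_betwI[where g="\<lambda>x. (1/c) *\<^sub>C x"]) (auto simp: cscale_cscale)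

primrec op_power :: "('a::real_normed_vector \<Rightarrow>\<^sub>L 'a) \<Rightarrow> nat \<Rightarrow> 'a \<Rightarrow>\<^sub>L 'a" where
  "op_power T 0 = id_blinfun"
| "op_power T (Suc n) = T o\<^sub>L op_power T n"

lemma op_power_apply: "blinfun_apply (op_power T n) x = (blinfun_apply T ^^ n) x"
  by (induction n) auto

lemma norm_funpow_le:
  fixes T :: "'a::real_normed_vector \<Rightarrow>\<^sub>L 'a"
  shows "norm ((blinfun_apply T ^^ n) x) \<le> norm (op_power T n) * norm x"
  using norm_blinfun[of "op_power T n" x] by (simp add: op_power_apply)

lemma funpow_bounded_linear:
  fixes T :: "'a::real_normed_vector \<Rightarrow>\<^sub>L 'a"
  shows "bounded_linear (blinfun_apply T ^^ n)"
  using blinfun.bounded_linear_right[of "op_power T n"] by (simp add: op_power_apply[abs_def])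

lemma clinear_op_funpow:
  "clinear_op T \<Longrightarrow> (blinfun_apply T ^^ n) (c *\<^sub>C x) = c *\<^sub>C (blinfun_apply T ^^ n) x"
  by (induction n) (auto simp: clinear_op_def)

lemma clinear_opD: "clinear_op T \<Longrightarrow> blinfun_apply T (c *\<^sub>C x) = c *\<^sub>C blinfun_apply T x"
  by (simp add: clinear_op_def)

text \<open>A finite subcover has a largest parameter, and monotonicity lets that one serve
  everywhere. Used for resolvent bounds on a disc and for powers of operators on vertical
  segments.\<close>

lemma compact_uniform_parameter:
  fixes P :: "'p::linorder \<Rightarrow> 'x::metric_space \<Rightarrow> bool"
  assumes D: "compact D" and mono: "\<And>K K' w. K \<le> K' \<Longrightarrow> P K w \<Longrightarrow> P K' w"
    and loc: "\<And>w. w \<in> D \<Longrightarrow> \<exists>e>0. \<exists>K. \<forall>w'\<in>D. dist w' w < e \<longrightarrow> P K w'"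
  shows "\<exists>K. \<forall>w\<in>D. P K w"
proof -
  obtain e K where eK: "\<And>w. w \<in> D \<Longrightarrow> e w > 0" "\<And>w w'. w \<in> D \<Longrightarrow> w' \<in> D \<Longrightarrow> dist w' w < e w \<Longrightarrow> P (K w) w'"
    using loc by metis
  have "D \<subseteq> (\<Union>w\<in>D. ball w (e w))" using eK(1) by (auto intro!: bexI)
  then obtain C where C: "C \<subseteq> D" "finite C" "D \<subseteq> (\<Union>w\<in>C. ball w (e w))"
    using compactE_image[OF D, of D "\<lambda>w. ball w (e w)"] by auto
  have "P (Max (K ` C)) w'" if w': "w' \<in> D" for w'
  proof -
    obtain w where w: "w \<in> C" "dist w' w < e w" using C(3) w' by (auto simp: dist_commute)
    then show ?thesis using C(1,2) eK(2)[of w w'] w' by (intro mono[of "K w" "Max (K ` C)"]) auto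
  qed
  then show ?thesis by blast
qed

section \<open>Roots of unity\<close>

definition unity_root :: "nat \<Rightarrow> complex" where
  "unity_root n = cis (2 * pi / real n)"

lemma norm_unity_root_power [simp]: "norm (unity_root n ^ k) = 1"
  by (simp add: unity_root_def norm_power)

lemma unity_root_power_eq:
  "unity_root n ^ j = exp (2 * of_real pi * \<i> * of_nat j / of_nat n)"
proof -
  have "\<i> * complex_of_real (real j * (2 * pi / real n)) = 2 * of_real pi * \<i> * of_nat j / of_nat n"
    by simp
  then show ?thesis unfolding unity_root_def Complex.DeMoivre by (simp only: cis_conv_exp)
qed

lemma unity_root_power_power [simp]: "n > 0 \<Longrightarrow> (unity_root n ^ k) ^ n = 1"
  unfolding unity_root_power_eq by (rule complex_root_unity) simp

lemma sum_unity_root_powers: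
  assumes "0 < j" "j < n"
  shows "(\<Sum>k<n. (unity_root n ^ k) ^ j) = 0"
proof -
  have ne: "unity_root n ^ j \<noteq> 1"
    using complex_root_unity_eq_1[of n j] assms unfolding unity_root_power_eq
    by (auto dest: nat_dvd_not_less)
  have "(\<Sum>k<n. (unity_root n ^ j) ^ k) = 0"
    using geometric_sum[OF ne, of n] assms by simp
  moreover have "(unity_root n ^ k) ^ j = (unity_root n ^ j) ^ k" for k by (metis mult.commute power_mult)
  ultimately show ?thesis by simp
qed

section \<open>Resolvent estimates and the decay of operator powers\<close>

context
  fixes T :: "'b::complex_banach \<Rightarrow>\<^sub>L 'b" and r :: real
  assumes T: "clinear_op T" and r: "r > 0" and spec: "op_spectrum T \<subseteq> ball 0 r"
begin

text \<open>The variable \<open>w\<close> stands for 1 / \<mu>: the spectral parameters of modulus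
  at least \<open>r\<close>, together with infinity, become the compact disc of radius 1/r.\<close>

private definition D where "D w x = x - w *\<^sub>C blinfun_apply T x"

private lemma D_bl: "bounded_linear (D w)"
  unfolding D_def
  by (intro bounded_linear_sub bounded_linear_ident
      bounded_linear_compose[OF cscale.bounded_linear_right] blinfun.bounded_linear_right)

private lemma D_bij: assumes "norm w \<le> 1/r" shows "bij (D w)"
proof (cases "w = 0")
  case True
  then show ?thesis by (simp add: D_def[abs_def] cscale.zero_left flip: id_def)
next
  case False
  have "norm (1/w) \<ge> r" using assms False r by (simp add: norm_divide field_simps)
  hence "1/w \<notin> op_spectrum T" using spec by auto
  hence "bij (\<lambda>x. blinfun_apply T x - (1/w) *\<^sub>C x)" by (simp add: spectrum_on_def)
  hence "bij ((\<lambda>x. (-w) *\<^sub>C x) \<circ> (\<lambda>x. blinfun_apply T x - (1/w) *\<^sub>C x))"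
    using bij_cscale[of "-w"] False by (intro bij_comp) auto
  moreover have "(\<lambda>x. (-w) *\<^sub>C x) \<circ> (\<lambda>x. blinfun_apply T x - (1/w) *\<^sub>C x) = D w"
    using False by (auto simp: fun_eq_iff D_def cscale.diff_right cscale_cscale cscale.minus_left)
  ultimately show ?thesis by simp
qed

text \<open>The bounded inverse theorem gives a lower bound for each \<open>w\<close>; it persists
  nearby with a worse constant, and the disc is compact.\<close>

private lemma D_lower: "\<exists>M>0. \<forall>w\<in>cball 0 (1/r). \<forall>y. norm y \<le> M * norm (D w y)"
proof -
  have "\<exists>K::nat. \<forall>w\<in>cball 0 (1/r). \<forall>y. norm y \<le> real K * norm (D w y)"
  proof (rule compact_uniform_parameter)
    fix w :: complex assume w: "w \<in> cball 0 (1/r)"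
    then obtain K where K: "K > 0" "\<And>x. norm x \<le> K * norm (D w x)"
      using bounded_inverse[OF D_bl D_bij, of w] by auto
    obtain n :: nat where n: "2 * K \<le> real n" using real_arch_simple by blast
    \<comment> \<open>Chosen so that \<open>K * (e * (norm T + 1))\<close> is 1/2: moving
      \<open>w\<close> by less than \<open>e\<close> costs at most half of \<open>norm y\<close>,
      which is absorbed on the left.\<close>
    define e where "e = 1 / (2 * K * (norm T + 1))"
    have e: "e > 0" using K by (simp add: e_def add_nonneg_pos)
    have "norm y \<le> real n * norm (D w' y)" if w': "dist w' w < e" for w' y
    proof -
      have "D w y = D w' y + (w' - w) *\<^sub>C blinfun_apply T y" by (simp add: D_def cscale.diff_left)
      hence "norm (D w y) \<le> norm (D w' y) + norm (w' - w) * norm (blinfun_apply T y)"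
        by (metis norm_cscale norm_triangle_ineq)
      also have "norm (w' - w) * norm (blinfun_apply T y) \<le> e * ((norm T + 1) * norm y)"
        using w' norm_blinfun[of T y] e
        by (intro mult_mono) (auto simp: dist_norm algebra_simps intro: order_trans)
      finally have "K * norm (D w y) \<le> K * (norm (D w' y) + e * ((norm T + 1) * norm y))"
        using K by (intro mult_left_mono) auto
      hence "norm y \<le> K * (norm (D w' y) + e * ((norm T + 1) * norm y))" using K(2)[of y] by linarith
      also have "\<dots> = K * norm (D w' y) + norm y / 2"
      proof -
        have "K * (e * (norm T + 1)) = 1/2" using K add_nonneg_pos[OF norm_ge_zero[of T], of 1] by (simp add: e_def)
        then show ?thesis by (simp add: algebra_simps) (metis distrib_left mult.assoc mult.commute mult_1 )
      qed
      finally have "norm y \<le> 2 * K * norm (D w' y)" by simp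
      also have "\<dots> \<le> real n * norm (D w' y)" using n by (intro mult_right_mono) auto
      finally show ?thesis .
    qed
    then show "\<exists>e>0. \<exists>K::nat. \<forall>w'\<in>cball 0 (1/r). dist w' w < e \<longrightarrow> (\<forall>y. norm y \<le> real K * norm (D w' y))"
      using e by blast
  next
    fix K K' :: nat and w :: complex
    assume "K \<le> K'" "\<forall>y. norm y \<le> real K * norm (D w y)"
    then show "\<forall>y. norm y \<le> real K' * norm (D w y)"
      by (meson mult_right_mono norm_ge_zero of_nat_mono order_trans)
  qed auto
  then obtain K :: nat where K: "\<forall>w\<in>cball 0 (1/r). \<forall>y. norm y \<le> real K * norm (D w y)" by blast
  have "norm y \<le> (real K + 1) * norm (D w y)" if "w\<in>cball 0 (1/r)" for w y
    using K that by (smt (verit, best) mult_right_mono norm_ge_zero)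
  then show ?thesis by (intro exI[of _ "real K + 1"]) auto
qed

private definition J where "J w = inv (D w)"

private lemma D_J: "norm w \<le> 1/r \<Longrightarrow> D w (J w x) = x"
  unfolding J_def by (rule surj_f_inv_f[OF bij_is_surj[OF D_bij]])

text \<open>Averaging the resolvent over the \<open>n\<close>-th roots of unity inverts \<open>1 - (wT)\<^sup>n\<close>. Since the resolvent
  is uniformly continuous on the disc, smallness of \<open>(wT)\<^sup>n\<close> propagates outwards along a radius
  (Rickart's argument, which avoids vector-valued contour integrals).\<close>

private definition A where
  "A n w x = (1 / real n) *\<^sub>R (\<Sum>k<n. J (unity_root n ^ k * w) x)"

text \<open>A partial Neumann sum applied to (1 - wT) y telescopes.\<close>

private lemma telescope:
  "D w y = x \<Longrightarrow> (\<Sum>j<n. w ^ j *\<^sub>C (blinfun_apply T ^^ j) x) = y - w ^ n *\<^sub>C (blinfun_apply T ^^ n) y"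
proof (induction n)
  case (Suc n)
  interpret F: bounded_linear "blinfun_apply T ^^ n" by (rule funpow_bounded_linear)
  have "x = y - w *\<^sub>C blinfun_apply T y" using Suc.prems by (simp add: D_def)
  hence "(blinfun_apply T ^^ n) x = (blinfun_apply T ^^ n) y - w *\<^sub>C (blinfun_apply T ^^ Suc n) y"
    using clinear_op_funpow[OF T, of n w] by (simp add: F.diff funpow_swap1)
  then show ?case using Suc by (simp add: cscale.diff_right cscale_cscale mult.commute)
qed simp

text \<open>Rotating \<open>w\<close> by an n-th root of unity does not change \<open>w ^ n\<close>,
  so the telescoped identity has the same right-hand operator for every \<open>k\<close>. After
  summing over \<open>k\<close> and swapping the sums, only the power j = 0 survives.\<close>

private lemma A_inverts:
  assumes n: "n > 0" and w: "norm w \<le> 1/r"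
  shows "A n w x - w ^ n *\<^sub>C (blinfun_apply T ^^ n) (A n w x) = x"
proof -
  let ?o = "unity_root n"
  let ?J = "\<lambda>k. J (?o ^ k * w) x"
  interpret F: bounded_linear "blinfun_apply T ^^ n" by (rule funpow_bounded_linear)
  have J: "(\<Sum>j<n. (?o ^ k * w) ^ j *\<^sub>C (blinfun_apply T ^^ j) x)
        = ?J k - w ^ n *\<^sub>C (blinfun_apply T ^^ n) (?J k)" for k
    using telescope[OF D_J[of "?o ^ k * w" x], of n] w n
    by (simp add: norm_mult power_mult_distrib)
  have "real n *\<^sub>R (A n w x - w ^ n *\<^sub>C (blinfun_apply T ^^ n) (A n w x))
      = (\<Sum>k<n. ?J k - w ^ n *\<^sub>C (blinfun_apply T ^^ n) (?J k))"
    using n by (simp add: A_def F.scaleR F.sum cscale.scaleR_right cscale.sum_right sum_subtractf scaleR_diff_right)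
  also have "\<dots> = (\<Sum>k<n. \<Sum>j<n. (?o ^ k * w) ^ j *\<^sub>C (blinfun_apply T ^^ j) x)"
    using J by simp
  also have "\<dots> = (\<Sum>j<n. \<Sum>k<n. (?o ^ k * w) ^ j *\<^sub>C (blinfun_apply T ^^ j) x)"
    by (rule sum.swap)
  also have "\<dots> = (\<Sum>j<n. (\<Sum>k<n. (?o ^ k) ^ j) *\<^sub>C w ^ j *\<^sub>C (blinfun_apply T ^^ j) x)"
    by (simp only: cscale.sum_left[symmetric] cscale_cscale power_mult_distrib sum_distrib_right)
  also have "\<dots> = (\<Sum>j<n. if j = 0 then real n *\<^sub>R x else 0)"
    by (rule sum.cong)
      (auto simp: sum_unity_root_powers cscale.zero_left cscale_of_real[symmetric])
  also have "\<dots> = real n *\<^sub>R x" using n by (simp add: sum.delta)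
  finally show ?thesis using n by simp
qed

theorem spectral_radius_lt:
  "(\<lambda>n. norm (op_power T n) / r ^ n) \<longlonglongrightarrow> 0"
proof -
  obtain M where M: "M > 0" "\<And>w y. norm w \<le> 1/r \<Longrightarrow> norm y \<le> M * norm (D w y)"
    using D_lower by auto
  \<comment> \<open>A Lipschitz constant of the resolvent \<open>J\<close> in \<open>w\<close>, from
    the resolvent identity; the added 1 makes it positive.\<close>
  define \<Lambda> where "\<Lambda> = M * (norm T * M) + 1"
  have Lam: "\<Lambda> > 0" using M unfolding \<Lambda>_def by (intro add_nonneg_pos) auto
  have Jb: "norm (J w x) \<le> M * norm x" if "norm w \<le> 1/r" for w x
    using M(2)[OF that, of "J w x"] D_J[OF that] by simp
  have Jlip: "norm (J w x - J w' x) \<le> \<Lambda> * norm (w - w') * norm x"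
    if w: "norm w \<le> 1/r" and w': "norm w' \<le> 1/r" for w w' x
  proof -
    interpret Dw: bounded_linear "D w" by (rule D_bl)
    have "D w (J w x - J w' x) = x - D w (J w' x)" using D_J[OF w] by (simp add: Dw.diff)
    also have "D w (J w' x) = D w' (J w' x) - (w - w') *\<^sub>C blinfun_apply T (J w' x)"
      by (simp add: D_def cscale.diff_left)
    finally have "D w (J w x - J w' x) = (w - w') *\<^sub>C blinfun_apply T (J w' x)"
      using D_J[OF w'] by simp
    hence "norm (J w x - J w' x) \<le> M * (norm (w - w') * norm (blinfun_apply T (J w' x)))"
      using M(2)[OF w, of "J w x - J w' x"] by (simp add: norm_cscale)
    also have "\<dots> \<le> M * (norm (w - w') * (norm T * (M * norm x)))"
      using M(1) by (intro mult_left_mono order_trans[OF norm_blinfun] Jb w') auto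
    also have "\<dots> \<le> \<Lambda> * norm (w - w') * norm x"
      by (simp add: \<Lambda>_def algebra_simps)
    finally show ?thesis .
  qed
  define b where "b n \<rho> = \<rho> ^ n * norm (op_power T n)" for n and \<rho> :: real
  have b0: "b n \<rho> \<ge> 0" if "\<rho> \<ge> 0" for n \<rho> using that by (simp add: b_def)
  \<comment> \<open>Write P for the n-th power of \<rho>' T and a for \<open>A n \<rho>' x\<close>.
    From a - P a = x follows P x = (a - x) - P (a - x), so a bound d on the distance of
    \<open>A\<close> from the identity bounds the norm of P by d (1 + norm P). That distance is
    small at \<rho> when \<open>b n \<rho>\<close> is, and \<open>A\<close> is Lipschitz in the
    radius.\<close>
  have key: "b n \<rho>' \<le> (M * b n \<rho> + \<Lambda> * \<bar>\<rho> - \<rho>'\<bar>) * (1 + b n \<rho>')"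
    if n: "n > 0" and \<rho>: "0 \<le> \<rho>" "\<rho> \<le> 1/r" and \<rho>': "0 \<le> \<rho>'" "\<rho>' \<le> 1/r" for n \<rho> \<rho>'
  proof -
    let ?o = "unity_root n"
    have nr: "norm (complex_of_real t) \<le> 1/r" if "0 \<le> t" "t \<le> 1/r" for t using that by simp
    let ?d = "M * b n \<rho> + \<Lambda> * \<bar>\<rho> - \<rho>'\<bar>"
    have d0: "?d \<ge> 0" using M Lam b0 \<rho> by (intro add_nonneg_nonneg mult_nonneg_nonneg) auto
    have Ab: "norm (A n (of_real \<rho>) x) \<le> M * norm x" for x
    proof -
      have "norm (\<Sum>k<n. J (?o ^ k * of_real \<rho>) x) \<le> (\<Sum>k<n. M * norm x)"
        using \<rho> by (intro sum_norm_le Jb) (simp add: norm_mult)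
      then show ?thesis using n by (simp add: A_def field_simps)
    qed
    have AA: "norm (A n (of_real \<rho>') x - A n (of_real \<rho>) x) \<le> \<Lambda> * \<bar>\<rho> - \<rho>'\<bar> * norm x" for x
    proof -
      have "norm (\<Sum>k<n. J (?o ^ k * of_real \<rho>') x - J (?o ^ k * of_real \<rho>) x) \<le> (\<Sum>k<n. \<Lambda> * \<bar>\<rho> - \<rho>'\<bar> * norm x)"
      proof (rule sum_norm_le)
        fix k
        have "norm (?o ^ k * of_real \<rho>' - ?o ^ k * of_real \<rho>) = \<bar>\<rho> - \<rho>'\<bar>"
          unfolding right_diff_distrib[symmetric] norm_mult
          by (simp add: abs_minus_commute flip: of_real_diff)
        then show "norm (J (?o ^ k * of_real \<rho>') x - J (?o ^ k * of_real \<rho>) x) \<le> \<Lambda> * \<bar>\<rho> - \<rho>'\<bar> * norm x"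
          using Jlip[of "?o ^ k * of_real \<rho>'" "?o ^ k * of_real \<rho>" x] \<rho> \<rho>' by (simp add: norm_mult)
      qed
      moreover have "A n (of_real \<rho>') x - A n (of_real \<rho>) x
          = (1 / real n) *\<^sub>R (\<Sum>k<n. J (?o ^ k * of_real \<rho>') x - J (?o ^ k * of_real \<rho>) x)"
        by (simp add: A_def sum_subtractf scaleR_diff_right)
      ultimately show ?thesis using n by (simp add: field_simps)
    qed
    have AI: "norm (A n (of_real \<rho>) x - x) \<le> M * b n \<rho> * norm x" for x
    proof -
      have "A n (of_real \<rho>) x - x = of_real \<rho> ^ n *\<^sub>C (blinfun_apply T ^^ n) (A n (of_real \<rho>) x)"
        using A_inverts[OF n nr[OF \<rho>], of x] by (simp add: algebra_simps)
      hence "norm (A n (of_real \<rho>) x - x) = \<rho> ^ n * norm ((blinfun_apply T ^^ n) (A n (of_real \<rho>) x))"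
        using \<rho> by (simp add: norm_cscale norm_power)
      also have "\<dots> \<le> \<rho> ^ n * (norm (op_power T n) * (M * norm x))"
        using \<rho> by (intro mult_left_mono order_trans[OF norm_funpow_le] Ab) auto
      finally show ?thesis by (simp add: b_def mult_ac)
    qed
    have d: "norm (A n (of_real \<rho>') x - x) \<le> ?d * norm x" for x
      using norm_triangle_ineq[of "A n (of_real \<rho>') x - A n (of_real \<rho>) x" "A n (of_real \<rho>) x - x"] AA[of x] AI[of x]
      by (simp add: algebra_simps)
    have "norm (\<rho>' ^ n *\<^sub>R blinfun_apply (op_power T n) x) \<le> ?d * (1 + b n \<rho>') * norm x" for x
    proof -
      let ?a = "A n (of_real \<rho>') x"
      interpret F: bounded_linear "blinfun_apply T ^^ n" by (rule funpow_bounded_linear)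
      have "\<rho>' ^ n *\<^sub>R (blinfun_apply T ^^ n) x = (?a - x) - \<rho>' ^ n *\<^sub>R (blinfun_apply T ^^ n) (?a - x)"
        using A_inverts[OF n nr[OF \<rho>'], of x]
        by (simp add: F.diff scaleR_diff_right cscale_of_real flip: of_real_power)
           (metis add_diff_cancel_left' diff_add_cancel)
      hence "norm (\<rho>' ^ n *\<^sub>R (blinfun_apply T ^^ n) x) \<le> norm (?a - x) + \<rho>' ^ n * norm ((blinfun_apply T ^^ n) (?a - x))"
        using \<rho>' by (metis abs_of_nonneg norm_scaleR norm_triangle_ineq4 zero_le_power)
      also have "\<dots> \<le> norm (?a - x) + \<rho>' ^ n * (norm (op_power T n) * norm (?a - x))"
        using \<rho>' by (intro add_left_mono mult_left_mono norm_funpow_le) auto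
      also have "\<dots> = (1 + b n \<rho>') * norm (?a - x)" by (simp add: b_def algebra_simps)
      also have "\<dots> \<le> (1 + b n \<rho>') * (?d * norm x)" using b0[of \<rho>' n] \<rho>' d by (intro mult_left_mono) auto
      finally show ?thesis by (simp add: op_power_apply mult_ac)
    qed
    hence "norm (\<rho>' ^ n *\<^sub>R op_power T n) \<le> ?d * (1 + b n \<rho>')"
      using d0 b0[of \<rho>' n] \<rho>' by (intro norm_blinfun_bound) (auto simp: blinfun.scaleR_left)
    then show ?thesis using \<rho>' by (simp add: b_def)
  qed
  \<comment> \<open>With the first factor of \<open>key\<close> at most 1/2, the bound
    \<open>b n \<rho>' \<le> 1\<close> follows for large n. Boundedness at \<rho>' implies decay at
    every smaller radius, and a second use of \<open>key\<close> from radii arbitrarily close to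
    \<rho>' makes the Lipschitz loss as small as desired.\<close>
  have step: "(\<lambda>n. b n \<rho>') \<longlonglongrightarrow> 0"
    if lim: "(\<lambda>n. b n \<rho>) \<longlonglongrightarrow> 0" and \<rho>: "0 \<le> \<rho>" "\<rho> \<le> \<rho>'" "\<rho>' \<le> 1/r" "\<Lambda> * (\<rho>' - \<rho>) \<le> 1/4" for \<rho> \<rho>'
  proof -
    have bdd: "\<forall>\<^sub>F n in sequentially. b n \<rho>' \<le> 1"
    proof -
      have "\<forall>\<^sub>F n in sequentially. b n \<rho> < 1 / (4 * M)" using order_tendstoD(2)[OF lim, of "1/(4*M)"] M by simp
      then show ?thesis using eventually_gt_at_top[of 0]
      proof eventually_elim
        case (elim n)
        have "M * b n \<rho> + \<Lambda> * \<bar>\<rho> - \<rho>'\<bar> \<le> 1/2" using elim M \<rho> by (simp add: field_simps)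
        hence "(M * b n \<rho> + \<Lambda> * \<bar>\<rho> - \<rho>'\<bar>) * (1 + b n \<rho>') \<le> 1/2 * (1 + b n \<rho>')"
          using b0[of \<rho>' n] \<rho> by (intro mult_right_mono) auto
        then show ?case using key[OF elim(2), of \<rho> \<rho>'] \<rho> by auto
      qed
    qed
    have below: "(\<lambda>n. b n t) \<longlonglongrightarrow> 0" if t: "0 \<le> t" "t < \<rho>'" for t
    proof (rule Lim_null_comparison[where g="\<lambda>n. (t/\<rho>') ^ n"])
      show "\<forall>\<^sub>F n in sequentially. norm (b n t) \<le> (t/\<rho>') ^ n"
        using bdd
      proof eventually_elim
        case (elim n)
        have "b n t = (t/\<rho>') ^ n * b n \<rho>'" using t by (simp add: b_def power_divide)
        then show ?case using elim t b0[of \<rho>' n] by (simp add: abs_mult mult_left_le)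
      qed
      show "(\<lambda>n. (t/\<rho>') ^ n) \<longlonglongrightarrow> 0" using t by (intro LIMSEQ_power_zero) auto
    qed
    show ?thesis
    proof (cases "\<rho>' = 0")
      case True
      then show ?thesis using lim \<rho> by simp
    next
      case False
      show ?thesis
      proof (rule LIMSEQ_I)
        fix \<epsilon> :: real assume \<epsilon>: "\<epsilon> > 0"
        define t where "t = max 0 (\<rho>' - \<epsilon> / (8 * \<Lambda>))"
        have t: "0 \<le> t" "t < \<rho>'" "\<Lambda> * \<bar>t - \<rho>'\<bar> \<le> \<epsilon>/8"
          using False \<rho> \<epsilon> Lam by (auto simp: t_def max_def abs_if field_simps)
        have "\<forall>\<^sub>F n in sequentially. b n t < \<epsilon> / (8 * M)" using order_tendstoD(2)[OF below[OF t(1,2)]] M \<epsilon> by simp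
        hence "\<forall>\<^sub>F n in sequentially. norm (b n \<rho>' - 0) < \<epsilon>" using bdd eventually_gt_at_top[of 0]
        proof eventually_elim
          case (elim n)
          have "M * b n t + \<Lambda> * \<bar>t - \<rho>'\<bar> \<le> \<epsilon>/4" using elim M t by (simp add: field_simps)
          hence "(M * b n t + \<Lambda> * \<bar>t - \<rho>'\<bar>) * (1 + b n \<rho>') \<le> \<epsilon>/4 * 2"
            using b0[of \<rho>' n] b0[of t n] \<rho> elim \<epsilon> by (intro mult_mono) auto
          then show ?case using key[OF elim(3), of t \<rho>'] \<rho> t b0[of \<rho>' n] \<epsilon> by auto
        qed
        then show "\<exists>no. \<forall>n\<ge>no. norm (b n \<rho>' - 0) < \<epsilon>" by (simp add: eventually_sequentially)
      qed
    qed
  qed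
  \<comment> \<open>A fixed step length with Lipschitz loss 1/4, so that finitely many steps lead
    from radius 0 to radius 1/r.\<close>
  define \<eta> where "\<eta> = 1 / (4 * \<Lambda>)"
  have \<eta>: "\<eta> > 0" "\<Lambda> * \<eta> = 1/4" using Lam by (auto simp: \<eta>_def)
  have "(\<lambda>n. b n (min (real k * \<eta>) (1/r))) \<longlonglongrightarrow> 0" for k
  proof (induction k)
    case 0
    have "\<forall>\<^sub>F n in sequentially. b n 0 = 0" using eventually_gt_at_top[of 0] by eventually_elim (simp add: b_def)
    then show ?case using r by (simp add: tendsto_eventually)
  next
    case (Suc k)
    have "\<Lambda> * (min (real (Suc k) * \<eta>) (1/r) - min (real k * \<eta>) (1/r)) \<le> \<Lambda> * \<eta>"
      using \<eta> Lam by (intro mult_left_mono) (auto simp: min_def algebra_simps)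
    then show ?case using \<eta> r by (intro step[OF Suc]) (auto simp: min_def algebra_simps)
  qed
  moreover obtain k where "1/r / \<eta> \<le> real k" using real_arch_simple by blast
  hence "1/r \<le> real k * \<eta>" using \<eta>(1) by (simp only: pos_divide_le_eq)
  hence "min (real k * \<eta>) (1/r) = 1/r" by simp
  ultimately have "(\<lambda>n. b n (1/r)) \<longlonglongrightarrow> 0" by metis
  then show ?thesis by (simp add: b_def power_divide)
qed

end

section \<open>Perturbation of a simple leading eigenvalue\<close>

lemma geometric_increments_limit:
  fixes s :: "nat \<Rightarrow> 'a::banach"
  assumes \<rho>: "0 \<le> \<rho>" "\<rho> < 1" and inc: "\<And>k. norm (s (Suc k) - s k) \<le> K * \<rho> ^ k"
  obtains l where "s \<longlonglongrightarrow> l" "\<And>k. norm (s k - l) \<le> K * \<rho> ^ k / (1 - \<rho>)"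
proof -
  have geo: "(\<lambda>k. K * \<rho> ^ k) sums (K * (1 / (1 - \<rho>)))"
    using \<rho> by (intro sums_mult geometric_sums) simp
  have "summable (\<lambda>k. s (Suc k) - s k)"
    by (rule summable_comparison_test'[OF sums_summable[OF geo], of 0]) (use inc in simp)
  hence "convergent (\<lambda>n. \<Sum>k<n. s (Suc k) - s k)" by (simp add: summable_iff_convergent)
  then obtain d where d: "(\<lambda>n. \<Sum>k<n. s (Suc k) - s k) \<longlonglongrightarrow> d" by (auto simp: convergent_def)
  have "(\<lambda>n. s 0 + (\<Sum>k<n. s (Suc k) - s k)) \<longlonglongrightarrow> s 0 + d" by (intro tendsto_intros d)
  hence lim: "s \<longlonglongrightarrow> s 0 + d" by (simp add: sum_lessThan_telescope)
  have "norm (s k - (s 0 + d)) \<le> K * \<rho> ^ k / (1 - \<rho>)" for k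
  proof -
    have "norm (s k - s (k + n)) \<le> K * \<rho> ^ k / (1 - \<rho>) - K * \<rho> ^ (k + n) / (1 - \<rho>)" for n
    proof (induction n)
      case (Suc n)
      have "norm (s k - s (k + Suc n)) \<le> norm (s k - s (k + n)) + norm (s (Suc (k + n)) - s (k + n))"
        using norm_triangle_ineq4[of "s k - s (k + n)" "s (Suc (k + n)) - s (k + n)"] by simp
      also have "\<dots> \<le> (K * \<rho> ^ k / (1 - \<rho>) - K * \<rho> ^ (k + n) / (1 - \<rho>)) + K * \<rho> ^ (k + n)"
        by (intro add_mono Suc inc)
      also have "\<dots> = K * \<rho> ^ k / (1 - \<rho>) - K * \<rho> ^ (k + Suc n) / (1 - \<rho>)"
      proof -
        have "K * \<rho> ^ (k + n) / (1 - \<rho>) - K * \<rho> ^ (k + Suc n) / (1 - \<rho>) = K * \<rho> ^ (k + n) * (1 - \<rho>) / (1 - \<rho>)"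
          by (simp add: algebra_simps diff_divide_distrib)
        then show ?thesis using \<rho> by simp
      qed
      finally show ?case .
    qed simp
    moreover have "0 \<le> K * \<rho> ^ (k + n) / (1 - \<rho>)" for n
      using order_trans[OF norm_ge_zero inc] \<rho> by (intro divide_nonneg_pos) auto
    ultimately have "norm (s k - s (k + n)) \<le> K * \<rho> ^ k / (1 - \<rho>)" for n
      by (smt (verit, ccfv_SIG))
    moreover have "(\<lambda>n. norm (s k - s (k + n))) \<longlonglongrightarrow> norm (s k - (s 0 + d))"
      using LIMSEQ_ignore_initial_segment[OF lim, of k] by (intro tendsto_intros) (simp add: add.commute)
    ultimately show ?thesis by (intro LIMSEQ_le_const2) auto
  qed
  then show thesis using that lim by blast
qed

text \<open>The seminorm \<open>V\<close> plays the role of an equivalent norm on the kernel of \<open>a\<close> for which the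
  unperturbed operator is a strict contraction relative to its leading eigenvalue.\<close>

locale adapted_seminorm =
  fixes a :: "'b::complex_banach \<Rightarrow> complex" and e :: 'b and V :: "'b \<Rightarrow> real" and C :: real
  assumes a: "clinear_functional a" and a_e: "a e = 1"
    and V_add: "V (x + y) \<le> V x + V y" and V_cscale: "V (c *\<^sub>C x) = cmod c * V x"
    and V_e: "V e = 0" and V_nonneg: "V x \<ge> 0"
    and V_bound: "V x \<le> C * norm x" and V_ker: "a x = 0 \<Longrightarrow> norm x \<le> V x"
begin

sublocale a: bounded_linear a using a by (simp add: clinear_functional_def)

lemma a_cscale: "a (c *\<^sub>C x) = c * a x" using a by (simp add: clinear_functional_def)

lemma V_diff: "V (x - y) \<le> V x + V y"
  using V_add[of x "(-1) *\<^sub>C y"] V_cscale[of "-1" y] by (simp add: cscale.minus_left)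

lemma norm_le: "norm x \<le> (1 + norm e) * (cmod (a x) + V x)"
proof -
  have "a (x - a x *\<^sub>C e) = 0" by (simp add: a.diff a_cscale a_e)
  hence "norm (x - a x *\<^sub>C e) \<le> V (x - a x *\<^sub>C e)" by (rule V_ker)
  also have "\<dots> \<le> V x" using V_diff[of x "a x *\<^sub>C e"] by (simp add: V_cscale V_e)
  finally have "norm x \<le> norm (a x *\<^sub>C e) + V x"
    using norm_triangle_ineq[of "x - a x *\<^sub>C e" "a x *\<^sub>C e"] by simp
  also have "\<dots> \<le> (1 + norm e) * (cmod (a x) + V x)"
    using V_nonneg[of x] by (simp add: norm_cscale algebra_simps)
  finally show ?thesis .
qed

text \<open>The normalised iterates of \<open>e\<close> contract to an eigenvector, and every other orbit splits into a
  multiple of that eigenvector and a remainder in the kernel of \<open>a\<close> decaying at the rate \<open>r + 2\<epsilon>\<close>.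
  All constants are independent of \<open>T\<close>, which makes the eigenvalue a uniform limit of ratios.\<close>

lemma perturbed_iterates:
  fixes lam r \<epsilon> :: real
  assumes T: "clinear_op T" and r: "0 \<le> r" and \<epsilon>: "0 < \<epsilon>" and gap: "r + 4 * \<epsilon> < lam"
    and aT: "\<And>x. cmod (a (blinfun_apply T x) - lam * a x) \<le> \<epsilon> * (cmod (a x) + V x)"
    and VT: "\<And>x. V (blinfun_apply T x) \<le> r * V x + \<epsilon> * (cmod (a x) + V x)"
  defines "q \<equiv> (r + 2 * \<epsilon>) / (lam - 2 * \<epsilon>)"
  obtains \<mu> :: complex where "cmod (\<mu> - lam) \<le> 2 * \<epsilon>"
    and "\<And>k. a ((blinfun_apply T ^^ k) e) \<noteq> 0"
    and "\<And>k. cmod (a ((blinfun_apply T ^^ Suc k) e) / a ((blinfun_apply T ^^ k) e) - \<mu>) \<le> 2 * \<epsilon> * q ^ k / (1 - q)"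
    and "\<And>v. \<exists>w. \<forall>N. norm ((blinfun_apply T ^^ N) v - \<mu> ^ N *\<^sub>C w)
               \<le> (V v + cmod (a v)) * (1 + \<epsilon> / (lam - r - 4 * \<epsilon>) * (norm e + 1)) * (r + 2 * \<epsilon>) ^ N"
proof -
  let ?T = "blinfun_apply T"
  let ?p = "r + 2 * \<epsilon>"
  let ?l = "lam - 2 * \<epsilon>"
  have l: "?l > 0" and pl: "?p < ?l" and p: "?p > 0" using r \<epsilon> gap by auto
  have q: "0 \<le> q" "q < 1" using l pl p by (auto simp: q_def)
  have aT1: "cmod (a (?T x) - lam) \<le> 2 * \<epsilon>" and VT1: "V (?T x) \<le> ?p"
    and aT2: "cmod (a (?T x)) \<ge> ?l" if "a x = 1" "V x \<le> 1" for x
  proof -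
    have "\<epsilon> * (cmod (a x) + V x) \<le> \<epsilon> * 2" using that \<epsilon> by (intro mult_left_mono) auto
    moreover have "r * V x \<le> r * 1" using that r by (intro mult_left_mono) auto
    ultimately show 1: "cmod (a (?T x) - lam) \<le> 2 * \<epsilon>" "V (?T x) \<le> ?p"
      using aT[of x] VT[of x] that by auto
    have "lam = cmod (complex_of_real lam)" using l \<epsilon> by simp
    also have "\<dots> \<le> cmod (a (?T x)) + cmod (a (?T x) - lam)" by (metis norm_triangle_sub norm_minus_commute)
    finally show "cmod (a (?T x)) \<ge> ?l" using 1 by simp
  qed
  have aT0: "cmod (a (?T x)) \<le> \<epsilon> * V x" and VT0: "V (?T x) \<le> (r + \<epsilon>) * V x" if "a x = 0" for x
    using aT[of x] VT[of x] that by (auto simp: algebra_simps)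

  define h where "h k = (1 / a ((?T ^^ k) e)) *\<^sub>C (?T ^^ k) e" for k
  define m where "m k = a (?T (h k))" for k
  have hk: "a ((?T ^^ k) e) \<noteq> 0 \<and> a (h k) = 1 \<and> V (h k) \<le> 1 \<and> ?T (h k) = m k *\<^sub>C h (Suc k) \<and>
      m k = a ((?T ^^ Suc k) e) / a ((?T ^^ k) e) \<and> a ((?T ^^ Suc k) e) \<noteq> 0 \<and> cmod (m k) \<ge> ?l" for k
  proof -
    have step: "a ((?T ^^ Suc k) e) \<noteq> 0 \<and> cmod (m k) \<ge> ?l \<and> V (h (Suc k)) \<le> 1 \<and> ?T (h k) = m k *\<^sub>C h (Suc k) \<and>
      m k = a ((?T ^^ Suc k) e) / a ((?T ^^ k) e)"
      if "a ((?T ^^ k) e) \<noteq> 0" "a (h k) = 1" "V (h k) \<le> 1" for k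
    proof -
      have Th: "?T (h k) = (1 / a ((?T ^^ k) e)) *\<^sub>C (?T ^^ Suc k) e" by (simp add: h_def clinear_opD[OF T])
      have mk: "m k = a ((?T ^^ Suc k) e) / a ((?T ^^ k) e)" unfolding m_def Th by (simp add: a_cscale)
      have ml: "cmod (m k) \<ge> ?l" using aT2[OF that(2,3)] by (simp add: m_def)
      hence nz: "m k \<noteq> 0" "a ((?T ^^ Suc k) e) \<noteq> 0" using l mk by auto
      have Th2: "?T (h k) = m k *\<^sub>C h (Suc k)" unfolding Th h_def[of "Suc k"] cscale_cscale mk using nz by simp
      hence "V (?T (h k)) = cmod (m k) * V (h (Suc k))" by (simp only: V_cscale)
      hence "cmod (m k) * V (h (Suc k)) \<le> ?p" using VT1[OF that(2,3)] by simp
      hence "?l * V (h (Suc k)) \<le> ?l * 1" using ml V_nonneg[of "h (Suc k)"] pl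
        by (smt (verit, best) mult_right_mono)
      hence "V (h (Suc k)) \<le> 1" using l by (simp only: mult_le_cancel_left_pos)
      then show ?thesis using nz ml Th2 mk by blast
    qed
    have "a ((?T ^^ k) e) \<noteq> 0 \<and> a (h k) = 1 \<and> V (h k) \<le> 1"
    proof (induction k)
      case 0
      then show ?case by (simp add: h_def a_e V_e)
    next
      case (Suc k)
      then show ?case using step[of k] by (auto simp: h_def a_cscale)
    qed
    then show ?thesis using step[of k] by blast
  qed
  \<comment> \<open>Consecutive normalised iterates differ by an element of the kernel of
    \<open>a\<close>. There \<open>T\<close> multiplies \<open>V\<close> by at most
    \<open>r + \<epsilon>\<close> and leaks at most \<open>\<epsilon> * V\<close> into
    \<open>a\<close>; renormalising divides by at least \<open>?l\<close>. Together this is the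
    ratio \<open>q\<close>.\<close>
  define d where "d k = h (Suc k) - h k" for k
  have ad: "a (d k) = 0" for k using hk[of k] hk[of "Suc k"] by (simp add: d_def a.diff)
  have md: "m (Suc k) - m k = a (?T (d k))" for k
    by (simp add: m_def d_def blinfun.diff_right a.diff)
  have Vd: "V (d k) \<le> 2 * q ^ k" for k
  proof (induction k)
    case 0
    then show ?case using V_diff[of "h 1" "h 0"] hk[of 0] hk[of 1] by (simp add: d_def)
  next
    case (Suc k)
    have "m (Suc k) *\<^sub>C d (Suc k) = ?T (h (Suc k)) - m (Suc k) *\<^sub>C h (Suc k)"
      using hk[of "Suc k"] by (simp add: d_def cscale.diff_right)
    also have "\<dots> = ?T (d k) - (m (Suc k) - m k) *\<^sub>C h (Suc k)"
      using hk[of k] by (simp add: d_def blinfun.diff_right cscale.diff_left)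
    finally have "cmod (m (Suc k)) * V (d (Suc k)) \<le> V (?T (d k)) + cmod (m (Suc k) - m k) * V (h (Suc k))"
      using V_diff[of "?T (d k)" "(m (Suc k) - m k) *\<^sub>C h (Suc k)"] by (metis V_cscale)
    also have "\<dots> \<le> (r + \<epsilon>) * V (d k) + (\<epsilon> * V (d k)) * 1"
      using VT0[OF ad] aT0[OF ad] hk[of "Suc k"] V_nonneg \<epsilon> unfolding md
      by (intro add_mono mult_mono) auto
    also have "\<dots> = ?p * V (d k)" by (simp add: algebra_simps)
    finally have "?l * V (d (Suc k)) \<le> ?p * V (d k)"
      using hk[of "Suc k"] V_nonneg[of "d (Suc k)"] by (smt (verit, best) mult_right_mono)
    hence "V (d (Suc k)) \<le> q * V (d k)" using l by (simp add: q_def field_simps)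
    also have "\<dots> \<le> q * (2 * q ^ k)" using Suc q by (intro mult_left_mono) auto
    finally show ?case by simp
  qed
  have "norm (h (Suc k) - h k) \<le> 2 * q ^ k" for k
    using V_ker[OF ad[of k]] Vd[of k] by (simp add: d_def)
  then obtain H where H: "h \<longlonglongrightarrow> H" using geometric_increments_limit[OF q] by metis
  have "cmod (m (Suc k) - m k) \<le> (2 * \<epsilon>) * q ^ k" for k
  proof -
    have "cmod (m (Suc k) - m k) \<le> \<epsilon> * V (d k)" using aT0[OF ad] by (simp add: md)
    also have "\<dots> \<le> \<epsilon> * (2 * q ^ k)" using Vd \<epsilon> by (intro mult_left_mono) auto
    finally show ?thesis by simp
  qed
  then obtain \<mu> where \<mu>: "m \<longlonglongrightarrow> \<mu>" "\<And>k. cmod (m k - \<mu>) \<le> 2 * \<epsilon> * q ^ k / (1 - q)"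
    using geometric_increments_limit[OF q] by metis
  have aH: "a H = 1"
    using LIMSEQ_unique[OF a.tendsto[OF H]] hk by (simp add: tendsto_const)
  have VH: "V H \<le> 1"
  proof -
    have "V H \<le> 1 + C * norm (H - h k)" for k
      using V_add[of "h k" "H - h k"] hk[of k] V_bound[of "H - h k"] by auto
    moreover have "(\<lambda>k. 1 + C * norm (H - h k)) \<longlonglongrightarrow> 1 + C * norm (H - H)" by (intro tendsto_intros H)
    ultimately show ?thesis by (intro LIMSEQ_le_const[where X="\<lambda>k. 1 + C * norm (H - h k)"]) auto
  qed
  have TH: "?T H = \<mu> *\<^sub>C H"
  proof -
    have "(\<lambda>k. ?T (h k)) \<longlonglongrightarrow> ?T H" by (intro tendsto_intros H)
    moreover have "(\<lambda>k. m k *\<^sub>C h (Suc k)) \<longlonglongrightarrow> \<mu> *\<^sub>C H"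
      by (intro cscale.tendsto \<mu> LIMSEQ_Suc H)
    ultimately show ?thesis using hk LIMSEQ_unique by simp
  qed
  have \<mu>a: "\<mu> = a (?T H)" by (simp add: TH a_cscale aH)
  have \<mu>l: "cmod (\<mu> - lam) \<le> 2 * \<epsilon>" and \<mu>2: "cmod \<mu> \<ge> ?l"
    unfolding \<mu>a using aT1[OF aH VH] aT2[OF aH VH] by auto
  have nH: "norm H \<le> norm e + 1"
  proof -
    have "norm (H - e) \<le> V (H - e)" by (rule V_ker) (simp add: a.diff aH a_e)
    also have "\<dots> \<le> 1" using V_diff[of H e] VH V_e by simp
    finally show ?thesis using norm_triangle_sub[of H e] by simp
  qed
  have main: "\<exists>w. \<forall>N. norm ((?T ^^ N) v - \<mu> ^ N *\<^sub>C w)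
               \<le> (V v + cmod (a v)) * (1 + \<epsilon> / (lam - r - 4 * \<epsilon>) * (norm e + 1)) * ?p ^ N" for v
  proof -
    let ?V0 = "V v + cmod (a v)"
    \<comment> \<open>Removing the \<open>H\<close> component after each application keeps the
      remainder in the kernel of \<open>a\<close>. What is removed feeds the scalar recursion
      \<open>\<alpha>S\<close>: multiplication by \<mu> plus an error of order
      \<open>?p ^ k\<close>, so \<alpha> rescaled by powers of \<mu> converges
      geometrically.\<close>
    define y where "y = rec_nat (v - a v *\<^sub>C H) (\<lambda>_ u. ?T u - a (?T u) *\<^sub>C H)"
    define \<alpha> where "\<alpha> k = a ((?T ^^ k) v)" for k
    have y0: "y 0 = v - a v *\<^sub>C H" and yS: "y (Suc k) = ?T (y k) - a (?T (y k)) *\<^sub>C H" for k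
      by (simp_all add: y_def)
    have ay: "a (y k) = 0" for k by (cases k) (simp_all add: y0 yS a.diff a_cscale aH)
    have Vy: "V (y k) \<le> ?V0 * ?p ^ k" for k
    proof (induction k)
      case 0
      have "V (y 0) \<le> V v + cmod (a v) * V H" using V_diff[of v "a v *\<^sub>C H"] by (simp add: y0 V_cscale)
      also have "\<dots> \<le> ?V0" using VH by (simp add: mult_left_le)
      finally show ?case by simp
    next
      case (Suc k)
      have "V (y (Suc k)) \<le> V (?T (y k)) + cmod (a (?T (y k))) * V H"
        using V_diff[of "?T (y k)" "a (?T (y k)) *\<^sub>C H"] by (simp add: yS V_cscale)
      also have "\<dots> \<le> (r + \<epsilon>) * V (y k) + (\<epsilon> * V (y k)) * 1"
        using VT0[OF ay] aT0[OF ay] VH V_nonneg \<epsilon> by (intro add_mono mult_mono) auto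
      also have "\<dots> = ?p * V (y k)" by (simp add: algebra_simps)
      also have "\<dots> \<le> ?p * (?V0 * ?p ^ k)" using Suc p by (intro mult_left_mono) auto
      finally show ?case by (simp add: mult_ac)
    qed
    have dec: "(?T ^^ k) v = \<alpha> k *\<^sub>C H + y k" for k
    proof (induction k)
      case (Suc k)
      have "(?T ^^ Suc k) v = ?T (\<alpha> k *\<^sub>C H + y k)" using Suc by simp
      also have "\<dots> = (\<alpha> k * \<mu> + a (?T (y k))) *\<^sub>C H + y (Suc k)"
        by (simp add: blinfun.add_right clinear_opD[OF T] TH cscale_cscale yS cscale.add_left)
      finally have *: "(?T ^^ Suc k) v = (\<alpha> k * \<mu> + a (?T (y k))) *\<^sub>C H + y (Suc k)" .
      have "\<alpha> (Suc k) = \<alpha> k * \<mu> + a (?T (y k))"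
        unfolding \<alpha>_def[of "Suc k"] * by (simp add: a.add a_cscale aH ay)
      then show ?case using * by simp
    qed (simp add: \<alpha>_def y0)
    have \<alpha>S: "\<alpha> (Suc k) = \<alpha> k * \<mu> + a (?T (y k))" for k
    proof -
      have "\<alpha> (Suc k) = a (?T (\<alpha> k *\<^sub>C H + y k))" using dec[of k] by (simp add: \<alpha>_def)
      then show ?thesis by (simp add: blinfun.add_right clinear_opD[OF T] TH cscale_cscale a.add a_cscale aH)
    qed
    have mu0: "cmod \<mu> > 0" "\<mu> \<noteq> 0" using \<mu>2 l by auto
    define \<rho> where "\<rho> = ?p / cmod \<mu>"
    have \<rho>: "0 \<le> \<rho>" "\<rho> < 1" using mu0 p pl \<mu>2 by (auto simp: \<rho>_def)
    have "cmod (\<alpha> (Suc k) / \<mu> ^ Suc k - \<alpha> k / \<mu> ^ k) \<le> (\<epsilon> * ?V0 / cmod \<mu>) * \<rho> ^ k" for k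
    proof -
      have "\<alpha> (Suc k) / \<mu> ^ Suc k - \<alpha> k / \<mu> ^ k = a (?T (y k)) / \<mu> ^ Suc k"
        using mu0 by (simp add: \<alpha>S field_simps)
      hence "cmod (\<alpha> (Suc k) / \<mu> ^ Suc k - \<alpha> k / \<mu> ^ k) = cmod (a (?T (y k))) / cmod \<mu> ^ Suc k"
        by (simp only: norm_divide norm_power)
      also have "\<dots> \<le> (\<epsilon> * (?V0 * ?p ^ k)) / cmod \<mu> ^ Suc k"
        using \<epsilon> by (intro divide_right_mono order_trans[OF aT0[OF ay]] mult_left_mono Vy) auto
      also have "\<dots> = (\<epsilon> * ?V0 / cmod \<mu>) * \<rho> ^ k" by (simp add: \<rho>_def power_divide)
      finally show ?thesis .
    qed
    then obtain \<gamma> where \<gamma>: "\<And>k. cmod (\<alpha> k / \<mu> ^ k - \<gamma>) \<le> (\<epsilon> * ?V0 / cmod \<mu>) * \<rho> ^ k / (1 - \<rho>)"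
      using geometric_increments_limit[OF \<rho>, of "\<lambda>k. \<alpha> k / \<mu> ^ k"] by metis
    have V00: "?V0 \<ge> 0" using V_nonneg[of v] by simp
    have a\<gamma>: "cmod (\<alpha> k - \<mu> ^ k * \<gamma>) \<le> ?V0 * (\<epsilon> / (lam - r - 4 * \<epsilon>)) * ?p ^ k" for k
    proof -
      have "\<alpha> k - \<mu> ^ k * \<gamma> = \<mu> ^ k * (\<alpha> k / \<mu> ^ k - \<gamma>)" using mu0 by (simp add: field_simps)
      hence "cmod (\<alpha> k - \<mu> ^ k * \<gamma>) = cmod \<mu> ^ k * cmod (\<alpha> k / \<mu> ^ k - \<gamma>)" by (simp only: norm_mult norm_power)
      also have "\<dots> \<le> cmod \<mu> ^ k * ((\<epsilon> * ?V0 / cmod \<mu>) * \<rho> ^ k / (1 - \<rho>))" by (intro mult_left_mono \<gamma>) auto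
      also have "\<dots> = (\<epsilon> * ?V0 * ?p ^ k) * (1 / (cmod \<mu> * (1 - \<rho>)))"
        using mu0 by (simp add: \<rho>_def power_divide)
      also have "cmod \<mu> * (1 - \<rho>) = cmod \<mu> - ?p" using mu0 by (simp add: \<rho>_def right_diff_distrib)
      also have "(\<epsilon> * ?V0 * ?p ^ k) * (1 / (cmod \<mu> - ?p)) \<le> (\<epsilon> * ?V0 * ?p ^ k) * (1 / (lam - r - 4 * \<epsilon>))"
        using \<mu>2 gap V00 \<epsilon> p by (intro mult_left_mono divide_left_mono mult_nonneg_nonneg) auto
      finally show ?thesis by (simp add: mult_ac)
    qed
    have "norm ((?T ^^ N) v - \<mu> ^ N *\<^sub>C (\<gamma> *\<^sub>C H)) \<le> ?V0 * (1 + \<epsilon> / (lam - r - 4 * \<epsilon>) * (norm e + 1)) * ?p ^ N" for N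
    proof -
      have "(?T ^^ N) v - \<mu> ^ N *\<^sub>C (\<gamma> *\<^sub>C H) = (\<alpha> N - \<mu> ^ N * \<gamma>) *\<^sub>C H + y N"
        by (simp add: dec cscale.diff_left cscale_cscale)
      hence "norm ((?T ^^ N) v - \<mu> ^ N *\<^sub>C (\<gamma> *\<^sub>C H)) \<le> cmod (\<alpha> N - \<mu> ^ N * \<gamma>) * norm H + norm (y N)"
        by (metis norm_cscale norm_triangle_ineq)
      also have "\<dots> \<le> (?V0 * (\<epsilon> / (lam - r - 4 * \<epsilon>)) * ?p ^ N) * (norm e + 1) + ?V0 * ?p ^ N"
        using a\<gamma>[of N] nH V_ker[OF ay[of N]] Vy[of N] V00 gap \<epsilon> p
        by (intro add_mono mult_mono) auto
      also have "\<dots> = ?V0 * (1 + \<epsilon> / (lam - r - 4 * \<epsilon>) * (norm e + 1)) * ?p ^ N"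
        by (simp add: algebra_simps)
      finally show ?thesis .
    qed
    then show ?thesis by blast
  qed
  show thesis
  proof (rule that[of \<mu>])
    show "cmod (a ((?T ^^ Suc k) e) / a ((?T ^^ k) e) - \<mu>) \<le> 2 * \<epsilon> * q ^ k / (1 - q)" for k
      using \<mu>(2)[of k] hk[of k] by simp
  qed (use \<mu>l hk main in auto)
qed

end

text \<open>The range is a line, so the projection has rank one, and its coefficient functional is a
  left eigenvector because the projection commutes with \<open>T\<close>. It is the functional that
  an adapted seminorm is built around.\<close>

lemma simple_eigenprojection_functional:
  fixes T P :: "'b::complex_banach \<Rightarrow>\<^sub>L 'b"
  assumes "simple_eigenprojection T \<mu> P"
  obtains a :: "'b \<Rightarrow> complex" and e where "clinear_functional a" "a e = 1" "\<And>x. blinfun_apply P x = a x *\<^sub>C e"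
    "\<And>x. a (blinfun_apply T x) = \<mu> * a x" "blinfun_apply P e = e"
proof -
  have Pc: "clinear_op P" and PP: "P o\<^sub>L P = P" and PT: "P o\<^sub>L T = T o\<^sub>L P"
    and TP: "\<forall>x\<in>range (blinfun_apply P). blinfun_apply T x = \<mu> *\<^sub>C x"
    using assms by (auto simp: simple_eigenprojection_def)
  obtain e where e: "e \<noteq> 0" and ran: "range (blinfun_apply P) = range (\<lambda>c. c *\<^sub>C e)"
    using assms by (auto simp: simple_eigenprojection_def)
  have "\<exists>c. blinfun_apply P x = c *\<^sub>C e" for x using ran by blast
  then obtain a where Pa: "\<And>x. blinfun_apply P x = a x *\<^sub>C e" by metis
  have inj: "c *\<^sub>C e = d *\<^sub>C e \<Longrightarrow> c = d" for c d
    using e by (metis cscale.diff_left cscale_eq_0_iff eq_iff_diff_eq_0)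
  have "e \<in> range (blinfun_apply P)" using ran by (metis cscale_one rangeI)
  hence Pe: "blinfun_apply P e = e" using PP by (metis blinfun_apply_blinfun_compose imageE)
  hence ae: "a e = 1" using inj[of "a e" 1] Pa[of e] by simp
  have "bounded_linear a"
  proof (rule bounded_linear_intro[where K="norm P / norm e"])
    show "a (x + y) = a x + a y" for x y
      by (rule inj) (simp add: cscale.add_left blinfun.add_right flip: Pa)
    show "a (r *\<^sub>R x) = r *\<^sub>R a x" for r x
      by (rule inj) (simp add: cscale.scaleR_left blinfun.scaleR_right flip: Pa)
    show "norm (a x) \<le> norm x * (norm P / norm e)" for x
      using norm_blinfun[of P x] e by (simp add: Pa norm_cscale field_simps)
  qed
  moreover have "a (c *\<^sub>C x) = c * a x" for c x
    by (rule inj) (simp add: clinear_opD[OF Pc] flip: Pa cscale_cscale)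
  ultimately have a: "clinear_functional a" by (simp add: clinear_functional_def)
  have "a (blinfun_apply T x) = \<mu> * a x" for x
  proof (rule inj)
    have "blinfun_apply P (blinfun_apply T x) = blinfun_apply T (blinfun_apply P x)"
      using PT by (metis blinfun_apply_blinfun_compose)
    then show "a (blinfun_apply T x) *\<^sub>C e = (\<mu> * a x) *\<^sub>C e"
      using TP by (simp add: cscale_cscale[symmetric] flip: Pa)
  qed
  then show thesis using that a ae Pa Pe by blast
qed

text \<open>T (1 - P) agrees with T on the kernel of P and vanishes on the range of P. For \<nu> of
  modulus at least r > 0 the range part is multiplication by - \<nu>. The kernel part is invertible
  by simplicity if \<nu> = \<mu>, and otherwise because T - \<nu> is bijective and commutes with
  P.\<close>

lemma complement_spectrum:
  assumes P: "simple_eigenprojection T \<mu> P" and T: "clinear_op T"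
    and r: "r > 0" and gap: "op_spectrum T - {\<mu>} \<subseteq> ball 0 r"
  shows "op_spectrum (T o\<^sub>L (id_blinfun - P)) \<subseteq> ball 0 r"
proof (rule ccontr)
  let ?T = "blinfun_apply T" and ?P = "blinfun_apply P" and ?U = "blinfun_apply (T o\<^sub>L (id_blinfun - P))"
  let ?K = "{x. ?P x = 0}"
  assume "\<not> op_spectrum (T o\<^sub>L (id_blinfun - P)) \<subseteq> ball 0 r"
  then obtain \<nu> where \<nu>: "\<nu> \<in> op_spectrum (T o\<^sub>L (id_blinfun - P))" "norm \<nu> \<ge> r" by force
  hence \<nu>0: "\<nu> \<noteq> 0" using r by auto
  have Pc: "clinear_op P" and PP: "\<And>x. ?P (?P x) = ?P x" and PT: "\<And>x. ?P (?T x) = ?T (?P x)"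
    using P unfolding simple_eigenprojection_def by (metis blinfun_apply_blinfun_compose)+
  have PD: "?P (?T x - \<nu> *\<^sub>C x) = ?T (?P x) - \<nu> *\<^sub>C ?P x" for x
    by (simp add: blinfun.diff_right PT clinear_opD[OF Pc])
  have bijK: "bij_betw (\<lambda>x. ?T x - \<nu> *\<^sub>C x) ?K ?K"
  proof (cases "\<nu> = \<mu>")
    case True
    then show ?thesis using P by (simp add: simple_eigenprojection_def spectrum_on_def)
  next
    case False
    hence "\<nu> \<notin> op_spectrum T" using gap \<nu>(2) by auto
    hence bij: "bij (\<lambda>x. ?T x - \<nu> *\<^sub>C x)" by (simp add: spectrum_on_def)
    have D0: "x = 0" if "?T x - \<nu> *\<^sub>C x = 0" for x
      using injD[OF bij_is_inj[OF bij], of x 0] that by (simp add: cscale.zero_right)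
    show ?thesis unfolding bij_betw_def
    proof (intro conjI equalityI subsetI)
      show "inj_on (\<lambda>x. ?T x - \<nu> *\<^sub>C x) ?K" using bij_is_inj[OF bij] by (rule inj_on_subset) simp
      fix y assume "y \<in> (\<lambda>x. ?T x - \<nu> *\<^sub>C x) ` ?K"
      then show "y \<in> ?K" using PD by (auto simp: cscale.zero_right)
    next
      fix y assume y: "y \<in> ?K"
      obtain x where x: "y = ?T x - \<nu> *\<^sub>C x" using surjD[OF bij_is_surj[OF bij]] by blast
      hence "?P x = 0" using y PD[of x] by - (rule D0, simp)
      then show "y \<in> (\<lambda>x. ?T x - \<nu> *\<^sub>C x) ` ?K" by (intro image_eqI[where x=x] x) simp
    qed
  qed
  have U: "?U x = ?T (x - ?P x)" for x by (simp add: blinfun.diff_left blinfun.diff_right)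
  have PU: "?P (?U x) = 0" for x by (simp only: U PT blinfun.diff_right PP) simp
  have "bij (\<lambda>x. ?U x - \<nu> *\<^sub>C x)" unfolding bij_def
  proof
    show "inj (\<lambda>x. ?U x - \<nu> *\<^sub>C x)"
    proof (rule injI)
      fix x y assume "?U x - \<nu> *\<^sub>C x = ?U y - \<nu> *\<^sub>C y"
      hence *: "?U (x - y) - \<nu> *\<^sub>C (x - y) = 0" by (simp only: blinfun.diff_right cscale.diff_right) (simp add: algebra_simps)
      hence "?P (?U (x - y)) - \<nu> *\<^sub>C ?P (x - y) = 0"
        by (metis blinfun.diff_right blinfun.zero_right clinear_opD[OF Pc])
      hence P0: "?P (x - y) = 0" using \<nu>0 unfolding PU by simp
      hence "?T (x - y) - \<nu> *\<^sub>C (x - y) = ?T 0 - \<nu> *\<^sub>C 0" using * unfolding U by (simp add: cscale.zero_right)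
      hence "x - y = 0" using inj_onD[OF bij_betw_imp_inj_on[OF bijK], of "x - y" 0] P0 by simp
      then show "x = y" by simp
    qed
    show "surj (\<lambda>x. ?U x - \<nu> *\<^sub>C x)"
    proof (rule surjI)
      fix y
      \<comment> \<open>The preimage is assembled from the two parts: T - \<nu> is inverted on the
        kernel of P, and - \<nu> on its range.\<close>
      let ?x = "\<lambda>y. inv_into ?K (\<lambda>x. ?T x - \<nu> *\<^sub>C x) (y - ?P y) - (1/\<nu>) *\<^sub>C ?P y"
      have yK: "y - ?P y \<in> ?K" by (simp add: blinfun.diff_right PP)
      define x1 where "x1 = inv_into ?K (\<lambda>x. ?T x - \<nu> *\<^sub>C x) (y - ?P y)"
      have img: "y - ?P y \<in> (\<lambda>x. ?T x - \<nu> *\<^sub>C x) ` ?K" using bijK yK unfolding bij_betw_def by simp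
      have x1: "?P x1 = 0" "?T x1 - \<nu> *\<^sub>C x1 = y - ?P y"
        using inv_into_into[OF img] f_inv_into_f[OF img] by (simp_all add: x1_def)
      have "?P (x1 - (1/\<nu>) *\<^sub>C ?P y) = - ((1/\<nu>) *\<^sub>C ?P y)"
        by (simp add: blinfun.diff_right clinear_opD[OF Pc] PP x1)
      hence "?U (x1 - (1/\<nu>) *\<^sub>C ?P y) = ?T x1" unfolding U by simp
      hence "?U (x1 - (1/\<nu>) *\<^sub>C ?P y) - \<nu> *\<^sub>C (x1 - (1/\<nu>) *\<^sub>C ?P y) = (?T x1 - \<nu> *\<^sub>C x1) + ?P y"
        using \<nu>0 by (simp add: cscale.diff_right cscale_cscale)
      then show "?U (?x y) - \<nu> *\<^sub>C (?x y) = y" using x1 by (simp add: x1_def)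
    qed
  qed
  with \<nu> show False by (simp add: spectrum_on_def)
qed

text \<open>The usual renorming. The supremum over n of norm (U^n (x - P x)) / r^n is finite by the
  spectral radius bound for U = T (1 - P). Its term n = 0 dominates the norm on the kernel of P, and
  shifting n shows that T multiplies it by at most r.\<close>

lemma adapted_seminorm_exists:
  fixes T P :: "'b::complex_banach \<Rightarrow>\<^sub>L 'b"
  assumes P: "simple_eigenprojection T (complex_of_real lam) P" and T: "clinear_op T"
    and lam: "lam > 0" and gap: "\<exists>r<lam. op_spectrum T - {complex_of_real lam} \<subseteq> ball 0 r"
  obtains a :: "'b \<Rightarrow> complex" and e V C r where "adapted_seminorm a e V C" "0 < r" "r < lam"
    "\<And>x. blinfun_apply P x = a x *\<^sub>C e"
    "\<And>x. a (blinfun_apply T x) = lam * a x" "\<And>x. V (blinfun_apply T x) \<le> r * V x"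
    "blinfun_apply T e = lam *\<^sub>C e"
proof -
  let ?T = "blinfun_apply T" and ?P = "blinfun_apply P"
  obtain r0 where r0: "r0 < lam" "op_spectrum T - {complex_of_real lam} \<subseteq> ball 0 r0" using gap by blast
  \<comment> \<open>\<open>r0\<close> may be nonpositive, while the division by \<open>r ^ n\<close>
    needs a positive radius.\<close>
  define r where "r = max r0 (lam / 2)"
  have r: "0 < r" "r < lam" using r0 lam by (auto simp: r_def)
  define U where "U = T o\<^sub>L (id_blinfun - P)"
  let ?U = "blinfun_apply U"
  obtain a :: "'b \<Rightarrow> complex" and e where a: "clinear_functional a" "a e = 1" and Pa: "\<And>x. ?P x = a x *\<^sub>C e"
    and aT: "\<And>x. a (?T x) = lam * a x" and Pe: "?P e = e"
    by (rule simple_eigenprojection_functional[OF P]) blast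
  have Pc: "clinear_op P" and PP: "\<And>x. ?P (?P x) = ?P x" and PT: "\<And>x. ?P (?T x) = ?T (?P x)"
    using P unfolding simple_eigenprojection_def by (metis blinfun_apply_blinfun_compose)+
  have Te: "?T e = lam *\<^sub>C e" using P Pe unfolding simple_eigenprojection_def by (metis rangeI)
  have Uap: "?U x = ?T (x - ?P x)" for x by (simp add: U_def blinfun.diff_left blinfun.diff_right)
  have Uc: "clinear_op U" unfolding clinear_op_def Uap
    by (simp add: clinear_opD[OF Pc] clinear_opD[OF T] flip: cscale.diff_right)
  have "op_spectrum U \<subseteq> ball 0 r" unfolding U_def
    using r0(2) by (intro complement_spectrum[OF P T r(1)]) (auto simp: r_def)
  hence "(\<lambda>n. norm (op_power U n) / r ^ n) \<longlonglongrightarrow> 0" by (rule spectral_radius_lt[OF Uc r(1)])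
  hence "Bseq (\<lambda>n. norm (op_power U n) / r ^ n)" by (intro convergent_imp_Bseq convergentI)
  then obtain B where B: "B > 0" "\<And>n. norm (norm (op_power U n) / r ^ n) \<le> B" by (auto simp: Bseq_def)
  define f where "f x n = norm ((?U ^^ n) (x - ?P x)) / r ^ n" for x n
  define C where "C = B * (1 + norm P)"
  define V where "V x = (SUP n. f x n)" for x
  have fB: "f x n \<le> C * norm x" for x n
  proof -
    have "norm (x - ?P x) \<le> (1 + norm P) * norm x"
      using norm_triangle_ineq4[of x "?P x"] norm_blinfun[of P x] by (simp add: algebra_simps)
    hence "f x n \<le> norm (op_power U n) * ((1 + norm P) * norm x) / r ^ n" unfolding f_def
      using r by (intro divide_right_mono order_trans[OF norm_funpow_le] mult_left_mono) auto
    also have "\<dots> = (norm (op_power U n) / r ^ n) * ((1 + norm P) * norm x)" by simp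
    also have "\<dots> \<le> B * ((1 + norm P) * norm x)" using B(2)[of n] r by (intro mult_right_mono) auto
    finally show ?thesis by (simp add: C_def mult.assoc)
  qed
  have bdd: "bdd_above (range (f x))" for x using fB by (intro bdd_aboveI2)
  have fV: "f x n \<le> V x" for x n unfolding V_def by (intro cSUP_upper bdd) auto
  have VI: "V x \<le> c" if "\<And>n. f x n \<le> c" for x c unfolding V_def using that by (intro cSUP_least) auto
  have f0: "f x n \<ge> 0" for x n using r by (simp add: f_def)
  have f_scale: "f (c *\<^sub>C x) n = cmod c * f x n" for c x n
    by (simp add: f_def clinear_opD[OF Pc] clinear_op_funpow[OF Uc] norm_cscale flip: cscale.diff_right)
  have "adapted_seminorm a e V C"
  proof
    show "V (x + y) \<le> V x + V y" for x y
    proof (rule VI)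
      fix n
      interpret F: bounded_linear "?U ^^ n" by (rule funpow_bounded_linear)
      have "(?U ^^ n) (x + y - ?P (x + y)) = (?U ^^ n) (x - ?P x) + (?U ^^ n) (y - ?P y)"
        by (simp add: blinfun.add_right algebra_simps flip: F.add)
      hence "f (x + y) n \<le> f x n + f y n"
        using r norm_triangle_ineq[of "(?U ^^ n) (x - ?P x)" "(?U ^^ n) (y - ?P y)"]
        by (simp add: f_def divide_right_mono flip: add_divide_distrib)
      then show "f (x + y) n \<le> V x + V y" using fV[of x n] fV[of y n] by linarith
    qed
    show V0: "V x \<ge> 0" for x using f0[of x 0] fV[of x 0] by linarith
    have Vle: "V (c *\<^sub>C x) \<le> cmod c * V x" for c x
      by (rule VI) (simp add: f_scale fV mult_left_mono)
    show "V (c *\<^sub>C x) = cmod c * V x" for c x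
    proof (cases "c = 0")
      case True
      then show ?thesis using Vle[of 0 x] V0[of "0 *\<^sub>C x"] by simp
    next
      case False
      have "V x = V ((1/c) *\<^sub>C (c *\<^sub>C x))" using False by (simp add: cscale_cscale)
      also have "\<dots> \<le> cmod (1/c) * V (c *\<^sub>C x)" by (rule Vle)
      finally show ?thesis using Vle[of c x] False by (simp add: norm_divide field_simps)
    qed
    have "f e n = 0" for n
    proof -
      interpret F: bounded_linear "?U ^^ n" by (rule funpow_bounded_linear)
      show ?thesis by (simp add: f_def Pe F.zero)
    qed
    then show "V e = 0" using V0[of e] VI[of e 0] by simp
    show "V x \<le> C * norm x" for x by (rule VI[OF fB])
    show "norm x \<le> V x" if "a x = 0" for x
      using fV[of x 0] that by (simp add: f_def Pa cscale.zero_left)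
  qed (rule a)+
  moreover have "V (?T x) \<le> r * V x" for x
  proof (rule VI)
    fix n
    have "?U (x - ?P x) = ?T x - ?P (?T x)" by (simp add: Uap blinfun.diff_right PP PT)
    hence "f (?T x) n = r * f x (Suc n)" using r by (simp add: f_def funpow_swap1)
    also have "\<dots> \<le> r * V x" using r fV by (intro mult_left_mono) auto
    finally show "f (?T x) n \<le> r * V x" .
  qed
  ultimately show thesis using that r Pa aT Te by blast
qed

section \<open>Moment generating functions of a spectral family\<close>

lemma tendsto_divide_sqrt_0: "(\<lambda>N. u / sqrt (real N)) \<longlonglongrightarrow> 0"
  by (intro tendsto_divide_0[OF tendsto_const] filterlim_at_top_imp_at_infinity
      filterlim_compose[OF sqrt_at_top] filterlim_real_sequentially)

lemma cmul_op_apply: "blinfun_apply (cmul_op c T) x = c *\<^sub>C blinfun_apply T x"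
  unfolding cmul_op_def
  by (subst bounded_linear_Blinfun_apply)
    (auto intro!: bounded_linear_compose[OF cscale.bounded_linear_right] blinfun.bounded_linear_right)

lemma op_power_add: "op_power T (m + n) = op_power T m o\<^sub>L op_power T n"
  by (rule blinfun_eqI) (simp add: op_power_apply funpow_add)

lemma norm_op_power_mult_le: "norm (op_power T (n * k)) \<le> norm (op_power T n) ^ k"
proof (induction k)
  case 0
  then show ?case by (simp add: norm_blinfun_id_le)
next
  case (Suc k)
  have "norm (op_power T (n * Suc k)) \<le> norm (op_power T n) * norm (op_power T (n * k))"
    using norm_blinfun_compose[of "op_power T n" "op_power T (n * k)"] by (simp add: op_power_add)
  also have "\<dots> \<le> norm (op_power T n) * norm (op_power T n) ^ k" using Suc by (intro mult_left_mono) auto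
  finally show ?case by simp
qed

lemma norm_op_power_le: "norm (op_power T n) \<le> norm T ^ n"
proof -
  have "op_power T 1 = T" by (rule blinfun_eqI) simp
  then show ?thesis using norm_op_power_mult_le[of T 1 n] by simp
qed

text \<open>Splitting N into blocks of length n gains 1/2 per block. The bounds assumed of
  \<open>T\<close> persist for nearby operators when they hold strictly, so the decay is locally
  uniform in a parameter.\<close>

lemma norm_op_power_geometric:
  fixes T :: "'a::real_normed_vector \<Rightarrow>\<^sub>L 'a"
  assumes n: "n > 0" and l: "0 < l" "l \<le> B" and B: "norm T \<le> B" and half: "norm (op_power T n) \<le> l ^ n / 2"
  shows "norm (op_power T N) \<le> 2 * (B / l) ^ n * (root n (1/2) * l) ^ N"
proof -
  define k where "k = N div n"
  define j where "j = N mod n"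
  have N: "N = n * k + j" "j \<le> n" using n by (auto simp: k_def j_def less_imp_le)
  let ?\<rho> = "root n (1/2) :: real"
  have \<rho>: "0 < ?\<rho>" "?\<rho> \<le> 1" "?\<rho> ^ n = 1/2" using n by (auto simp: real_root_pow_pos2)
  have "norm (op_power T N) \<le> norm (op_power T (n * k)) * norm (op_power T j)"
    unfolding N(1) op_power_add by (rule norm_blinfun_compose)
  also have "\<dots> \<le> norm (op_power T n) ^ k * norm T ^ j"
    by (intro mult_mono norm_op_power_mult_le norm_op_power_le) auto
  also have "\<dots> \<le> (l ^ n / 2) ^ k * B ^ j"
    using l half B by (intro mult_mono power_mono) auto
  also have "\<dots> = (1/2) ^ k * (B / l) ^ j * l ^ N"
    using l by (simp add: N(1) power_add power_mult power_divide)
  also have "\<dots> \<le> (2 * ?\<rho> ^ N) * (B / l) ^ n * l ^ N"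
  proof (intro mult_right_mono mult_mono)
    \<comment> \<open>An incomplete last block costs at most a factor 2, since its length is at most
      n and the n-th power of the root is 1/2.\<close>
    have "1/2 \<le> ?\<rho> ^ j" using power_decreasing[OF N(2), of ?\<rho>] \<rho> by simp
    hence "(1/2) ^ k * (1/2) \<le> (?\<rho> ^ n) ^ k * ?\<rho> ^ j" unfolding \<rho>(3) by (intro mult_left_mono) auto
    then show "(1/2) ^ k \<le> 2 * ?\<rho> ^ N" by (simp add: N(1) power_add power_mult)
    show "(B / l) ^ j \<le> (B / l) ^ n" using l N(2) by (intro power_increasing) auto
  qed (use l \<rho> in auto)
  finally show ?thesis by (simp add: power_mult_distrib mult_ac)
qed

lemma continuous_on_op_power [continuous_intros]:
  "continuous_on S f \<Longrightarrow> continuous_on S (\<lambda>x. op_power (f x) n)"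
  by (induction n) (auto intro!: continuous_intros)

lemma holomorphic_geometric_limit:
  assumes S: "open S" and hol: "\<And>k. f k holomorphic_on S" and \<rho>: "0 \<le> \<rho>" "\<rho> < 1"
    and bound: "\<And>k z. z \<in> S \<Longrightarrow> cmod (f k z - g z) \<le> K * \<rho> ^ k"
  shows "g holomorphic_on S"
proof (rule holomorphic_uniform_sequence[OF S hol])
  fix x assume "x \<in> S"
  then obtain d where d: "d > 0" "cball x d \<subseteq> S" using S open_contains_cball by blast
  have "uniform_limit (cball x d) f g sequentially"
  proof (rule uniform_limitI)
    fix e :: real assume "e > 0"
    have "(\<lambda>k. K * \<rho> ^ k) \<longlonglongrightarrow> 0" using \<rho> by (intro tendsto_mult_right_zero LIMSEQ_power_zero) auto
    hence "\<forall>\<^sub>F k in sequentially. K * \<rho> ^ k < e" using \<open>e > 0\<close> by (rule order_tendstoD)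
    then show "\<forall>\<^sub>F k in sequentially. \<forall>z\<in>cball x d. dist (f k z) (g z) < e"
    proof eventually_elim
      case (elim k)
      show ?case
      proof
        fix z assume "z \<in> cball x d"
        then show "dist (f k z) (g z) < e" using bound[of z k] d elim unfolding dist_norm by fastforce
      qed
    qed
  qed
  then show "\<exists>d>0. cball x d \<subseteq> S \<and> uniform_limit (cball x d) f g sequentially" using d by blast
qed

text \<open>Base and coefficient are recovered from the sequence itself, so two such expansions of
  one sequence can be identified.\<close>

lemma geometric_leading_term:
  fixes s :: "nat \<Rightarrow> complex"
  assumes p: "0 \<le> p" "p < cmod A" and s: "\<And>N. cmod (s N - A ^ N * x) \<le> K * p ^ N"
  shows "(\<lambda>N. s N / A ^ N) \<longlonglongrightarrow> x" and "x \<noteq> 0 \<Longrightarrow> (\<lambda>N. s (Suc N) / s N) \<longlonglongrightarrow> A"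
proof -
  have A: "A \<noteq> 0" using p by auto
  show lim: "(\<lambda>N. s N / A ^ N) \<longlonglongrightarrow> x"
  proof (rule LIM_zero_cancel, rule Lim_null_comparison)
    show "\<forall>\<^sub>F N in sequentially. norm (s N / A ^ N - x) \<le> K * (p / cmod A) ^ N"
    proof (intro always_eventually allI)
      fix N
      have "s N / A ^ N - x = (s N - A ^ N * x) / A ^ N" using A by (simp add: field_simps)
      hence "norm (s N / A ^ N - x) = cmod (s N - A ^ N * x) / cmod A ^ N" by (simp only: norm_divide norm_power)
      also have "\<dots> \<le> K * p ^ N / cmod A ^ N" by (intro divide_right_mono s) auto
      finally show "norm (s N / A ^ N - x) \<le> K * (p / cmod A) ^ N" by (simp add: power_divide)
    qed
    show "(\<lambda>N. K * (p / cmod A) ^ N) \<longlonglongrightarrow> 0"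
      using p A by (intro tendsto_mult_right_zero LIMSEQ_power_zero) simp
  qed
  assume x: "x \<noteq> 0"
  have "(\<lambda>N. A * ((s (Suc N) / A ^ Suc N) / (s N / A ^ N))) \<longlonglongrightarrow> A * (x / x)"
    by (intro tendsto_mult tendsto_const tendsto_divide LIMSEQ_Suc[OF lim] lim x)
  then show "(\<lambda>N. s (Suc N) / s N) \<longlonglongrightarrow> A" using A x by (simp add: field_simps)
qed

section \<open>Expansions of the moment functions of an operator family\<close>

locale spectral_family =
  fixes \<delta> :: real
    and v :: "'b::complex_banach"
    and ell :: "'b \<Rightarrow> complex"
    and L :: "complex \<Rightarrow> ('b \<Rightarrow>\<^sub>L 'b)"
    and lam :: "real \<Rightarrow> real"
    and Pi :: "real \<Rightarrow> ('b \<Rightarrow>\<^sub>L 'b)"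
  assumes \<delta>_pos: "\<delta> > 0"
    and ell_lin: "clinear_functional ell"
    and L_lin: "\<And>z. \<bar>Re z\<bar> < \<delta> \<Longrightarrow> clinear_op (L z)"
    and B1_cont: "continuous_on {z. \<bar>Re z\<bar> < \<delta>} L"
    and B1_hol: "op_holomorphic_on L (ball 0 \<delta>)"
    and B2_pos: "\<And>\<theta>. \<bar>\<theta>\<bar> < \<delta> \<Longrightarrow> lam \<theta> > 0"
    and B2_eig: "\<And>\<theta>. \<bar>\<theta>\<bar> < \<delta> \<Longrightarrow>
                   simple_eigenprojection (L (complex_of_real \<theta>)) (complex_of_real (lam \<theta>)) (Pi \<theta>)"
    and B2_gap: "\<And>\<theta>. \<bar>\<theta>\<bar> < \<delta> \<Longrightarrow> \<exists>r < lam \<theta>.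
                   op_spectrum (L (complex_of_real \<theta>)) - {complex_of_real (lam \<theta>)} \<subseteq> ball 0 r"
    and B3: "\<And>\<theta> s. \<bar>\<theta>\<bar> < \<delta> \<Longrightarrow> s \<noteq> 0 \<Longrightarrow>
               op_spectrum (L (Complex \<theta> s)) \<subseteq> ball 0 (lam \<theta>)"
    and C_nz: "\<And>\<theta>. \<bar>\<theta>\<bar> < \<delta> \<Longrightarrow> ell (blinfun_apply (Pi \<theta>) v) \<noteq> 0"
begin

definition \<psi> where "\<psi> N z = ell ((blinfun_apply (L z) ^^ N) v)"

lemma ell_bl: "bounded_linear ell" and ell_cscale: "ell (c *\<^sub>C x) = c * ell x"
  using ell_lin by (auto simp: clinear_functional_def)

lemma ball_Re: "z \<in> ball 0 \<delta> \<Longrightarrow> \<bar>Re z\<bar> < \<delta>"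
  using abs_Re_le_cmod[of z] by simp

text \<open>In the form of a Frechet derivative, holomorphy of the family becomes accessible to the
  product rule for operator application.\<close>

lemma L_has_derivative:
  assumes z: "z \<in> ball 0 \<delta>"
  obtains D where "(L has_derivative (\<lambda>h. cmul_op h D)) (at z)"
proof -
  obtain D where D: "((\<lambda>w. norm (L w - L z - cmul_op (w - z) D) / cmod (w - z)) \<longlongrightarrow> 0) (at z within ball 0 \<delta>)"
    using B1_hol z unfolding op_holomorphic_on_def by blast
  hence D': "((\<lambda>w. norm (L w - L z - cmul_op (w - z) D) / cmod (w - z)) \<longlongrightarrow> 0) (at z)"
    using z at_within_open[OF z open_ball] by simp
  have "bounded_linear (\<lambda>h. cmul_op h D)"
  proof (rule bounded_linear_intro[where K="norm D"])
    show "cmul_op (x + y) D = cmul_op x D + cmul_op y D" for x y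
      by (rule blinfun_eqI) (simp add: cmul_op_apply blinfun.add_left cscale.add_left)
    show "cmul_op (r *\<^sub>R x) D = r *\<^sub>R cmul_op x D" for r x
      by (rule blinfun_eqI) (simp add: cmul_op_apply blinfun.scaleR_left cscale.scaleR_left)
    show "norm (cmul_op x D) \<le> norm x * norm D" for x
      by (rule norm_blinfun_bound)
        (auto simp: cmul_op_apply norm_cscale mult.assoc intro!: mult_left_mono norm_blinfun)
  qed
  moreover have "((\<lambda>y. (L y - L z - cmul_op (y - z) D) /\<^sub>R cmod (y - z)) \<longlongrightarrow> 0) (at z)"
    using D' by (intro tendsto_norm_zero_cancel[of "\<lambda>y. (L y - L z - cmul_op (y - z) D) /\<^sub>R cmod (y - z)"])
      (simp add: divide_inverse mult.commute)
  ultimately have "(L has_derivative (\<lambda>h. cmul_op h D)) (at z)"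
    unfolding has_derivative_at_within by blast
  then show thesis by (rule that)
qed

lemma iterate_has_derivative:
  assumes z: "z \<in> ball 0 \<delta>"
  shows "\<exists>y. ((\<lambda>z. (blinfun_apply (L z) ^^ N) x) has_derivative (\<lambda>h. h *\<^sub>C y)) (at z)"
proof (induction N)
  case 0
  show ?case by (intro exI[of _ 0]) (simp add: cscale.zero_right)
next
  case (Suc N)
  then obtain y where y: "((\<lambda>z. (blinfun_apply (L z) ^^ N) x) has_derivative (\<lambda>h. h *\<^sub>C y)) (at z)" by blast
  obtain D where D: "(L has_derivative (\<lambda>h. cmul_op h D)) (at z)" using L_has_derivative[OF z] .
  have "((\<lambda>z. blinfun_apply (L z) ((blinfun_apply (L z) ^^ N) x)) has_derivative
     (\<lambda>h. blinfun_apply (L z) (h *\<^sub>C y) + blinfun_apply (cmul_op h D) ((blinfun_apply (L z) ^^ N) x))) (at z)"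
    by (rule blinfun.FDERIV[OF D y])
  also have "(\<lambda>h. blinfun_apply (L z) (h *\<^sub>C y) + blinfun_apply (cmul_op h D) ((blinfun_apply (L z) ^^ N) x))
      = (\<lambda>h. h *\<^sub>C (blinfun_apply (L z) y + blinfun_apply D ((blinfun_apply (L z) ^^ N) x)))"
    using clinear_opD[OF L_lin[OF ball_Re[OF z]]] by (simp add: cmul_op_apply cscale.add_right)
  finally show ?case by auto
qed

lemma functional_iterate_holomorphic:
  assumes a: "clinear_functional a"
  shows "(\<lambda>z. a ((blinfun_apply (L z) ^^ N) x)) holomorphic_on ball 0 \<delta>"
proof (rule holomorphic_onI)
  fix z :: complex assume z: "z \<in> ball 0 \<delta>"
  interpret a: bounded_linear a using a by (simp add: clinear_functional_def)
  obtain y where y: "((\<lambda>z. (blinfun_apply (L z) ^^ N) x) has_derivative (\<lambda>h. h *\<^sub>C y)) (at z)"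
    using iterate_has_derivative[OF z] by blast
  have "((\<lambda>z. a ((blinfun_apply (L z) ^^ N) x)) has_derivative (\<lambda>h. a (h *\<^sub>C y))) (at z)"
    by (rule a.has_derivative[OF y])
  moreover have "(\<lambda>h. a (h *\<^sub>C y)) = (*) (a y)"
    using a by (auto simp: clinear_functional_def mult.commute)
  ultimately have "((\<lambda>z. a ((blinfun_apply (L z) ^^ N) x)) has_field_derivative (a y)) (at z)"
    by (simp add: has_field_derivative_def)
  then show "(\<lambda>z. a ((blinfun_apply (L z) ^^ N) x)) field_differentiable at z within ball 0 \<delta>"
    using field_differentiable_at_within field_differentiable_def by blast
qed

lemma \<psi>_holomorphic: "\<psi> N holomorphic_on ball 0 \<delta>"
  unfolding \<psi>_def[abs_def] by (rule functional_iterate_holomorphic[OF ell_lin])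

text \<open>Here the projection is known, so \<open>v\<close> splits exactly into its projection and
  a part in the kernel. This expansion later fixes the abstract eigenvalue and coefficient on the
  real axis.\<close>

lemma real_axis_expansion:
  assumes t: "\<bar>t\<bar> < \<delta>"
  obtains r K where "0 < r" "r < lam t"
    "\<And>N. cmod (\<psi> N (of_real t) - of_real (lam t) ^ N * ell (blinfun_apply (Pi t) v)) \<le> K * r ^ N"
proof -
  let ?T = "blinfun_apply (L (of_real t))"
  have Tc: "clinear_op (L (of_real t))" using t by (intro L_lin) simp
  obtain a :: "'b \<Rightarrow> complex" and e V C r where A: "adapted_seminorm a e V C" and r: "0 < r" "r < lam t"
    and Pa: "\<And>x. blinfun_apply (Pi t) x = a x *\<^sub>C e"
    and aT: "\<And>x. a (?T x) = lam t * a x" and VT: "\<And>x. V (?T x) \<le> r * V x" and Te: "?T e = lam t *\<^sub>C e"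
    by (rule adapted_seminorm_exists[OF B2_eig[OF t] Tc B2_pos[OF t] B2_gap[OF t]]) blast
  interpret adapted_seminorm a e V C by (rule A)
  define y where "y = v - a v *\<^sub>C e"
  have ay: "a ((?T ^^ N) y) = 0" for N
    by (induction N) (auto simp: aT y_def a.diff a_cscale a_e)
  have Vy: "V ((?T ^^ N) y) \<le> V y * r ^ N" for N
  proof (induction N)
    case (Suc N)
    have "V ((?T ^^ Suc N) y) \<le> r * V ((?T ^^ N) y)" using VT by simp
    also have "\<dots> \<le> r * (V y * r ^ N)" using Suc r by (intro mult_left_mono) auto
    finally show ?case by (simp add: mult_ac)
  qed simp
  have Te': "(?T ^^ N) e = of_real (lam t) ^ N *\<^sub>C e" for N
    by (induction N) (auto simp: Te clinear_opD[OF Tc] cscale_cscale mult.commute)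
  have dec: "(?T ^^ N) v = of_real (lam t) ^ N *\<^sub>C blinfun_apply (Pi t) v + (?T ^^ N) y" for N
  proof -
    interpret F: bounded_linear "?T ^^ N" by (rule funpow_bounded_linear)
    have "(?T ^^ N) v = (?T ^^ N) (a v *\<^sub>C e) + (?T ^^ N) y" by (simp add: y_def flip: F.add)
    then show ?thesis by (simp add: clinear_op_funpow[OF Tc] Te' Pa cscale_cscale mult.commute)
  qed
  obtain K where K: "K > 0" "\<And>x. norm (ell x) \<le> norm x * K" using bounded_linear.pos_bounded[OF ell_bl] by blast
  have "cmod (\<psi> N (of_real t) - of_real (lam t) ^ N * ell (blinfun_apply (Pi t) v)) \<le> (V y * K) * r ^ N" for N
  proof -
    have "\<psi> N (of_real t) - of_real (lam t) ^ N * ell (blinfun_apply (Pi t) v) = ell ((?T ^^ N) y)"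
      unfolding \<psi>_def dec by (simp add: linear_add[OF bounded_linear.linear[OF ell_bl]] ell_cscale)
    also have "cmod \<dots> \<le> norm ((?T ^^ N) y) * K" by (rule K)
    also have "\<dots> \<le> (V y * r ^ N) * K"
      using K(1) order_trans[OF V_ker[OF ay] Vy] by (intro mult_right_mono) auto
    finally show ?thesis by (simp add: mult_ac)
  qed
  then show thesis using that r by blast
qed

text \<open>Measured in the seminorm adapted to the operator at \<theta>, every nearby
  \<open>L z\<close> is a small perturbation with constants independent of \<open>z\<close>. The
  eigenvalue ratios and the quotients \<open>\<psi> k z / \<mu> z ^ k\<close> are holomorphic and
  converge uniformly, which makes both limits holomorphic.\<close>

lemma uniform_expansion:
  assumes \<theta>: "\<bar>\<theta>\<bar> < \<delta>"
  obtains d q l K \<mu> c where "d > 0" "ball (complex_of_real \<theta>) d \<subseteq> ball 0 \<delta>" "0 < q" "q < lam \<theta>" "q < l"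
    "\<mu> holomorphic_on ball (of_real \<theta>) d" "c holomorphic_on ball (of_real \<theta>) d"
    "\<And>z. z \<in> ball (of_real \<theta>) d \<Longrightarrow> l \<le> cmod (\<mu> z)"
    "\<And>z N. z \<in> ball (of_real \<theta>) d \<Longrightarrow> cmod (\<psi> N z - \<mu> z ^ N * c z) \<le> K * q ^ N"
proof -
  let ?T = "\<lambda>z. blinfun_apply (L z)"
  let ?\<theta> = "complex_of_real \<theta>"
  have Tc: "clinear_op (L ?\<theta>)" using \<theta> by (intro L_lin) simp
  obtain a :: "'b \<Rightarrow> complex" and e V C r where A: "adapted_seminorm a e V C" and r: "0 < r" "r < lam \<theta>"
    and aT: "\<And>x. a (?T ?\<theta> x) = lam \<theta> * a x" and VT: "\<And>x. V (?T ?\<theta> x) \<le> r * V x"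
    by (rule adapted_seminorm_exists[OF B2_eig[OF \<theta>] Tc B2_pos[OF \<theta>] B2_gap[OF \<theta>]]) blast
  interpret adapted_seminorm a e V C by (rule A)
  \<comment> \<open>The slack \<open>4 * \<epsilon>\<close> in the hypothesis of
    \<open>perturbed_iterates\<close> then takes half of the gap between \<open>r\<close> and
    \<open>lam \<theta>\<close>.\<close>
  define \<epsilon> where "\<epsilon> = (lam \<theta> - r) / 8"
  have \<epsilon>: "\<epsilon> > 0" "r + 4 * \<epsilon> < lam \<theta>" using r by (auto simp: \<epsilon>_def field_simps)
  obtain Ka where Ka: "Ka > 0" "\<And>x. norm (a x) \<le> norm x * Ka" using a.pos_bounded by blast
  \<comment> \<open>Combines the bound of the norm by \<open>a\<close> and \<open>V\<close> with the
    bounds of \<open>a\<close> and \<open>V\<close> by the norm, so that one \<epsilon> serves both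
    error estimates.\<close>
  define B where "B = (Ka + \<bar>C\<bar> + 1) * (1 + norm e)"
  have B: "B > 0" using Ka unfolding B_def by (intro mult_pos_pos add_pos_nonneg add_nonneg_pos) auto
  have "isCont L ?\<theta>"
  proof -
    have "open {z. \<bar>Re z\<bar> < \<delta>}" by (intro open_Collect_less continuous_intros)
    then show ?thesis using B1_cont \<theta> by (auto simp: continuous_on_eq_continuous_at)
  qed
  then obtain d1 where d1: "d1 > 0" "\<And>z. dist z ?\<theta> < d1 \<Longrightarrow> dist (L z) (L ?\<theta>) < \<epsilon> / B"
    using \<epsilon> B unfolding continuous_at_eps_delta by (meson divide_pos_pos)
  define d where "d = min d1 (\<delta> - \<bar>\<theta>\<bar>)"
  have d: "d > 0" using d1 \<theta> by (simp add: d_def)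
  have sub: "ball ?\<theta> d \<subseteq> ball 0 \<delta>"
    by (rule order_trans[OF ball_subset_ball_iff[THEN iffD2] order_refl]) (auto simp: d_def)
  have near: "norm (blinfun_apply (L z - L ?\<theta>) x) * (Ka + \<bar>C\<bar> + 1) \<le> \<epsilon> * (cmod (a x) + V x)"
    if z: "z \<in> ball ?\<theta> d" for z x
  proof -
    have "norm (blinfun_apply (L z - L ?\<theta>) x) \<le> norm (L z - L ?\<theta>) * norm x" by (rule norm_blinfun)
    also have "\<dots> \<le> \<epsilon> / B * ((1 + norm e) * (cmod (a x) + V x))"
      using d1(2)[of z] z \<epsilon> B norm_le[of x] by (intro mult_mono) (auto simp: d_def dist_norm norm_minus_commute)
    finally have "norm (blinfun_apply (L z - L ?\<theta>) x) * (Ka + \<bar>C\<bar> + 1)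
        \<le> \<epsilon> / B * ((1 + norm e) * (cmod (a x) + V x)) * (Ka + \<bar>C\<bar> + 1)"
      using Ka by (intro mult_right_mono) auto
    also have "\<dots> = \<epsilon> / B * B * (cmod (a x) + V x)" by (simp add: B_def mult_ac)
    finally show ?thesis using B by simp
  qed
  have split: "?T z x = ?T ?\<theta> x + blinfun_apply (L z - L ?\<theta>) x" for z x by (simp add: blinfun.diff_left)
  have aTz: "cmod (a (?T z x) - lam \<theta> * a x) \<le> \<epsilon> * (cmod (a x) + V x)" if z: "z \<in> ball ?\<theta> d" for z x
  proof -
    have "cmod (a (?T z x) - lam \<theta> * a x) \<le> norm (blinfun_apply (L z - L ?\<theta>) x) * Ka"
      unfolding split[of z] by (simp add: a.add aT Ka)
    also have "\<dots> \<le> norm (blinfun_apply (L z - L ?\<theta>) x) * (Ka + \<bar>C\<bar> + 1)" by (intro mult_left_mono) auto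
    finally show ?thesis using near[OF z] by (rule order_trans)
  qed
  have VTz: "V (?T z x) \<le> r * V x + \<epsilon> * (cmod (a x) + V x)" if z: "z \<in> ball ?\<theta> d" for z x
  proof -
    have "V (?T z x) \<le> V (?T ?\<theta> x) + V (blinfun_apply (L z - L ?\<theta>) x)" unfolding split[of z] by (rule V_add)
    also have "V (blinfun_apply (L z - L ?\<theta>) x) \<le> C * norm (blinfun_apply (L z - L ?\<theta>) x)" by (rule V_bound)
    also have "\<dots> \<le> (Ka + \<bar>C\<bar> + 1) * norm (blinfun_apply (L z - L ?\<theta>) x)" using Ka by (intro mult_right_mono) auto
    also have "\<dots> \<le> \<epsilon> * (cmod (a x) + V x)" using near[OF z, of x] by (simp add: mult.commute)
    finally show ?thesis using VT[of x] by simp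
  qed
  \<comment> \<open>This \<open>q\<close> is the contraction ratio of the normalised iterates. The
    rate called \<open>q\<close> in the conclusion is \<open>r + 2 * \<epsilon>\<close>, and
    \<open>l\<close> there is \<open>lam \<theta> - 2 * \<epsilon>\<close>.\<close>
  define q where "q = (r + 2 * \<epsilon>) / (lam \<theta> - 2 * \<epsilon>)"
  define K0 where "K0 = (V v + cmod (a v)) * (1 + \<epsilon> / (lam \<theta> - r - 4 * \<epsilon>) * (norm e + 1))"
  have "\<exists>(\<mu>::complex) w. cmod (\<mu> - lam \<theta>) \<le> 2 * \<epsilon> \<and> (\<forall>k. a ((?T z ^^ k) e) \<noteq> 0) \<and>
      (\<forall>k. cmod (a ((?T z ^^ Suc k) e) / a ((?T z ^^ k) e) - \<mu>) \<le> 2 * \<epsilon> * q ^ k / (1 - q)) \<and>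
      (\<forall>N. norm ((?T z ^^ N) v - \<mu> ^ N *\<^sub>C w) \<le> K0 * (r + 2 * \<epsilon>) ^ N)" if z: "z \<in> ball ?\<theta> d" for z
  proof -
    have "clinear_op (L z)" using sub z by (intro L_lin ball_Re) auto
    then obtain \<mu> :: complex where *: "cmod (\<mu> - lam \<theta>) \<le> 2 * \<epsilon>" "\<And>k. a ((?T z ^^ k) e) \<noteq> 0"
      "\<And>k. cmod (a ((?T z ^^ Suc k) e) / a ((?T z ^^ k) e) - \<mu>) \<le> 2 * \<epsilon> * q ^ k / (1 - q)"
      "\<And>v. \<exists>w. \<forall>N. norm ((?T z ^^ N) v - \<mu> ^ N *\<^sub>C w)
               \<le> (V v + cmod (a v)) * (1 + \<epsilon> / (lam \<theta> - r - 4 * \<epsilon>) * (norm e + 1)) * (r + 2 * \<epsilon>) ^ N"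
      by (rule perturbed_iterates[OF _ less_imp_le[OF r(1)] \<epsilon> aTz[OF z] VTz[OF z], folded q_def]) blast
    obtain w where "\<forall>N. norm ((?T z ^^ N) v - \<mu> ^ N *\<^sub>C w) \<le> K0 * (r + 2 * \<epsilon>) ^ N"
      using *(4)[of v] unfolding K0_def by blast
    then show ?thesis using *(1-3) by blast
  qed
  then obtain \<mu> :: "complex \<Rightarrow> complex" and w where \<mu>w: "\<And>z. z \<in> ball ?\<theta> d \<Longrightarrow> cmod (\<mu> z - lam \<theta>) \<le> 2 * \<epsilon>"
    "\<And>z k. z \<in> ball ?\<theta> d \<Longrightarrow> a ((?T z ^^ k) e) \<noteq> 0"
    "\<And>z k. z \<in> ball ?\<theta> d \<Longrightarrow> cmod (a ((?T z ^^ Suc k) e) / a ((?T z ^^ k) e) - \<mu> z) \<le> 2 * \<epsilon> * q ^ k / (1 - q)"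
    "\<And>z N. z \<in> ball ?\<theta> d \<Longrightarrow> norm ((?T z ^^ N) v - \<mu> z ^ N *\<^sub>C w z) \<le> K0 * (r + 2 * \<epsilon>) ^ N"
    by metis
  have q: "0 \<le> q" "q < 1" and l0: "lam \<theta> - 2 * \<epsilon> > 0" using r \<epsilon> by (auto simp: q_def)
  have \<mu>l: "lam \<theta> - 2 * \<epsilon> \<le> cmod (\<mu> z)" if "z \<in> ball ?\<theta> d" for z
  proof -
    have "lam \<theta> \<le> cmod (complex_of_real (lam \<theta>))" by simp
    also have "\<dots> \<le> cmod (\<mu> z) + cmod (\<mu> z - lam \<theta>)" by (metis norm_triangle_sub norm_minus_commute)
    finally show ?thesis using \<mu>w(1)[OF that] by simp
  qed
  have hol\<mu>: "\<mu> holomorphic_on ball ?\<theta> d"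
  proof (rule holomorphic_geometric_limit[OF open_ball _ q, where K="2 * \<epsilon> / (1 - q)"])
    show "(\<lambda>z. a ((?T z ^^ Suc k) e) / a ((?T z ^^ k) e)) holomorphic_on ball ?\<theta> d" for k
      by (intro holomorphic_on_divide holomorphic_on_subset[OF functional_iterate_holomorphic[OF a] sub])
        (use \<mu>w in auto)
  qed (use \<mu>w(3) in \<open>simp add: mult_ac\<close>)
  obtain K where K: "K > 0" "\<And>x. norm (ell x) \<le> norm x * K" using bounded_linear.pos_bounded[OF ell_bl] by blast
  have \<psi>b: "cmod (\<psi> N z - \<mu> z ^ N * ell (w z)) \<le> (K0 * K) * (r + 2 * \<epsilon>) ^ N" if z: "z \<in> ball ?\<theta> d" for z N
  proof -
    have "\<psi> N z - \<mu> z ^ N * ell (w z) = ell ((?T z ^^ N) v - \<mu> z ^ N *\<^sub>C w z)"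
      by (simp add: \<psi>_def linear_diff[OF bounded_linear.linear[OF ell_bl]] ell_cscale)
    also have "cmod \<dots> \<le> norm ((?T z ^^ N) v - \<mu> z ^ N *\<^sub>C w z) * K" by (rule K)
    also have "\<dots> \<le> (K0 * (r + 2 * \<epsilon>) ^ N) * K" using K(1) \<mu>w(4)[OF z] by (intro mult_right_mono) auto
    finally show ?thesis by (simp add: mult_ac)
  qed
  have holc: "(\<lambda>z. ell (w z)) holomorphic_on ball ?\<theta> d"
  proof (rule holomorphic_geometric_limit[OF open_ball _ q, where K="K0 * K"])
    show "(\<lambda>z. \<psi> k z / \<mu> z ^ k) holomorphic_on ball ?\<theta> d" for k
      by (intro holomorphic_intros hol\<mu> holomorphic_on_subset[OF \<psi>_holomorphic sub])
        (use \<mu>l l0 in force)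
    fix k z assume z: "z \<in> ball ?\<theta> d"
    have nz: "cmod (\<mu> z) > 0" using \<mu>l[OF z] l0 by linarith
    have KK: "K0 * K \<ge> 0" using order_trans[OF norm_ge_zero \<psi>b[OF z, of 0]] by simp
    have "\<psi> k z / \<mu> z ^ k - ell (w z) = (\<psi> k z - \<mu> z ^ k * ell (w z)) / \<mu> z ^ k" using nz by (simp add: field_simps)
    hence "cmod (\<psi> k z / \<mu> z ^ k - ell (w z)) = cmod (\<psi> k z - \<mu> z ^ k * ell (w z)) / cmod (\<mu> z) ^ k"
      by (simp only: norm_divide norm_power)
    also have "\<dots> \<le> (K0 * K) * (r + 2 * \<epsilon>) ^ k / (lam \<theta> - 2 * \<epsilon>) ^ k"
      using \<psi>b[OF z] \<mu>l[OF z] l0 r \<epsilon>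
      by (intro frac_le power_mono mult_nonneg_nonneg[OF KK]) auto
    finally show "cmod (\<psi> k z / \<mu> z ^ k - ell (w z)) \<le> K0 * K * q ^ k" by (simp add: q_def power_divide)
  qed
  show thesis
    by (rule that[OF d sub _ _ _ hol\<mu> holc \<mu>l \<psi>b]) (use r \<epsilon> in auto)
qed

text \<open>The holomorphic pair is tied to \<open>lam\<close> and \<open>Pi\<close> only through
  \<open>\<psi>\<close>. On the real axis two expansions of the same sequence are available, and
  they must agree where the coefficient is nonzero; the ball is shrunk until \<open>c\<close> has no
  zero in it.\<close>

lemma local_expansion:
  assumes \<theta>: "\<bar>\<theta>\<bar> < \<delta>"
  obtains d q K \<mu> c where "d > 0" "ball (complex_of_real \<theta>) d \<subseteq> ball 0 \<delta>" "0 < q" "q < lam \<theta>"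
    "\<mu> holomorphic_on ball (of_real \<theta>) d" "c holomorphic_on ball (of_real \<theta>) d"
    "\<And>z N. z \<in> ball (of_real \<theta>) d \<Longrightarrow> cmod (\<psi> N z - \<mu> z ^ N * c z) \<le> K * q ^ N"
    "\<And>t. \<bar>t - \<theta>\<bar> < d \<Longrightarrow> \<mu> (of_real t) = of_real (lam t)"
    "\<And>t. \<bar>t - \<theta>\<bar> < d \<Longrightarrow> c (of_real t) = ell (blinfun_apply (Pi t) v)"
proof -
  let ?\<theta> = "complex_of_real \<theta>"
  obtain d q l K \<mu> c where d: "d > 0" and sub: "ball ?\<theta> d \<subseteq> ball 0 \<delta>" and q: "0 < q" "q < lam \<theta>" "q < l"
    and hol\<mu>: "\<mu> holomorphic_on ball ?\<theta> d" and holc: "c holomorphic_on ball ?\<theta> d"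
    and \<mu>l: "\<And>z. z \<in> ball ?\<theta> d \<Longrightarrow> l \<le> cmod (\<mu> z)"
    and \<psi>b: "\<And>z N. z \<in> ball ?\<theta> d \<Longrightarrow> cmod (\<psi> N z - \<mu> z ^ N * c z) \<le> K * q ^ N"
    by (rule uniform_expansion[OF \<theta>]) (rule that; blast)
  \<comment> \<open>Otherwise \<open>\<psi> N\<close> at \<theta> would be of order
    \<open>q ^ N\<close> with \<open>q < lam \<theta>\<close>, against the nonzero leading term on
    the real axis.\<close>
  have "c ?\<theta> \<noteq> 0"
  proof
    assume c0: "c ?\<theta> = 0"
    have \<theta>d: "?\<theta> \<in> ball ?\<theta> d" using d by simp
    obtain r K' where r: "0 < r" "r < lam \<theta>"
      "\<And>N. cmod (\<psi> N ?\<theta> - of_real (lam \<theta>) ^ N * ell (blinfun_apply (Pi \<theta>) v)) \<le> K' * r ^ N"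
      using real_axis_expansion[OF \<theta>] by blast
    have "(\<lambda>N. \<psi> N ?\<theta> / of_real (lam \<theta>) ^ N) \<longlonglongrightarrow> ell (blinfun_apply (Pi \<theta>) v)"
      using r by (intro geometric_leading_term(1)[where p=r and K=K']) auto
    moreover have "(\<lambda>N. \<psi> N ?\<theta> / of_real (lam \<theta>) ^ N) \<longlonglongrightarrow> 0"
      using q \<psi>b[OF \<theta>d] c0 by (intro geometric_leading_term(1)[where p=q and K=K]) auto
    ultimately show False using C_nz[OF \<theta>] LIMSEQ_unique by blast
  qed
  moreover have "isCont c ?\<theta>"
    using holomorphic_on_imp_continuous_on[OF holc] d by (simp add: continuous_on_eq_continuous_at)
  ultimately obtain d' where d': "d' > 0" "\<And>z. dist z ?\<theta> < d' \<Longrightarrow> c z \<noteq> 0"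
    using continuous_at_avoid[of ?\<theta> c 0] by (auto simp: dist_commute)
  define D where "D = min d d'"
  have D: "D > 0" "ball ?\<theta> D \<subseteq> ball ?\<theta> d" using d d' by (auto simp: D_def)
  have eq: "\<mu> (of_real t) = of_real (lam t) \<and> c (of_real t) = ell (blinfun_apply (Pi t) v)" if t: "\<bar>t - \<theta>\<bar> < D" for t
  proof -
    have dt: "dist (complex_of_real t) ?\<theta> < D" using t by (simp add: dist_norm flip: of_real_diff)
    have tb: "complex_of_real t \<in> ball ?\<theta> d" using dt by (simp add: D_def dist_commute)
    have t\<delta>: "\<bar>t\<bar> < \<delta>" using ball_Re[OF subsetD[OF sub tb]] by simp
    have c0: "c (of_real t) \<noteq> 0" using d'(2) dt by (simp add: D_def)
    have \<mu>q: "q < cmod (\<mu> (of_real t))" using \<mu>l[OF tb] q by linarith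
    obtain r K' where r: "0 < r" "r < lam t"
      "\<And>N. cmod (\<psi> N (of_real t) - of_real (lam t) ^ N * ell (blinfun_apply (Pi t) v)) \<le> K' * r ^ N"
      using real_axis_expansion[OF t\<delta>] by blast
    have r': "r < cmod (complex_of_real (lam t))" using r by simp
    note g1 = geometric_leading_term[OF less_imp_le[OF r(1)] r' r(3)]
    note g2 = geometric_leading_term[OF less_imp_le[OF q(1)] \<mu>q \<psi>b[OF tb]]
    have \<mu>: "\<mu> (of_real t) = of_real (lam t)" using LIMSEQ_unique[OF g2(2)[OF c0] g1(2)[OF C_nz[OF t\<delta>]]] .
    moreover have "c (of_real t) = ell (blinfun_apply (Pi t) v)"
      using LIMSEQ_unique[OF g2(1)[unfolded \<mu>] g1(1)] .
    ultimately show ?thesis by blast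
  qed
  show thesis
    by (rule that[OF D(1) _ q(1,2) holomorphic_on_subset[OF hol\<mu> D(2)] holomorphic_on_subset[OF holc D(2)] \<psi>b])
      (use D sub eq in auto)
qed

text \<open>For each s away from 0 the spectrum lies strictly inside the disc of radius
  \<open>lam \<theta>\<close>, so some power of the operator is small. That is an open condition in
  s, and the set of s considered is compact.\<close>

lemma vertical_line_decay:
  assumes \<theta>: "\<bar>\<theta>\<bar> < \<delta>" and \<eta>: "\<eta> > 0"
  obtains K \<rho> where "0 < \<rho>" "\<rho> < 1"
    "\<And>s N. \<eta> \<le> \<bar>s\<bar> \<Longrightarrow> \<bar>s\<bar> \<le> R \<Longrightarrow> cmod (\<psi> N (Complex \<theta> s)) \<le> K * (\<rho> * lam \<theta>) ^ N"
proof -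
  let ?L = "\<lambda>s. L (Complex \<theta> s)"
  let ?D = "{s. \<eta> \<le> \<bar>s\<bar> \<and> \<bar>s\<bar> \<le> R}"
  \<comment> \<open>One natural number indexes both the constant and the rate, so that the bounds
    weaken along a linear order as \<open>compact_uniform_parameter\<close> demands.\<close>
  define \<rho> where "\<rho> j = 1 - 1 / real (j + 2)" for j :: nat
  have \<rho>: "0 < \<rho> j" "\<rho> j < 1" for j by (auto simp: \<rho>_def)
  have \<rho>_mono: "\<rho> j \<le> \<rho> k" if "j \<le> k" for j k using that by (auto simp: \<rho>_def frac_le)
  have lam: "lam \<theta> > 0" by (rule B2_pos[OF \<theta>])
  have contL: "continuous_on UNIV ?L"
  proof (rule continuous_on_compose2[OF B1_cont])
    show "continuous_on UNIV (Complex \<theta>)" unfolding complex_eq[abs_def] by (auto intro!: continuous_intros simp: Complex_eq)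
  qed (use \<theta> in auto)
  have comp: "compact ?D"
  proof -
    have "closed {s. \<eta> \<le> \<bar>s\<bar>}" "closed {s. \<bar>s\<bar> \<le> R}" by (intro closed_Collect_le continuous_intros)+
    moreover have "?D = {s. \<eta> \<le> \<bar>s\<bar>} \<inter> {s. \<bar>s\<bar> \<le> R}" by auto
    ultimately have "closed ?D" by (simp only: closed_Int)
    moreover have "bounded ?D" unfolding bounded_iff by (intro exI[of _ R]) auto
    ultimately show ?thesis by (simp add: compact_eq_bounded_closed)
  qed
  have "\<exists>j::nat. \<forall>s\<in>?D. \<forall>N. norm (op_power (?L s) N) \<le> real j * (\<rho> j * lam \<theta>) ^ N"
  proof (rule compact_uniform_parameter[OF comp])
    fix j k :: nat and s :: real
    assume jk: "j \<le> k" and j: "\<forall>N. norm (op_power (?L s) N) \<le> real j * (\<rho> j * lam \<theta>) ^ N"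
    have "real j * (\<rho> j * lam \<theta>) ^ N \<le> real k * (\<rho> k * lam \<theta>) ^ N" for N
      using jk \<rho>_mono[OF jk] \<rho>(1)[of j] lam by (intro mult_mono power_mono) auto
    then show "\<forall>N. norm (op_power (?L s) N) \<le> real k * (\<rho> k * lam \<theta>) ^ N" using j order_trans by blast
  next
    fix s assume s: "s \<in> ?D"
    hence s0: "s \<noteq> 0" using \<eta> by auto
    have "(\<lambda>n. norm (op_power (?L s) n) / lam \<theta> ^ n) \<longlonglongrightarrow> 0"
      using \<theta> by (intro spectral_radius_lt L_lin lam B3 s0) auto
    hence ev: "\<forall>\<^sub>F n in sequentially. norm (op_power (?L s) n) / lam \<theta> ^ n < 1/2" by (rule order_tendstoD) simp
    then obtain n where n: "n > 0" "norm (op_power (?L s) n) / lam \<theta> ^ n < 1/2"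
      using eventually_happens'[OF sequentially_bot eventually_conj[OF ev eventually_gt_at_top[of 0]]] by blast
    \<comment> \<open>At least \<open>lam \<theta>\<close>, as
      \<open>norm_op_power_geometric\<close> demands, and with room for the norms of nearby
      operators.\<close>
    define B where "B = max (norm (?L s) + 1) (lam \<theta>)"
    have c1: "continuous_on UNIV (\<lambda>s. norm (op_power (?L s) n))" by (intro continuous_intros contL)
    have c2: "continuous_on UNIV (\<lambda>s. norm (?L s))" by (intro continuous_intros contL)
    have "open {s'. norm (op_power (?L s') n) < lam \<theta> ^ n / 2}" "open {s'. norm (?L s') < norm (?L s) + 1}"
      by (intro open_Collect_less continuous_intros c1 c2)+
    hence "open ({s'. norm (op_power (?L s') n) < lam \<theta> ^ n / 2} \<inter> {s'. norm (?L s') < norm (?L s) + 1})" by (rule open_Int)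
    moreover have "s \<in> {s'. norm (op_power (?L s') n) < lam \<theta> ^ n / 2} \<inter> {s'. norm (?L s') < norm (?L s) + 1}"
      using n lam by (simp add: field_simps)
    ultimately obtain e where e: "e > 0" "\<And>s'. dist s' s < e \<Longrightarrow> norm (op_power (?L s') n) < lam \<theta> ^ n / 2 \<and> norm (?L s') < norm (?L s) + 1"
      unfolding open_dist by blast
    let ?r = "root n (1/2) :: real"
    have r: "0 < ?r" "?r < 1" using n by auto
    obtain j1 :: nat where j1: "2 * (B / lam \<theta>) ^ n \<le> real j1" using real_arch_simple by blast
    obtain j2 :: nat where j2: "1 / (1 - ?r) \<le> real j2" using real_arch_simple by blast
    define j where "j = max j1 j2"
    have "1 / real (j + 2) \<le> 1 - ?r"
    proof -
      have "1 / (1 - ?r) \<le> real (j + 2)" using j2 by (simp add: j_def)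
      then show ?thesis using r by (simp add: field_simps)
    qed
    hence rj: "?r \<le> \<rho> j" by (simp add: \<rho>_def)
    have "norm (op_power (?L s') N) \<le> real j * (\<rho> j * lam \<theta>) ^ N" if "dist s' s < e" for s' N
    proof -
      have "norm (op_power (?L s') N) \<le> 2 * (B / lam \<theta>) ^ n * (?r * lam \<theta>) ^ N"
        using e(2)[OF that] n lam by (intro norm_op_power_geometric) (auto simp: B_def)
      also have "\<dots> \<le> real j * (\<rho> j * lam \<theta>) ^ N"
        using j1 rj r lam by (intro mult_mono power_mono) (auto simp: j_def)
      finally show ?thesis .
    qed
    then show "\<exists>e>0. \<exists>j::nat. \<forall>s'\<in>?D. dist s' s < e \<longrightarrow> (\<forall>N. norm (op_power (?L s') N) \<le> real j * (\<rho> j * lam \<theta>) ^ N)"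
      using e(1) by blast
  qed
  then obtain j :: nat where j: "\<And>s N. s \<in> ?D \<Longrightarrow> norm (op_power (?L s) N) \<le> real j * (\<rho> j * lam \<theta>) ^ N" by blast
  obtain K where K: "K > 0" "\<And>x. norm (ell x) \<le> norm x * K" using bounded_linear.pos_bounded[OF ell_bl] by blast
  show thesis
  proof (rule that[OF \<rho>])
    fix s N assume "\<eta> \<le> \<bar>s\<bar>" "\<bar>s\<bar> \<le> R"
    hence s: "s \<in> ?D" by simp
    have "cmod (\<psi> N (Complex \<theta> s)) \<le> norm ((blinfun_apply (?L s) ^^ N) v) * K" unfolding \<psi>_def by (rule K)
    also have "\<dots> \<le> (real j * (\<rho> j * lam \<theta>) ^ N * norm v) * K"
      using K(1) by (intro mult_right_mono order_trans[OF norm_funpow_le] mult_right_mono j s) auto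
    finally show "cmod (\<psi> N (Complex \<theta> s)) \<le> (real j * norm v * K) * (\<rho> j * lam \<theta>) ^ N" by (simp add: mult_ac)
  qed
qed

end

text \<open>Lets complex Taylor coefficients at a real point be read as real derivatives; applied
  again to \<open>deriv G\<close> it reaches the second order.\<close>

lemma real_axis_deriv:
  assumes G: "G holomorphic_on ball (complex_of_real \<theta>) d"
    and real: "\<And>t. \<bar>t - \<theta>\<bar> < d \<Longrightarrow> G (of_real t) = of_real (g t)" and t: "\<bar>t - \<theta>\<bar> < d"
  shows "(g has_real_derivative deriv g t) (at t)" and "deriv G (of_real t) = of_real (deriv g t)"
proof -
  have tb: "complex_of_real t \<in> ball (of_real \<theta>) d"
    using t by (simp add: dist_norm abs_minus_commute flip: of_real_diff)
  let ?D = "deriv G (of_real t)"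
  have "((\<lambda>x. G (of_real x)) has_vector_derivative ?D) (at t)"
    by (intro has_vector_derivative_real_field holomorphic_derivI[OF G open_ball tb])
  hence "((\<lambda>x. complex_of_real (g x)) has_vector_derivative ?D) (at t)"
    by (rule has_vector_derivative_transform_within_open[where S="ball \<theta> d"])
      (use t real in \<open>auto simp: dist_real_def abs_minus_commute\<close>)
  hence re: "(g has_real_derivative Re ?D) (at t)" and im: "((\<lambda>x. 0) has_real_derivative Im ?D) (at t)"
    by (simp_all add: has_vector_derivative_complex_iff)
  have "deriv g t = Re ?D" by (rule DERIV_imp_deriv[OF re])
  moreover have "Im ?D = 0" by (rule DERIV_unique[OF im DERIV_const])
  ultimately show "(g has_real_derivative deriv g t) (at t)" "?D = of_real (deriv g t)"
    using re by (simp_all add: complex_eq_iff)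
qed

section \<open>The logarithm of the leading eigenvalue and the expansion at a saddle point\<close>

context spectral_family
begin

definition \<Lambda> where "\<Lambda> t = ln (lam t)"

lemma exp_\<Lambda>: "\<bar>t\<bar> < \<delta> \<Longrightarrow> exp (\<Lambda> t) = lam t"
  by (simp add: \<Lambda>_def B2_pos)

text \<open>With the power of the eigenvalue written as exp (N F), the exponent can be Taylor
  expanded. The ball is shrunk until \<mu> stays in the right half plane, where \<open>Ln\<close> is
  holomorphic.\<close>

lemma log_expansion:
  assumes \<theta>: "\<bar>\<theta>\<bar> < \<delta>"
  obtains d q K F c where "d > 0" "0 < q" "q < lam \<theta>"
    "F holomorphic_on ball (of_real \<theta>) d" "c holomorphic_on ball (of_real \<theta>) d"
    "\<And>z N. z \<in> ball (of_real \<theta>) d \<Longrightarrow> cmod (\<psi> N z - exp (of_nat N * F z) * c z) \<le> K * q ^ N"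
    "\<And>t. \<bar>t - \<theta>\<bar> < d \<Longrightarrow> F (of_real t) = of_real (\<Lambda> t)"
    "c (of_real \<theta>) = ell (blinfun_apply (Pi \<theta>) v)"
proof -
  let ?\<theta> = "complex_of_real \<theta>"
  obtain d q K \<mu> c where d: "d > 0" "ball ?\<theta> d \<subseteq> ball 0 \<delta>" and q: "0 < q" "q < lam \<theta>"
    and hol\<mu>: "\<mu> holomorphic_on ball ?\<theta> d" and holc: "c holomorphic_on ball ?\<theta> d"
    and \<psi>b: "\<And>z N. z \<in> ball ?\<theta> d \<Longrightarrow> cmod (\<psi> N z - \<mu> z ^ N * c z) \<le> K * q ^ N"
    and \<mu>: "\<And>t. \<bar>t - \<theta>\<bar> < d \<Longrightarrow> \<mu> (of_real t) = of_real (lam t)"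
    and c: "\<And>t. \<bar>t - \<theta>\<bar> < d \<Longrightarrow> c (of_real t) = ell (blinfun_apply (Pi t) v)"
    proof (rule local_expansion[OF \<theta>], goal_cases)
      case 1
      show ?case by (rule that[OF 1(2-)])
    qed
  have "isCont \<mu> ?\<theta>"
    using holomorphic_on_imp_continuous_on[OF hol\<mu>] d by (simp add: continuous_on_eq_continuous_at)
  then obtain e where e: "e > 0" "\<And>z. dist z ?\<theta> < e \<Longrightarrow> dist (\<mu> z) (\<mu> ?\<theta>) < lam \<theta>"
    using B2_pos[OF \<theta>] unfolding continuous_at_eps_delta by blast
  define D where "D = min d e"
  have D: "D > 0" "ball ?\<theta> D \<subseteq> ball ?\<theta> d" using d e by (auto simp: D_def)
  have Re: "Re (\<mu> z) > 0" if "z \<in> ball ?\<theta> D" for z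
  proof -
    have "cmod (\<mu> z - of_real (lam \<theta>)) < lam \<theta>"
      using e(2)[of z] that \<mu>[of \<theta>] d by (simp add: D_def dist_commute dist_norm)
    then show ?thesis using abs_Re_le_cmod[of "\<mu> z - of_real (lam \<theta>)"] by simp
  qed
  have nz: "\<mu> z \<notin> \<real>\<^sub>\<le>\<^sub>0" if "z \<in> ball ?\<theta> D" for z
    using Re[OF that] by (auto simp: complex_nonpos_Reals_iff)
  show thesis
  proof (rule that[OF D(1) q, where F="\<lambda>z. Ln (\<mu> z)" and c=c and K=K])
    show "(\<lambda>z. Ln (\<mu> z)) holomorphic_on ball ?\<theta> D"
      by (intro holomorphic_on_Ln' nz holomorphic_on_subset[OF hol\<mu> D(2)])
    show "c holomorphic_on ball ?\<theta> D" by (rule holomorphic_on_subset[OF holc D(2)])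
    show "cmod (\<psi> N z - exp (of_nat N * Ln (\<mu> z)) * c z) \<le> K * q ^ N" if z: "z \<in> ball ?\<theta> D" for z N
    proof -
      have "\<mu> z \<noteq> 0" using Re[OF z] by auto
      hence "exp (of_nat N * Ln (\<mu> z)) = \<mu> z ^ N" by (simp add: exp_of_nat_mult)
      then show ?thesis using \<psi>b[of z N] z D(2) by auto
    qed
    show "Ln (\<mu> (of_real t)) = of_real (\<Lambda> t)" if t: "\<bar>t - \<theta>\<bar> < D" for t
    proof -
      have "complex_of_real t \<in> ball ?\<theta> d"
        using t by (simp add: D_def dist_norm abs_minus_commute flip: of_real_diff)
      hence "\<bar>t\<bar> < \<delta>" using d(2) ball_Re[of "of_real t"] by (metis Re_complex_of_real subsetD)
      then show ?thesis using \<mu>[of t] t B2_pos[of t] by (simp add: D_def \<Lambda>_def Ln_of_real)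
    qed
    show "c ?\<theta> = ell (blinfun_apply (Pi \<theta>) v)" using c[of \<theta>] d by simp
  qed
qed

text \<open>\<open>\<Lambda>\<close> inherits its smoothness from the holomorphic \<open>F\<close>
  that extends it near each real point.\<close>

lemma \<Lambda>_deriv:
  assumes t: "\<bar>t\<bar> < \<delta>"
  shows "(\<Lambda> has_real_derivative deriv \<Lambda> t) (at t)"
    and "(deriv \<Lambda> has_real_derivative deriv (deriv \<Lambda>) t) (at t)"
proof -
  obtain d q K F c where d: "d > 0" and F: "F holomorphic_on ball (complex_of_real t) d"
    and re: "\<And>s. \<bar>s - t\<bar> < d \<Longrightarrow> F (of_real s) = of_real (\<Lambda> s)"
    proof (rule log_expansion[OF t], goal_cases)
      case 1
      show ?case by (rule that[OF 1(2,5,8)])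
    qed
  have d1: "(\<Lambda> has_real_derivative deriv \<Lambda> s) (at s)" and re1: "deriv F (of_real s) = of_real (deriv \<Lambda> s)"
    if "\<bar>s - t\<bar> < d" for s using real_axis_deriv[OF F re that] by auto
  show "(\<Lambda> has_real_derivative deriv \<Lambda> t) (at t)" using d1[of t] d by simp
  show "(deriv \<Lambda> has_real_derivative deriv (deriv \<Lambda>) t) (at t)"
    using real_axis_deriv(1)[OF holomorphic_deriv[OF F open_ball] re1, of t] d by simp
qed

text \<open>The division by \<open>lam \<theta> ^ N\<close> and the phase remove the constant and
  the linear Taylor term of \<open>F\<close> along the vertical line, so the remaining exponent
  \<open>G\<close> starts with the quadratic term. Its sign is negative because the direction is
  imaginary.\<close>

lemma saddle_expansion:
  assumes \<theta>: "\<bar>\<theta>\<bar> < \<delta>"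
  obtains d q K B C and G c :: "real \<Rightarrow> complex" where "d > 0" "0 < q" "q < lam \<theta>"
    "\<And>s N. \<bar>s\<bar> < d \<Longrightarrow> cmod (\<psi> N (Complex \<theta> s) / of_real (lam \<theta> ^ N) * iexp (- (deriv \<Lambda> \<theta> * real N * s))
        - exp (of_nat N * G s) * c s) \<le> K * (q / lam \<theta>) ^ N"
    "\<And>s. \<bar>s\<bar> < d \<Longrightarrow> cmod (G s + of_real (deriv (deriv \<Lambda>) \<theta> * s\<^sup>2 / 2)) \<le> B * \<bar>s\<bar> ^ 3"
    "isCont c 0" "c 0 = ell (blinfun_apply (Pi \<theta>) v)" "\<And>s. \<bar>s\<bar> < d \<Longrightarrow> cmod (c s) \<le> C"
proof -
  let ?\<theta> = "complex_of_real \<theta>"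
  obtain d q K F c where d: "d > 0" and q: "0 < q" "q < lam \<theta>" and F: "F holomorphic_on ball ?\<theta> d"
    and c: "c holomorphic_on ball ?\<theta> d"
    and \<psi>b: "\<And>z N. z \<in> ball ?\<theta> d \<Longrightarrow> cmod (\<psi> N z - exp (of_nat N * F z) * c z) \<le> K * q ^ N"
    and re: "\<And>s. \<bar>s - \<theta>\<bar> < d \<Longrightarrow> F (of_real s) = of_real (\<Lambda> s)" and c0: "c ?\<theta> = ell (blinfun_apply (Pi \<theta>) v)"
    proof (rule log_expansion[OF \<theta>], goal_cases)
      case 1
      show ?case by (rule that[OF 1(2-)])
    qed
  have re1: "deriv F (of_real s) = of_real (deriv \<Lambda> s)" if "\<bar>s - \<theta>\<bar> < d" for s
    using real_axis_deriv(2)[OF F re that] .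
  have re2: "deriv (deriv F) (of_real s) = of_real (deriv (deriv \<Lambda>) s)" if "\<bar>s - \<theta>\<bar> < d" for s
    using real_axis_deriv(2)[OF holomorphic_deriv[OF F open_ball] re1 that] .
  \<comment> \<open>Half the radius, so that compactness bounds the third derivative and
    \<open>c\<close>.\<close>
  define S where "S = cball ?\<theta> (d/2)"
  have S: "S \<subseteq> ball ?\<theta> d" "compact S" "convex S" "?\<theta> \<in> S" using d by (auto simp: S_def)
  have zS: "Complex \<theta> s \<in> S" if "\<bar>s\<bar> < d/2" for s
    using that by (simp add: S_def dist_norm cmod_def complex_of_real_def)
  have F3: "(deriv ^^ i) F holomorphic_on ball ?\<theta> d" for i
    by (intro holomorphic_higher_deriv F open_ball)
  have "compact ((deriv ^^ 3) F ` S)"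
    using S by (intro compact_continuous_image continuous_on_subset[OF holomorphic_on_imp_continuous_on[OF F3]]) auto
  then obtain B where "\<forall>z\<in>S. cmod ((deriv ^^ 3) F z) \<le> B"
    by (auto dest!: compact_imp_bounded simp: bounded_iff)
  hence B: "\<And>z. z \<in> S \<Longrightarrow> cmod ((deriv ^^ 3) F z) \<le> B" by blast
  have "compact (c ` S)"
    using S by (intro compact_continuous_image continuous_on_subset[OF holomorphic_on_imp_continuous_on[OF c]]) auto
  then obtain C where "\<forall>z\<in>S. cmod (c z) \<le> C"
    by (auto dest!: compact_imp_bounded simp: bounded_iff)
  hence C: "\<And>z. z \<in> S \<Longrightarrow> cmod (c z) \<le> C" by blast
  define G where "G s = F (Complex \<theta> s) - of_real (\<Lambda> \<theta>) - \<i> * of_real (deriv \<Lambda> \<theta> * s)" for s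
  have cx: "Complex \<theta> s - ?\<theta> = \<i> * of_real s" for s by (simp add: complex_eq_iff)
  show thesis
  proof (rule that[of "d/2" q G "\<lambda>s. c (Complex \<theta> s)" K "B/2" C])
    fix s :: real assume s: "\<bar>s\<bar> < d/2"
    note z = zS[OF s]
    show "cmod (c (Complex \<theta> s)) \<le> C" by (rule C[OF z])
    show "cmod (\<psi> N (Complex \<theta> s) / of_real (lam \<theta> ^ N) * iexp (- (deriv \<Lambda> \<theta> * real N * s))
        - exp (of_nat N * G s) * c (Complex \<theta> s)) \<le> K * (q / lam \<theta>) ^ N" for N
    proof -
      let ?e = "iexp (- (deriv \<Lambda> \<theta> * real N * s))"
      have l: "complex_of_real (lam \<theta> ^ N) = exp (of_nat N * of_real (\<Lambda> \<theta>))"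
        using exp_\<Lambda>[OF \<theta>] by (metis exp_of_nat_mult exp_of_real of_real_mult of_real_of_nat_eq)
      have E: "exp (of_nat N * G s) = exp (of_nat N * F (Complex \<theta> s)) / of_real (lam \<theta> ^ N) * ?e"
        unfolding l by (simp add: G_def flip: exp_diff exp_add) (simp add: algebra_simps)
      have alg: "x / l * e - y / l * e * w = (x - y * w) / l * e" for x y w l e :: complex
        by (simp add: diff_divide_distrib algebra_simps)
      have "\<psi> N (Complex \<theta> s) / of_real (lam \<theta> ^ N) * ?e - exp (of_nat N * G s) * c (Complex \<theta> s)
          = (\<psi> N (Complex \<theta> s) - exp (of_nat N * F (Complex \<theta> s)) * c (Complex \<theta> s)) / of_real (lam \<theta> ^ N) * ?e"
        unfolding E by (rule alg)
      hence "cmod (\<psi> N (Complex \<theta> s) / of_real (lam \<theta> ^ N) * ?e - exp (of_nat N * G s) * c (Complex \<theta> s))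
          = cmod (\<psi> N (Complex \<theta> s) - exp (of_nat N * F (Complex \<theta> s)) * c (Complex \<theta> s)) / lam \<theta> ^ N"
        using B2_pos[OF \<theta>] by (simp only: norm_mult norm_divide norm_exp_i_times norm_of_real) simp
      also have "\<dots> \<le> K * q ^ N / lam \<theta> ^ N"
        using B2_pos[OF \<theta>] z S by (intro divide_right_mono \<psi>b) auto
      finally show ?thesis by (simp add: power_divide)
    qed
    have "cmod ((deriv ^^ 0) F (Complex \<theta> s) - (\<Sum>i\<le>2. (deriv ^^ i) F ?\<theta> * (Complex \<theta> s - ?\<theta>) ^ i / fact i))
        \<le> B * cmod (Complex \<theta> s - ?\<theta>) ^ Suc 2 / fact 2"
    proof (rule complex_Taylor[where f="\<lambda>i. (deriv ^^ i) F", OF S(3) _ _ S(4) z])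
      show "((deriv ^^ i) F has_field_derivative (deriv ^^ Suc i) F x) (at x within S)" if "x \<in> S" for i x
        using holomorphic_derivI[OF F3[of i] open_ball, of x S] S that by auto
      show "cmod ((deriv ^^ Suc 2) F x) \<le> B" if "x \<in> S" for x
        using B[OF that] by (simp add: numeral_3_eq_3)
    qed
    moreover have "(\<Sum>i\<le>2. (deriv ^^ i) F ?\<theta> * (Complex \<theta> s - ?\<theta>) ^ i / fact i)
        = of_real (\<Lambda> \<theta>) + \<i> * of_real (deriv \<Lambda> \<theta> * s) - of_real (deriv (deriv \<Lambda>) \<theta> * s\<^sup>2 / 2)"
      using re[of \<theta>] re1[of \<theta>] re2[of \<theta>] d
      by (simp add: cx numeral_2_eq_2 power_mult_distrib) 
    ultimately have "cmod (F (Complex \<theta> s) - (of_real (\<Lambda> \<theta>) + \<i> * of_real (deriv \<Lambda> \<theta> * s) - of_real (deriv (deriv \<Lambda>) \<theta> * s\<^sup>2 / 2)))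
        \<le> B * \<bar>s\<bar> ^ 3 / 2" by (simp add: cx norm_mult numeral_3_eq_3)
    also have "F (Complex \<theta> s) - (of_real (\<Lambda> \<theta>) + \<i> * of_real (deriv \<Lambda> \<theta> * s) - of_real (deriv (deriv \<Lambda>) \<theta> * s\<^sup>2 / 2))
        = G s + of_real (deriv (deriv \<Lambda>) \<theta> * s\<^sup>2 / 2)" by (simp add: G_def)
    finally show "cmod (G s + of_real (deriv (deriv \<Lambda>) \<theta> * s\<^sup>2 / 2)) \<le> B / 2 * \<bar>s\<bar> ^ 3" by simp
  next
    have "Complex \<theta> 0 = ?\<theta>" by (simp add: complex_eq_iff)
    then show "c (Complex \<theta> 0) = ell (blinfun_apply (Pi \<theta>) v)" using c0 by simp
    have "isCont c ?\<theta>"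
      using holomorphic_on_imp_continuous_on[OF c] d by (simp add: continuous_on_eq_continuous_at)
    moreover have "isCont (\<lambda>s. Complex \<theta> s) 0" unfolding Complex_eq[abs_def] by (intro continuous_intros)
    ultimately show "isCont (\<lambda>s. c (Complex \<theta> s)) 0"
      using isCont_o2[where a=0 and f="Complex \<theta>" and g=c] \<open>Complex \<theta> 0 = ?\<theta>\<close> by simp
  qed (use d q in auto)
qed

text \<open>For the moment functions this is the characteristic function of the N-th sum, centred at
  N times the slope of \<open>\<Lambda>\<close> at \<theta>, under the law tilted by the exponential
  of \<theta> times the sum. It is expressed through \<open>\<psi>\<close> alone.\<close>

definition tilted_char where
  "tilted_char \<theta> N s = \<psi> N (Complex \<theta> s) / \<psi> N (of_real \<theta>) * iexp (- (deriv \<Lambda> \<theta> * real N * s))"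

lemma \<psi>_real_asymp:
  assumes \<theta>: "\<bar>\<theta>\<bar> < \<delta>"
  shows "(\<lambda>N. \<psi> N (of_real \<theta>) / of_real (lam \<theta> ^ N)) \<longlonglongrightarrow> ell (blinfun_apply (Pi \<theta>) v)"
proof -
  obtain r K where r: "0 < r" "r < lam \<theta>"
    "\<And>N. cmod (\<psi> N (of_real \<theta>) - of_real (lam \<theta>) ^ N * ell (blinfun_apply (Pi \<theta>) v)) \<le> K * r ^ N"
    proof (rule real_axis_expansion[OF \<theta>], goal_cases)
      case 1
      show ?case by (rule that[OF 1(2-)])
    qed
  have "(\<lambda>N. \<psi> N (of_real \<theta>) / of_real (lam \<theta>) ^ N) \<longlonglongrightarrow> ell (blinfun_apply (Pi \<theta>) v)"
    using r by (intro geometric_leading_term(1)[where p=r and K=K]) auto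
  then show ?thesis by simp
qed

lemma tilted_char_eq:
  assumes "\<bar>\<theta>\<bar> < \<delta>"
  shows "tilted_char \<theta> N s = (\<psi> N (Complex \<theta> s) / of_real (lam \<theta> ^ N) * iexp (- (deriv \<Lambda> \<theta> * real N * s)))
    / (\<psi> N (of_real \<theta>) / of_real (lam \<theta> ^ N))"
  using B2_pos[OF assms] by (simp add: tilted_char_def)

text \<open>At s = u / sqrt N the quadratic term of N G does not depend on N, and the cubic error is
  of order N (|u| / sqrt N)^3, which vanishes. The prefactor \<open>c\<close> tends to the limit of
  the normalising quotient and cancels.\<close>

lemma tilted_char_limit:
  assumes \<theta>: "\<bar>\<theta>\<bar> < \<delta>"
  shows "(\<lambda>N. tilted_char \<theta> N (u / sqrt (real N))) \<longlonglongrightarrow> of_real (exp (- (deriv (deriv \<Lambda>) \<theta> * u\<^sup>2 / 2)))"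
proof -
  let ?S2 = "deriv (deriv \<Lambda>) \<theta>"
  obtain d q K B C and G c :: "real \<Rightarrow> complex" where d: "d > 0" and q: "0 < q" "q < lam \<theta>"
    and ex: "\<And>s N. \<bar>s\<bar> < d \<Longrightarrow> cmod (\<psi> N (Complex \<theta> s) / of_real (lam \<theta> ^ N) * iexp (- (deriv \<Lambda> \<theta> * real N * s))
        - exp (of_nat N * G s) * c s) \<le> K * (q / lam \<theta>) ^ N"
    and G: "\<And>s. \<bar>s\<bar> < d \<Longrightarrow> cmod (G s + of_real (?S2 * s\<^sup>2 / 2)) \<le> B * \<bar>s\<bar> ^ 3"
    and c: "isCont c 0" "c 0 = ell (blinfun_apply (Pi \<theta>) v)"
    proof (rule saddle_expansion[OF \<theta>], goal_cases)
      case 1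
      show ?case by (rule that[OF 1(2-8)])
    qed
  let ?s = "\<lambda>N. u / sqrt (real N)"
  have slim: "?s \<longlonglongrightarrow> 0" by (rule tendsto_divide_sqrt_0)
  have sd: "\<forall>\<^sub>F N in sequentially. \<bar>?s N\<bar> < d"
    using order_tendstoD(2)[OF tendsto_rabs[OF slim], of d] d by simp
  have NG: "(\<lambda>N. of_nat N * G (?s N)) \<longlonglongrightarrow> of_real (- (?S2 * u\<^sup>2 / 2))"
  proof (rule LIM_zero_cancel, rule Lim_null_comparison)
    show "\<forall>\<^sub>F N in sequentially. norm (of_nat N * G (?s N) - of_real (- (?S2 * u\<^sup>2 / 2))) \<le> B * u\<^sup>2 * \<bar>?s N\<bar>"
      using sd eventually_gt_at_top[of 0]
    proof eventually_elim
      case (elim N)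
      have Ns: "real N * (?s N)\<^sup>2 = u\<^sup>2" using elim by (simp add: power_divide)
      have "of_nat N * G (?s N) - of_real (- (?S2 * u\<^sup>2 / 2)) = of_nat N * (G (?s N) + of_real (?S2 * (?s N)\<^sup>2 / 2))"
      proof -
        have "real N * (?S2 * (?s N)\<^sup>2 / 2) = ?S2 * (real N * (?s N)\<^sup>2) / 2" by simp
        hence "of_nat N * complex_of_real (?S2 * (?s N)\<^sup>2 / 2) = of_real (?S2 * u\<^sup>2 / 2)"
          unfolding Ns by (metis of_real_mult of_real_of_nat_eq)
        then show ?thesis by (simp only: distrib_left of_real_minus diff_minus_eq_add)
      qed
      hence "norm (of_nat N * G (?s N) - of_real (- (?S2 * u\<^sup>2 / 2))) = real N * cmod (G (?s N) + of_real (?S2 * (?s N)\<^sup>2 / 2))"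
        by (simp only: norm_mult norm_of_nat)
      also have "\<dots> \<le> real N * (B * \<bar>?s N\<bar> ^ 3)" using G[OF elim(1)] by (intro mult_left_mono) auto
      also have "\<dots> = B * (real N * (?s N)\<^sup>2) * \<bar>?s N\<bar>" by (simp add: power3_eq_cube power2_eq_square)
      finally show ?case unfolding Ns .
    qed
    have "(\<lambda>N. B * u\<^sup>2 * \<bar>?s N\<bar>) \<longlonglongrightarrow> B * u\<^sup>2 * \<bar>0\<bar>" by (intro tendsto_intros slim)
    then show "(\<lambda>N. B * u\<^sup>2 * \<bar>?s N\<bar>) \<longlonglongrightarrow> 0" by simp
  qed
  let ?c0 = "ell (blinfun_apply (Pi \<theta>) v)"
  let ?A = "\<lambda>N. \<psi> N (Complex \<theta> (?s N)) / of_real (lam \<theta> ^ N) * iexp (- (deriv \<Lambda> \<theta> * real N * ?s N))"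
  have "(\<lambda>N. ?A N - exp (of_nat N * G (?s N)) * c (?s N)) \<longlonglongrightarrow> 0"
  proof (rule Lim_null_comparison)
    show "\<forall>\<^sub>F N in sequentially. norm (?A N - exp (of_nat N * G (?s N)) * c (?s N)) \<le> K * (q / lam \<theta>) ^ N"
      using sd by eventually_elim (rule ex)
    show "(\<lambda>N. K * (q / lam \<theta>) ^ N) \<longlonglongrightarrow> 0"
      using q by (intro tendsto_mult_right_zero LIMSEQ_power_zero) auto
  qed
  moreover have "(\<lambda>N. exp (of_nat N * G (?s N)) * c (?s N)) \<longlonglongrightarrow> exp (of_real (- (?S2 * u\<^sup>2 / 2))) * ?c0"
    unfolding c(2)[symmetric] by (intro tendsto_mult tendsto_exp NG isCont_tendsto_compose[OF c(1) slim])
  ultimately have "?A \<longlonglongrightarrow> exp (of_real (- (?S2 * u\<^sup>2 / 2))) * ?c0"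
    using tendsto_add by fastforce
  hence "(\<lambda>N. ?A N / (\<psi> N (of_real \<theta>) / of_real (lam \<theta> ^ N))) \<longlonglongrightarrow> exp (of_real (- (?S2 * u\<^sup>2 / 2))) * ?c0 / ?c0"
    by (intro tendsto_divide \<psi>_real_asymp[OF \<theta>] C_nz[OF \<theta>])
  then show ?thesis using C_nz[OF \<theta>] unfolding tilted_char_eq[OF \<theta>] by (simp add: exp_of_real[symmetric])
qed

text \<open>Supplies the dominating function for integrating the pointwise limit. Near 0 the
  quadratic term outweighs the cubic one; away from 0, and for the remainder near 0, geometric decay
  in N lies below the Gaussian because s is bounded by \<open>R\<close>.\<close>

lemma tilted_char_bound:
  assumes \<theta>: "\<bar>\<theta>\<bar> < \<delta>" and S2: "deriv (deriv \<Lambda>) \<theta> > 0"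
  shows "\<exists>K \<kappa>. \<kappa> > 0 \<and> (\<forall>\<^sub>F N in sequentially. \<forall>s. \<bar>s\<bar> \<le> R \<longrightarrow> cmod (tilted_char \<theta> N s) \<le> K * exp (- (\<kappa> * real N * s\<^sup>2)))"
proof -
  let ?S2 = "deriv (deriv \<Lambda>) \<theta>"
  obtain d q K B C and G c :: "real \<Rightarrow> complex" where d: "d > 0" and q: "0 < q" "q < lam \<theta>"
    and ex: "\<And>s N. \<bar>s\<bar> < d \<Longrightarrow> cmod (\<psi> N (Complex \<theta> s) / of_real (lam \<theta> ^ N) * iexp (- (deriv \<Lambda> \<theta> * real N * s))
        - exp (of_nat N * G s) * c s) \<le> K * (q / lam \<theta>) ^ N"
    and G: "\<And>s. \<bar>s\<bar> < d \<Longrightarrow> cmod (G s + of_real (?S2 * s\<^sup>2 / 2)) \<le> B * \<bar>s\<bar> ^ 3"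
    and C: "\<And>s. \<bar>s\<bar> < d \<Longrightarrow> cmod (c s) \<le> C"
    proof (rule saddle_expansion[OF \<theta>], goal_cases)
      case 1
      show ?case by (rule that[OF 1(2-6,9)])
    qed
  have lam: "lam \<theta> > 0" by (rule B2_pos[OF \<theta>])
  let ?c0 = "ell (blinfun_apply (Pi \<theta>) v)"
  \<comment> \<open>Small enough that the cubic error takes at most half of the quadratic
    decay.\<close>
  define \<eta> where "\<eta> = min (d/2) (?S2 / (4 * (\<bar>B\<bar> + 1)))"
  have \<eta>: "\<eta> > 0" "\<eta> < d" using d S2 by (auto simp: \<eta>_def)
  have K0: "K \<ge> 0" and C0: "C \<ge> 0"
    using order_trans[OF norm_ge_zero ex[of 0 0]] order_trans[OF norm_ge_zero C[of 0]] d by auto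
  obtain K' \<rho> where \<rho>: "0 < \<rho>" "\<rho> < 1" and out: "\<And>s N. \<eta> \<le> \<bar>s\<bar> \<Longrightarrow> \<bar>s\<bar> \<le> R \<Longrightarrow> cmod (\<psi> N (Complex \<theta> s)) \<le> K' * (\<rho> * lam \<theta>) ^ N"
    proof (rule vertical_line_decay[OF \<theta> \<eta>(1), of R], goal_cases)
      case 1
      show ?case by (rule that[OF 1(2-)])
    qed
  define \<rho>1 where "\<rho>1 = max \<rho> (q / lam \<theta>)"
  have \<rho>1: "0 < \<rho>1" "\<rho>1 < 1" "\<rho> \<le> \<rho>1" "q / lam \<theta> \<le> \<rho>1" using \<rho> q lam by (auto simp: \<rho>1_def)
  \<comment> \<open>The first entry is what the cubic error leaves of the quadratic term; the second
    makes \<open>\<rho>1 ^ N\<close> lie below the Gaussian for all |s| \<le> R.\<close>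
  define \<kappa> where "\<kappa> = min (?S2 / 4) (- ln \<rho>1 / (1 + R\<^sup>2))"
  have R1: "1 + R\<^sup>2 > 0" by (intro add_pos_nonneg) auto
  have "- ln \<rho>1 / (1 + R\<^sup>2) > 0" using \<rho>1 R1 by (intro divide_pos_pos) auto
  hence \<kappa>: "\<kappa> > 0" using S2 by (simp add: \<kappa>_def)
  have geo: "\<rho>1 ^ N \<le> exp (- (\<kappa> * real N * s\<^sup>2))" if s: "\<bar>s\<bar> \<le> R" for N s
  proof -
    have "s\<^sup>2 \<le> R\<^sup>2" using s by (intro abs_le_square_iff[THEN iffD1]) auto
    hence "\<kappa> * s\<^sup>2 \<le> (- ln \<rho>1 / (1 + R\<^sup>2)) * (1 + R\<^sup>2)"
      using \<kappa> \<rho>1 R1 by (intro mult_mono) (auto simp: \<kappa>_def)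
    hence "\<kappa> * s\<^sup>2 \<le> - ln \<rho>1" using R1 by simp
    hence "real N * (\<kappa> * s\<^sup>2) \<le> real N * (- ln \<rho>1)" by (intro mult_left_mono) auto
    hence "exp (real N * ln \<rho>1) \<le> exp (- (\<kappa> * real N * s\<^sup>2))" by (simp add: mult_ac)
    then show ?thesis using \<rho>1 by (simp add: exp_of_nat_mult)
  qed
  have inner: "cmod (exp (of_nat N * G s)) \<le> exp (- (\<kappa> * real N * s\<^sup>2))" if s: "\<bar>s\<bar> \<le> \<eta>" for N s
  proof -
    have "Re (G s + of_real (?S2 * s\<^sup>2 / 2)) \<le> B * \<bar>s\<bar> ^ 3"
      using order_trans[OF complex_Re_le_cmod G] s \<eta> by simp
    hence "Re (G s) \<le> B * \<bar>s\<bar> ^ 3 - ?S2 * s\<^sup>2 / 2" by simp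
    also have "B * \<bar>s\<bar> ^ 3 \<le> ?S2 / 4 * s\<^sup>2"
    proof -
      have "(\<bar>B\<bar> + 1) * \<bar>s\<bar> \<le> (\<bar>B\<bar> + 1) * (?S2 / (4 * (\<bar>B\<bar> + 1)))"
        using s by (intro mult_left_mono) (auto simp: \<eta>_def)
      also have "\<dots> = ?S2 / 4" by (simp add: field_simps add_nonneg_eq_0_iff)
      finally have "(\<bar>B\<bar> + 1) * \<bar>s\<bar> \<le> ?S2 / 4" .
      moreover have "B * \<bar>s\<bar> \<le> (\<bar>B\<bar> + 1) * \<bar>s\<bar>" by (intro mult_right_mono) auto
      ultimately have "B * \<bar>s\<bar> \<le> ?S2 / 4" by linarith
      hence "B * \<bar>s\<bar> * s\<^sup>2 \<le> ?S2 / 4 * s\<^sup>2" by (intro mult_right_mono) auto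
      then show ?thesis by (simp add: power3_eq_cube power2_eq_square mult.assoc)
    qed
    finally have "Re (G s) \<le> - (?S2 / 4 * s\<^sup>2)" by simp
    also have "\<dots> \<le> - (\<kappa> * s\<^sup>2)"
      unfolding \<kappa>_def by (intro le_imp_neg_le mult_right_mono min.cobounded1) simp
    finally have "real N * Re (G s) \<le> real N * - (\<kappa> * s\<^sup>2)" by (intro mult_left_mono) auto
    then show ?thesis by (simp add: mult_ac)
  qed
  have num: "cmod (\<psi> N (Complex \<theta> s) / of_real (lam \<theta> ^ N) * iexp (- (deriv \<Lambda> \<theta> * real N * s)))
      \<le> (C + K + \<bar>K'\<bar>) * exp (- (\<kappa> * real N * s\<^sup>2))" if s: "\<bar>s\<bar> \<le> R" for N s
  proof (cases "\<bar>s\<bar> < \<eta>")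
    case True
    let ?a = "\<psi> N (Complex \<theta> s) / of_real (lam \<theta> ^ N) * iexp (- (deriv \<Lambda> \<theta> * real N * s))"
    have "cmod ?a \<le> cmod (exp (of_nat N * G s) * c s) + cmod (?a - exp (of_nat N * G s) * c s)"
      by (rule norm_triangle_sub)
    also have "\<dots> \<le> exp (- (\<kappa> * real N * s\<^sup>2)) * C + K * (q / lam \<theta>) ^ N"
      unfolding norm_mult using True \<eta> C C0
      by (intro add_mono mult_mono inner ex[unfolded norm_mult]) auto
    also have "K * (q / lam \<theta>) ^ N \<le> K * exp (- (\<kappa> * real N * s\<^sup>2))"
      using K0 q lam \<rho>1 by (intro mult_left_mono order_trans[OF power_mono geo[OF s]]) auto
    finally have "cmod ?a \<le> (C + K) * exp (- (\<kappa> * real N * s\<^sup>2))" by (simp add: algebra_simps)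
    also have "\<dots> \<le> (C + K + \<bar>K'\<bar>) * exp (- (\<kappa> * real N * s\<^sup>2))" by (intro mult_right_mono) auto
    finally show ?thesis .
  next
    case False
    have "cmod (\<psi> N (Complex \<theta> s)) / lam \<theta> ^ N \<le> K' * (\<rho> * lam \<theta>) ^ N / lam \<theta> ^ N"
      using False s lam by (intro divide_right_mono out) auto
    also have "\<dots> = K' * \<rho> ^ N" using lam by (simp add: power_mult_distrib)
    also have "\<dots> \<le> \<bar>K'\<bar> * exp (- (\<kappa> * real N * s\<^sup>2))"
      using \<rho> \<rho>1 by (intro mult_mono order_trans[OF power_mono geo[OF s]]) auto
    also have "\<dots> \<le> (C + K + \<bar>K'\<bar>) * exp (- (\<kappa> * real N * s\<^sup>2))" using C0 K0 by (intro mult_right_mono) auto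
    finally show ?thesis
      using lam by (simp only: norm_mult norm_divide norm_exp_i_times norm_of_real) simp
  qed
  have "\<forall>\<^sub>F N in sequentially. cmod ?c0 / 2 < cmod (\<psi> N (of_real \<theta>) / of_real (lam \<theta> ^ N))"
    using C_nz[OF \<theta>] by (intro order_tendstoD(1)[OF tendsto_norm[OF \<psi>_real_asymp[OF \<theta>]]]) simp
  hence "\<forall>\<^sub>F N in sequentially. \<forall>s. \<bar>s\<bar> \<le> R \<longrightarrow> cmod (tilted_char \<theta> N s) \<le> ((C + K + \<bar>K'\<bar>) / (cmod ?c0 / 2)) * exp (- (\<kappa> * real N * s\<^sup>2))"
  proof eventually_elim
    case (elim N)
    show ?case
    proof (intro allI impI)
      fix s :: real assume s: "\<bar>s\<bar> \<le> R"
      have "cmod (tilted_char \<theta> N s) \<le> ((C + K + \<bar>K'\<bar>) * exp (- (\<kappa> * real N * s\<^sup>2))) / (cmod ?c0 / 2)"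
        unfolding tilted_char_eq[OF \<theta>] norm_divide[of "_ * _"]
        using num[OF s, of N] elim C_nz[OF \<theta>] C0 K0 by (intro frac_le mult_nonneg_nonneg) auto
      then show "cmod (tilted_char \<theta> N s) \<le> ((C + K + \<bar>K'\<bar>) / (cmod ?c0 / 2)) * exp (- (\<kappa> * real N * s\<^sup>2))"
        by (simp only: times_divide_eq_left)
    qed
  qed
  then show ?thesis using \<kappa> by blast
qed

end

section \<open>Fejer kernels and a local limit theorem\<close>

lemma gaussian_integral:
  assumes "\<sigma> > 0"
  shows "has_bochner_integral lborel (\<lambda>u. exp (- (\<sigma>\<^sup>2 * u\<^sup>2 / 2))) (sqrt (2 * pi) / \<sigma>)"
proof -
  have "has_bochner_integral lborel (\<lambda>u. sqrt (2 * pi) / \<sigma> * normal_density 0 (1/\<sigma>) u) (sqrt (2 * pi) / \<sigma> * 1)"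
    using integral_normal_density[of "1/\<sigma>" 0] integrable_normal_density[of "1/\<sigma>" 0] assms
    by (intro has_bochner_integral_mult_right) (simp add: has_bochner_integral_iff)
  moreover have "sqrt (2 * pi) / \<sigma> * normal_density 0 (1/\<sigma>) u = exp (- (\<sigma>\<^sup>2 * u\<^sup>2 / 2))" for u
    using assms by (simp add: normal_density_def real_sqrt_mult real_sqrt_divide field_simps)
  ultimately show ?thesis by simp
qed

text \<open>The substitution s = u / sqrt N produces integrands with a pointwise limit. The kernel
  vanishes for |s| > R, so a Gaussian bound on that one frequency range dominates them.\<close>

lemma gaussian_scaling_limit:
  fixes \<phi> :: "nat \<Rightarrow> real \<Rightarrow> complex" and k :: "real \<Rightarrow> complex"
  assumes \<sigma>: "\<sigma> > 0" and meas [measurable]: "\<And>N. \<phi> N \<in> borel_measurable borel"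
    and k: "continuous_on UNIV k" and R: "R \<ge> 0" and supp: "\<And>s. \<bar>s\<bar> > R \<Longrightarrow> k s = 0"
    and K1: "\<And>R. \<exists>K \<kappa>. \<kappa> > 0 \<and> (\<forall>\<^sub>F N in sequentially. \<forall>s. \<bar>s\<bar> \<le> R \<longrightarrow> cmod (\<phi> N s) \<le> K * exp (- (\<kappa> * real N * s\<^sup>2)))"
    and K2: "\<And>u. (\<lambda>N. \<phi> N (u / sqrt (real N))) \<longlonglongrightarrow> of_real (exp (- (\<sigma>\<^sup>2 * u\<^sup>2 / 2)))"
  shows "(\<lambda>N. sqrt (real N) * (LINT s|lborel. k s * \<phi> N s)) \<longlonglongrightarrow> k 0 * (sqrt (2 * pi) / \<sigma>)"
proof -
  have [measurable]: "k \<in> borel_measurable borel" using k by (rule borel_measurable_continuous_onI)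
  obtain K \<kappa> where \<kappa>: "\<kappa> > 0" and ev: "\<forall>\<^sub>F N in sequentially. \<forall>s. \<bar>s\<bar> \<le> R \<longrightarrow> cmod (\<phi> N s) \<le> K * exp (- (\<kappa> * real N * s\<^sup>2))"
    using K1[of R] by blast
  obtain N0 where N0: "\<And>N s. N \<ge> N0 \<Longrightarrow> \<bar>s\<bar> \<le> R \<Longrightarrow> cmod (\<phi> N s) \<le> K * exp (- (\<kappa> * real N * s\<^sup>2))"
    using ev unfolding eventually_sequentially by blast
  have "bounded (k ` {-R..R})"
    by (intro compact_imp_bounded compact_continuous_image continuous_on_subset[OF k]) auto
  then obtain B where B: "B > 0" "\<And>s. \<bar>s\<bar> \<le> R \<Longrightarrow> cmod (k s) \<le> B"
    unfolding bounded_pos by (auto simp: abs_le_iff)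
  \<comment> \<open>The Gaussian bound holds only from \<open>N0\<close> on, and the rescaling needs
    a positive index; \<open>LIMSEQ_offset\<close> undoes the shift at the end.\<close>
  define M where "M n = n + N0 + 1" for n :: nat
  have M: "M n > 0" "M n \<ge> N0" for n by (auto simp: M_def)
  have Mlim: "filterlim M at_top sequentially"
    by (rule filterlim_at_top_mono[OF filterlim_ident]) (auto simp: M_def)
  let ?g = "\<lambda>n u. k (u / sqrt (real (M n))) * \<phi> (M n) (u / sqrt (real (M n)))"
  have subst: "sqrt (real (M n)) * (LINT s|lborel. k s * \<phi> (M n) s) = (LINT u|lborel. ?g n u)" for n
  proof -
    have "(LINT s|lborel. k s * \<phi> (M n) s) = \<bar>1 / sqrt (real (M n))\<bar> *\<^sub>R (LINT u|lborel. ?g n u)"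
      using lborel_integral_real_affine[of "1 / sqrt (real (M n))" "\<lambda>s. k s * \<phi> (M n) s" 0] M(1)[of n] by simp
    then show ?thesis using M(1)[of n] by (simp add: scaleR_conv_of_real)
  qed
  have "(\<lambda>n. LINT u|lborel. ?g n u) \<longlonglongrightarrow> (LINT u|lborel. k 0 * of_real (exp (- (\<sigma>\<^sup>2 * u\<^sup>2 / 2))))"
  proof (rule integral_dominated_convergence)
    have "integrable lborel (\<lambda>u. exp (- ((sqrt (2 * \<kappa>))\<^sup>2 * u\<^sup>2 / 2)))"
      using gaussian_integral[of "sqrt (2 * \<kappa>)"] \<kappa> by (simp add: has_bochner_integral_iff)
    then show "integrable lborel (\<lambda>u. B * K * exp (- (\<kappa> * u\<^sup>2)))" using \<kappa> by simp
    show "AE u in lborel. (\<lambda>n. ?g n u) \<longlonglongrightarrow> k 0 * of_real (exp (- (\<sigma>\<^sup>2 * u\<^sup>2 / 2)))"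
    proof (intro AE_I2 tendsto_mult)
      fix u
      have "(\<lambda>N. u / sqrt (real N)) \<longlonglongrightarrow> 0" by (rule tendsto_divide_sqrt_0)
      hence "(\<lambda>n. u / sqrt (real (M n))) \<longlonglongrightarrow> 0" by (rule filterlim_compose[OF _ Mlim])
      moreover have "isCont k 0" using k by (simp add: continuous_on_eq_continuous_at)
      ultimately show "(\<lambda>n. k (u / sqrt (real (M n)))) \<longlonglongrightarrow> k 0" by (rule isCont_tendsto_compose[rotated])
      show "(\<lambda>n. \<phi> (M n) (u / sqrt (real (M n)))) \<longlonglongrightarrow> of_real (exp (- (\<sigma>\<^sup>2 * u\<^sup>2 / 2)))"
        by (rule filterlim_compose[OF K2 Mlim])
    qed
    fix n
    show "AE u in lborel. norm (?g n u) \<le> B * K * exp (- (\<kappa> * u\<^sup>2))"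
    proof (rule AE_I2)
      fix u
      let ?s = "u / sqrt (real (M n))"
      have "K \<ge> 0" using order_trans[OF norm_ge_zero N0[OF M(2), of 0 n]] R by simp
      show "norm (?g n u) \<le> B * K * exp (- (\<kappa> * u\<^sup>2))"
      proof (cases "\<bar>?s\<bar> \<le> R")
        case True
        have eq: "\<kappa> * real (M n) * ?s\<^sup>2 = \<kappa> * u\<^sup>2" using M(1)[of n] by (simp add: power_divide)
        have "cmod (\<phi> (M n) ?s) \<le> K * exp (- (\<kappa> * u\<^sup>2))" using N0[OF M(2)[of n] True] unfolding eq .
        then show ?thesis using B(1) B(2)[OF True] unfolding norm_mult mult.assoc by (intro mult_mono) auto
      next
        case False
        then show ?thesis using supp[of ?s] B \<open>K \<ge> 0\<close> by simp
      qed
    qed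
  qed measurable
  also have "(LINT u|lborel. k 0 * of_real (exp (- (\<sigma>\<^sup>2 * u\<^sup>2 / 2)))) = k 0 * (sqrt (2 * pi) / \<sigma>)"
    using gaussian_integral[OF \<sigma>] by (simp add: has_bochner_integral_iff)
  finally have "(\<lambda>n. sqrt (real (M n)) * (LINT s|lborel. k s * \<phi> (M n) s)) \<longlonglongrightarrow> k 0 * (sqrt (2 * pi) / \<sigma>)"
    unfolding subst .
  then show ?thesis unfolding M_def add.assoc by (rule LIMSEQ_offset)
qed

text \<open>Parseval's identity by Fubini: integrating the transform of \<open>k\<close> against the
  law equals integrating the characteristic function against \<open>k\<close>, and the factor
  \<open>iexp (u * t)\<close> translates \<open>k\<close>.\<close>

lemma (in real_distribution) fourier_kernel_integral:
  fixes k :: "real \<Rightarrow> complex"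
  assumes k: "integrable lborel k"
  shows "(LINT t|M. (LINT s|lborel. k s * iexp (s * t)) * iexp (u * t)) = (LINT s|lborel. k (s - u) * char M s)"
proof -
  interpret P: pair_sigma_finite M lborel ..
  have [measurable]: "k \<in> borel_measurable borel" using k by auto
  have nk: "norm (k s * iexp (s * t) * iexp (u * t)) = norm (k s)" for s t by (simp add: norm_mult)
  have "integrable (M \<Otimes>\<^sub>M lborel) (\<lambda>(t, s). k s * iexp (s * t) * iexp (u * t))"
  proof (rule P.Fubini_integrable)
    show "integrable M (\<lambda>t. LINT s|lborel. norm (case (t, s) of (t, s) \<Rightarrow> k s * iexp (s * t) * iexp (u * t)))"
      by (simp only: case_prod_conv nk) simp
    show "AE t in M. integrable lborel (\<lambda>s. case (t, s) of (t, s) \<Rightarrow> k s * iexp (s * t) * iexp (u * t))"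
    proof (intro AE_I2, simp only: case_prod_conv)
      fix t
      show "integrable lborel (\<lambda>s. k s * iexp (s * t) * iexp (u * t))"
        by (rule Bochner_Integration.integrable_bound[OF integrable_norm[OF k]]) (auto simp: nk simp del: of_real_mult)
    qed
  qed measurable
  hence "(LINT t|M. LINT s|lborel. k s * iexp (s * t) * iexp (u * t))
       = (LINT s|lborel. LINT t|M. k s * iexp (s * t) * iexp (u * t))"
    by (rule P.Fubini_integral[symmetric])
  also have "(\<lambda>s. LINT t|M. k s * iexp (s * t) * iexp (u * t)) = (\<lambda>s. k s * char M (s + u))"
  proof
    fix s
    have "k s * iexp (s * t) * iexp (u * t) = k s * iexp ((s + u) * t)" for t
      by (simp add: exp_add distrib_left distrib_right)
    then show "(LINT t|M. k s * iexp (s * t) * iexp (u * t)) = k s * char M (s + u)"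
      by (simp only: char_def integral_mult_right_zero)
  qed
  also have "(LINT s|lborel. k s * char M (s + u)) = (LINT s|lborel. k (s - u) * char M s)"
    using lborel_integral_real_affine[of 1 "\<lambda>s. k s * char M (s + u)" "-u"] by (simp add: algebra_simps)
  finally show ?thesis by simp
qed

section \<open>The Fejer kernel as Fourier transform of a triangle function\<close>

definition tent :: "real \<Rightarrow> real" where "tent s = max 0 (1 - \<bar>s\<bar>)"

lemma tent_cont: "continuous_on UNIV tent"
  unfolding tent_def[abs_def] by (intro continuous_intros)

lemma tent_meas [measurable]: "tent \<in> borel_measurable borel"
  using tent_cont by (rule borel_measurable_continuous_onI)

lemma tent_integrable: "integrable lborel tent"
proof -
  have "integrable lborel (\<lambda>s. indicator {-1..1} s *\<^sub>R tent s)"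
    by (rule borel_integrable_compact) (auto intro: continuous_on_subset[OF tent_cont])
  moreover have "(\<lambda>s. indicator {-1..1} s *\<^sub>R tent s) = tent"
    by (auto simp: tent_def indicator_def fun_eq_iff)
  ultimately show ?thesis by simp
qed

text \<open>For nonzero t this is (sin (t/2) / (t/2))^2. The integral form also gives the right
  value at 0 and yields continuity by dominated convergence.\<close>

definition fejer :: "real \<Rightarrow> real" where
  "fejer t = Re (LINT s|lborel. of_real (tent s) * iexp (s * t))"

lemma tent_iexp_integrable: "integrable lborel (\<lambda>s. of_real (tent s) * iexp (s * t))"
  by (rule Bochner_Integration.integrable_bound[OF tent_integrable]) (auto simp: norm_mult)

lemma tent_fourier_nonzero:
  assumes t: "t \<noteq> 0"
  shows "(LINT s|lborel. of_real (tent s) * iexp (s * t)) = of_real (2 * (1 - cos t) / t\<^sup>2)"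
proof -
  let ?c = "\<i> * complex_of_real t"
  have c: "?c \<noteq> 0" using t by simp
  \<comment> \<open>\<open>G\<close> and \<open>H\<close> are antiderivatives of the two linear
    branches of the triangle times the exponential.\<close>
  define G where "G z = (1 - z) * exp (?c * z) / ?c + exp (?c * z) / ?c\<^sup>2" for z
  define H where "H z = (1 + z) * exp (?c * z) / ?c - exp (?c * z) / ?c\<^sup>2" for z
  have dG: "(G has_field_derivative (1 - z) * exp (?c * z)) (at z)" for z
    unfolding G_def[abs_def] using c
    by (auto intro!: derivative_eq_intros simp: field_simps power2_eq_square)
  have dH: "(H has_field_derivative (1 + z) * exp (?c * z)) (at z)" for z
    unfolding H_def[abs_def] using c
    by (auto intro!: derivative_eq_intros simp: field_simps power2_eq_square)
  have iG: "has_bochner_integral lborel (\<lambda>s. indicator {0..1} s *\<^sub>R ((1 - of_real s) * exp (?c * of_real s))) (G (of_real 1) - G (of_real 0))"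
    by (rule has_bochner_integral_FTC_Icc)
      (auto intro!: has_vector_derivative_real_field dG continuous_intros)
  have iH: "has_bochner_integral lborel (\<lambda>s. indicator {-1..0} s *\<^sub>R ((1 + of_real s) * exp (?c * of_real s))) (H (of_real 0) - H (of_real (-1)))"
    by (rule has_bochner_integral_FTC_Icc)
      (auto intro!: has_vector_derivative_real_field dH continuous_intros)
  have "(LINT s|lborel. of_real (tent s) * iexp (s * t))
      = (LINT s|lborel. indicator {0..1} s *\<^sub>R ((1 - of_real s) * exp (?c * of_real s))
           + indicator {-1..0} s *\<^sub>R ((1 + of_real s) * exp (?c * of_real s)))"
  proof (rule integral_cong_AE)
    show "AE s in lborel. of_real (tent s) * iexp (s * t) = indicator {0..1} s *\<^sub>R ((1 - of_real s) * exp (?c * of_real s))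
           + indicator {-1..0} s *\<^sub>R ((1 + of_real s) * exp (?c * of_real s))"
      \<comment> \<open>Both indicators are 1 at the point 0, so the splitting holds only almost
        everywhere.\<close>
      using AE_lborel_singleton[of 0]
      by eventually_elim (auto simp: tent_def indicator_def max_def abs_if mult_ac)
  qed measurable
  also have "\<dots> = (G (of_real 1) - G (of_real 0)) + (H (of_real 0) - H (of_real (-1)))"
    by (rule has_bochner_integral_integral_eq[OF has_bochner_integral_add[OF iG iH]])
  also have "\<dots> = (exp ?c + exp (- ?c) - 2) / ?c\<^sup>2"
    using c by (simp add: G_def H_def field_simps)
  also have "exp ?c + exp (- ?c) = 2 * of_real (cos t)"
    by (simp add: exp_Euler[symmetric] cos_exp_eq flip: cos_of_real) 
  also have "(2 * of_real (cos t) - 2) / ?c\<^sup>2 = of_real (2 * (1 - cos t) / t\<^sup>2)"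
    using t by (simp add: power_mult_distrib field_simps)
  finally show ?thesis .
qed

lemma fejer_eq: "t \<noteq> 0 \<Longrightarrow> fejer t = 2 * (1 - cos t) / t\<^sup>2"
  unfolding fejer_def by (subst tent_fourier_nonzero) auto

lemma tent_fourier: "(LINT s|lborel. of_real (tent s) * iexp (s * t)) = of_real (fejer t)"
proof (cases "t = 0")
  case True
  then show ?thesis by (simp add: fejer_def)
next
  case False
  then show ?thesis using tent_fourier_nonzero[OF False] fejer_eq[OF False] by simp
qed

lemma fejer_nonneg: "fejer t \<ge> 0"
proof (cases "t = 0")
  case True
  then show ?thesis by (simp add: fejer_def tent_def)
next
  case False
  then show ?thesis by (simp add: fejer_eq)
qed

lemma fejer_cont: "continuous_on UNIV fejer"
proof -
  have "isCont (\<lambda>t. LINT s|lborel. of_real (tent s) * iexp (s * t)) t0" for t0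
    unfolding continuous_at_sequentially comp_def
  proof (intro allI impI integral_dominated_convergence[where w=tent])
    fix X :: "nat \<Rightarrow> real" assume X: "X \<longlonglongrightarrow> t0"
    show "AE s in lborel. (\<lambda>n. of_real (tent s) * iexp (s * X n)) \<longlonglongrightarrow> of_real (tent s) * iexp (s * t0)"
      by (intro AE_I2 tendsto_intros X)
  qed (use tent_integrable in \<open>auto simp: norm_mult tent_def\<close>)
  hence "isCont fejer t0" for t0
    unfolding fejer_def[abs_def] by (rule continuous_Re)
  then show ?thesis by (simp add: continuous_on_eq_continuous_at)
qed

lemma fejer_integrable: "integrable lborel fejer"
proof -
  have [measurable]: "fejer \<in> borel_measurable borel" using fejer_cont by (rule borel_measurable_continuous_onI)
  have "bounded (fejer ` {-1..1})"
    by (intro compact_imp_bounded compact_continuous_image continuous_on_subset[OF fejer_cont]) auto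
  then obtain B where B: "B > 0" "\<And>t. t \<in> {-1..1} \<Longrightarrow> norm (fejer t) \<le> B"
    unfolding bounded_pos by blast
  have B': "fejer t \<le> B" if "\<bar>t\<bar> \<le> 1" for t
    using order_trans[OF abs_ge_self B(2)[of t, unfolded real_norm_def]] that by (simp add: abs_le_iff)
  \<comment> \<open>The summand \<open>2 * B\<close> handles |t| \<le> 1, and 8 handles the tail,
    where the kernel is at most 4 / t^2.\<close>
  have "fejer t \<le> (2 * B + 8) * inverse (1 + t\<^sup>2)" for t
  proof (cases "\<bar>t\<bar> \<le> 1")
    case True
    hence "t\<^sup>2 \<le> 1" by (simp add: abs_square_le_1)
    hence "fejer t * (1 + t\<^sup>2) \<le> B * 2" using B(1) B'[OF True] by (intro mult_mono) auto
    then show ?thesis by (simp add: field_simps add_pos_nonneg)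
  next
    case False
    hence t: "t \<noteq> 0" "t\<^sup>2 \<ge> 1" by (auto simp: abs_square_le_1[symmetric] not_le)
    have "2 * (1 - cos t) \<le> 2 * (1 - (-1))" by (intro mult_left_mono diff_left_mono) auto
    hence "fejer t \<le> 4 / t\<^sup>2" unfolding fejer_eq[OF t(1)] by (intro divide_right_mono) simp_all
    also have "\<dots> \<le> 8 / (1 + t\<^sup>2)" using t by (simp add: field_simps add_pos_nonneg)
    also have "\<dots> \<le> (2 * B + 8) * inverse (1 + t\<^sup>2)" using B by (simp add: field_simps add_pos_nonneg)
    finally show ?thesis .
  qed
  note bound = this
  have le: "norm (fejer t) \<le> norm ((2 * B + 8) * inverse (1 + t\<^sup>2))" for t
    unfolding real_norm_def abs_of_nonneg[OF fejer_nonneg] by (rule order_trans[OF bound abs_ge_self])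
  have "integrable lborel (\<lambda>t::real. (2 * B + 8) * inverse (1 + t\<^sup>2))"
    using integrable_inverse_1_plus_square by (simp add: set_integrable_def)
  then show ?thesis by (rule Bochner_Integration.integrable_bound) (use le in auto)
qed

text \<open>The two Fejer kernels have disjoint zero sets, so their sum can be divided out on the half line.\<close>

definition fejer2 :: "real \<Rightarrow> real" where "fejer2 t = fejer t + fejer (t + pi)"

text \<open>Translating the kernel by pi modulates the function whose transform it is;
  \<open>tent2_fourier\<close> makes the link with \<open>fejer2\<close>.\<close>

definition tent2 :: "real \<Rightarrow> complex" where "tent2 s = of_real (tent s) * (1 + iexp (pi * s))"

lemma tent2_cont: "continuous_on UNIV tent2"
  unfolding tent2_def[abs_def] by (intro continuous_intros tent_cont)

lemma tent2_supp: "\<bar>s\<bar> > 1 \<Longrightarrow> tent2 s = 0"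
  by (simp add: tent2_def tent_def)

lemma tent2_0: "tent2 0 = 2"
  by (simp add: tent2_def tent_def)

lemma iexp_times: "iexp a * iexp b = iexp (a + b)"
  by (simp add: exp_add distrib_left)

lemma tent2_eq: "tent2 s * iexp (s * t) = of_real (tent s) * iexp (s * t) + of_real (tent s) * iexp (s * (t + pi))"
proof -
  have "iexp (s * (t + pi)) = iexp (pi * s) * iexp (s * t)"
    unfolding iexp_times by (simp add: algebra_simps)
  then show ?thesis by (simp add: tent2_def algebra_simps)
qed

lemma tent2_integrable: "integrable lborel tent2"
proof -
  have "tent2 = (\<lambda>s. of_real (tent s) * iexp (s * 0) + of_real (tent s) * iexp (s * (0 + pi)))"
    using tent2_eq[of _ 0] by (intro ext) simp
  then show ?thesis
    using Bochner_Integration.integrable_add[OF tent_iexp_integrable[of 0] tent_iexp_integrable[of "0 + pi"]]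
    by (simp only:)
qed

lemma tent2_fourier: "(LINT s|lborel. tent2 s * iexp (s * t)) = of_real (fejer2 t)"
  unfolding tent2_eq fejer2_def
  by (subst Bochner_Integration.integral_add[OF tent_iexp_integrable tent_iexp_integrable])
    (simp only: tent_fourier of_real_add)

lemma fejer2_nonneg: "fejer2 t \<ge> 0"
  by (simp add: fejer2_def fejer_nonneg)

lemma fejer2_cont: "continuous_on UNIV fejer2"
  unfolding fejer2_def[abs_def]
  by (intro continuous_intros fejer_cont continuous_on_compose2[OF fejer_cont]) auto

lemma fejer2_meas [measurable]: "fejer2 \<in> borel_measurable borel"
  using fejer2_cont by (rule borel_measurable_continuous_onI)

lemma fejer2_integrable: "integrable lborel fejer2"
  unfolding fejer2_def[abs_def]
  using fejer_integrable lborel_integrable_real_affine[OF fejer_integrable, of 1 pi]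
  by (intro Bochner_Integration.integrable_add) (auto simp: add.commute)

text \<open>Since cos (t + pi) = - cos t, the two numerators add up to 4 over the larger of the two
  denominators. The bound decays only quadratically, so exp (- \<theta> t) divided by the kernel
  stays bounded.\<close>

lemma fejer2_lower:
  assumes "t \<ge> 0"
  shows "4 / (t + pi)\<^sup>2 \<le> fejer2 t"
proof -
  have p: "t + pi > 0" using assms pi_gt_zero by linarith
  have f2: "fejer (t + pi) = 2 * (1 + cos t) / (t + pi)\<^sup>2" using p by (subst fejer_eq) auto
  show ?thesis
  proof (cases "t = 0")
    case True
    then show ?thesis using f2 fejer_nonneg[of 0] by (simp add: fejer2_def)
  next
    case False
    have "2 * (1 - cos t) / (t + pi)\<^sup>2 \<le> 2 * (1 - cos t) / t\<^sup>2"
      using assms False p by (intro divide_left_mono power_mono mult_pos_pos) auto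
    moreover have "4 / (t + pi)\<^sup>2 = 2 * (1 - cos t) / (t + pi)\<^sup>2 + 2 * (1 + cos t) / (t + pi)\<^sup>2"
      by (simp add: add_divide_distrib[symmetric])
    ultimately show ?thesis by (simp only: fejer2_def f2 fejer_eq[OF False])
  qed
qed

lemma fejer2_bounded: obtains B where "B > 0" "\<And>t. fejer2 t \<le> B"
proof -
  let ?B = "LINT s|lborel. norm (tent2 s)"
  have "fejer2 t \<le> ?B" for t
  proof -
    have "fejer2 t = norm (LINT s|lborel. tent2 s * iexp (s * t))" unfolding tent2_fourier using fejer2_nonneg by simp
    also have "\<dots> \<le> (LINT s|lborel. norm (tent2 s * iexp (s * t)))" by (rule integral_norm_bound)
    also have "(\<lambda>s. norm (tent2 s * iexp (s * t))) = (\<lambda>s. norm (tent2 s))" by (simp add: norm_mult del: of_real_mult)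
    finally show ?thesis .
  qed
  moreover have "?B \<ge> 0" by simp
  ultimately show thesis by (intro that[of "?B + 1"]) (auto intro: order_trans[of _ ?B] simp: add_nonneg_pos)
qed

text \<open>The Gaussian bound is asked on each bounded frequency range, with constants depending on
  \<open>R\<close>; this is what a spectral condition on compact vertical segments can
  provide.\<close>

locale gaussian_family =
  fixes Q :: "nat \<Rightarrow> real measure" and \<sigma> :: real
  assumes \<sigma>: "\<sigma> > 0" and Q: "\<And>N. real_distribution (Q N)"
    and char_bound: "\<And>R. \<exists>K \<kappa>. \<kappa> > 0 \<and>
        (\<forall>\<^sub>F N in sequentially. \<forall>s. \<bar>s\<bar> \<le> R \<longrightarrow> cmod (char (Q N) s) \<le> K * exp (- (\<kappa> * real N * s\<^sup>2)))"
    and char_limit: "\<And>u. (\<lambda>N. char (Q N) (u / sqrt (real N))) \<longlonglongrightarrow> of_real (exp (- (\<sigma>\<^sup>2 * u\<^sup>2 / 2)))"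
begin

lemma kernel_limit:
  "(\<lambda>N. sqrt (real N) * (LINT t|Q N. of_real (fejer2 t) * iexp (u * t))) \<longlonglongrightarrow> tent2 (-u) * (sqrt (2 * pi) / \<sigma>)"
proof -
  have "(\<lambda>N. sqrt (real N) * (LINT s|lborel. tent2 (s - u) * char (Q N) s)) \<longlonglongrightarrow> tent2 (0 - u) * (sqrt (2 * pi) / \<sigma>)"
  \<comment> \<open>Translating the kernel by \<open>u\<close> enlarges its support to |s| \<le> 1 +
    |u|.\<close>
  proof (rule gaussian_scaling_limit[OF \<sigma> _ _ _ _ char_bound char_limit, where R="1 + \<bar>u\<bar>"])
    show "char (Q N) \<in> borel_measurable borel" for N by (rule real_distribution.char_measurable[OF Q])
    show "continuous_on UNIV (\<lambda>s. tent2 (s - u))"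
      by (intro continuous_on_compose2[OF tent2_cont] continuous_intros) auto
  qed (auto intro!: tent2_supp)
  then show ?thesis
    using real_distribution.fourier_kernel_integral[OF Q tent2_integrable] by (simp only: tent2_fourier) simp
qed

end

text \<open>A reference family with explicit densities, for which \<open>kernel_limit\<close> can be
  compared with a direct computation.\<close>

lemma scaled_normal_family:
  "gaussian_family (\<lambda>N. distr std_normal_distribution borel (\<lambda>x. sqrt (real N) * x)) 1"
proof -
  interpret S: real_distribution std_normal_distribution by (rule real_dist_normal_dist)
  let ?Q = "\<lambda>N. distr std_normal_distribution borel (\<lambda>x. sqrt (real N) * x)"
  have ch: "char (?Q N) s = of_real (exp (- (1/2 * real N * s\<^sup>2)))" for N s
  proof -
    have "char (?Q N) s = char std_normal_distribution (s * sqrt (real N))"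
      unfolding char_def by (subst integral_distr) (auto simp: mult_ac)
    then show ?thesis by (simp add: char_std_normal_distribution power_mult_distrib mult_ac)
  qed
  show ?thesis
  proof (rule gaussian_family.intro)
    show "real_distribution (?Q N)" for N by (rule S.real_distribution_distr) simp
    show "\<exists>K \<kappa>. \<kappa> > 0 \<and> (\<forall>\<^sub>F N in sequentially. \<forall>s. \<bar>s\<bar> \<le> R \<longrightarrow> cmod (char (?Q N) s) \<le> K * exp (- (\<kappa> * real N * s\<^sup>2)))" for R
      unfolding ch by (intro exI[of _ 1] exI[of _ "1/2"]) auto
    show "(\<lambda>N. char (?Q N) (u / sqrt (real N))) \<longlonglongrightarrow> of_real (exp (- (1\<^sup>2 * u\<^sup>2 / 2)))" for u
    proof (rule tendsto_eventually)
      show "\<forall>\<^sub>F N in sequentially. char (?Q N) (u / sqrt (real N)) = of_real (exp (- (1\<^sup>2 * u\<^sup>2 / 2)))"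
        using eventually_gt_at_top[of 0] by eventually_elim (simp add: ch power_divide)
    qed
  qed simp
qed

text \<open>Fourier inversion for the kernel, by comparing with centred normal laws of growing variance.\<close>

lemma fejer2_fourier: "(LINT t|lborel. of_real (fejer2 t) * iexp (u * t)) = 2 * pi * tent2 (-u)"
proof -
  let ?Q = "\<lambda>N. distr std_normal_distribution borel (\<lambda>x. sqrt (real N) * x)"
  let ?F = "\<lambda>t. of_real (fejer2 t) * iexp (u * t)"
  interpret gaussian_family ?Q 1 by (rule scaled_normal_family)
  have [measurable]: "?F \<in> borel_measurable borel" by measurable
  have nF: "norm (?F t) = fejer2 t" for t using fejer2_nonneg[of t] by (simp add: norm_mult)
  have F: "integrable lborel ?F"
    by (rule Bochner_Integration.integrable_bound[OF fejer2_integrable]) (auto simp: nF simp del: of_real_mult)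
  have eq: "sqrt (real N) * (LINT t|?Q N. ?F t) = (LINT t|lborel. std_normal_density (t / sqrt (real N)) *\<^sub>R ?F t)"
    if N: "N > 0" for N
  proof -
    have "(LINT t|?Q N. ?F t) = (LINT x|std_normal_distribution. ?F (sqrt (real N) * x))"
      by (rule integral_distr) auto
    also have "\<dots> = (LINT x|lborel. std_normal_density x *\<^sub>R ?F (sqrt (real N) * x))"
      by (rule integral_density) auto
    finally have *: "(LINT t|?Q N. ?F t) = (LINT x|lborel. std_normal_density x *\<^sub>R ?F (sqrt (real N) * x))" .
    show ?thesis unfolding * using N
      by (subst lborel_integral_real_affine[of "sqrt (real N)" "\<lambda>t. std_normal_density (t / sqrt (real N)) *\<^sub>R ?F t" 0])
        (simp_all add: scaleR_conv_of_real)
  qed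
  \<comment> \<open>The density of variance N times sqrt N tends to the constant 1 / sqrt (2 pi), so
    the quantity in \<open>kernel_limit\<close> also converges to a multiple of the Lebesgue
    integral.\<close>
  have "(\<lambda>N. LINT t|lborel. std_normal_density (t / sqrt (real N)) *\<^sub>R ?F t) \<longlonglongrightarrow> (LINT t|lborel. std_normal_density 0 *\<^sub>R ?F t)"
  proof (rule integral_dominated_convergence[where w="\<lambda>t. (1 / sqrt (2 * pi)) * fejer2 t"])
    show "integrable lborel (\<lambda>t. (1 / sqrt (2 * pi)) * fejer2 t)" using fejer2_integrable by (rule integrable_mult_right)
    show "AE t in lborel. (\<lambda>N. std_normal_density (t / sqrt (real N)) *\<^sub>R ?F t) \<longlonglongrightarrow> std_normal_density 0 *\<^sub>R ?F t"
    proof (intro AE_I2 tendsto_scaleR tendsto_const)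
      fix t
      have "(\<lambda>N. t / sqrt (real N)) \<longlonglongrightarrow> 0" by (rule tendsto_divide_sqrt_0)
      moreover have "isCont std_normal_density 0"
        unfolding std_normal_density_def[abs_def] by (intro continuous_intros) auto
      ultimately show "(\<lambda>N. std_normal_density (t / sqrt (real N))) \<longlonglongrightarrow> std_normal_density 0"
        by (rule isCont_tendsto_compose[rotated])
    qed
    show "AE t in lborel. norm (std_normal_density (t / sqrt (real N)) *\<^sub>R ?F t) \<le> (1 / sqrt (2 * pi)) * fejer2 t" for N
    proof (rule AE_I2)
      fix t
      have "std_normal_density (t / sqrt (real N)) \<le> 1 / sqrt (2 * pi)"
        unfolding std_normal_density_def by (auto intro!: divide_right_mono)
      then show "norm (std_normal_density (t / sqrt (real N)) *\<^sub>R ?F t) \<le> (1 / sqrt (2 * pi)) * fejer2 t"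
        unfolding norm_scaleR nF using fejer2_nonneg[of t] by (intro mult_right_mono) auto
    qed
  qed measurable
  also have "(LINT t|lborel. std_normal_density 0 *\<^sub>R ?F t) = of_real (1 / sqrt (2 * pi)) * (LINT t|lborel. ?F t)"
    using F by (simp add: std_normal_density_def scaleR_conv_of_real)
  finally have "(\<lambda>N. LINT t|lborel. std_normal_density (t / sqrt (real N)) *\<^sub>R ?F t)
      \<longlonglongrightarrow> of_real (1 / sqrt (2 * pi)) * (LINT t|lborel. ?F t)" .
  moreover have "(\<lambda>N. LINT t|lborel. std_normal_density (t / sqrt (real N)) *\<^sub>R ?F t) \<longlonglongrightarrow> tent2 (-u) * (sqrt (2 * pi) / 1)"
  proof (rule Lim_transform_eventually[OF kernel_limit])
    show "\<forall>\<^sub>F N in sequentially. sqrt (real N) * (LINT t|?Q N. ?F t)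
        = (LINT t|lborel. std_normal_density (t / sqrt (real N)) *\<^sub>R ?F t)"
      using eventually_gt_at_top[of 0] by eventually_elim (rule eq)
  qed
  ultimately have "of_real (1 / sqrt (2 * pi)) * (LINT t|lborel. ?F t) = tent2 (-u) * (sqrt (2 * pi) / 1)"
    by (rule LIMSEQ_unique)
  hence "(LINT t|lborel. ?F t) = tent2 (-u) * (complex_of_real (sqrt (2 * pi)) * complex_of_real (sqrt (2 * pi)))"
    by (simp add: field_simps del: of_real_mult real_sqrt_mult)
  also have "complex_of_real (sqrt (2 * pi)) * complex_of_real (sqrt (2 * pi)) = of_real (2 * pi)"
    unfolding of_real_mult[symmetric] by simp
  finally show ?thesis by (simp add: mult_ac)
qed

text \<open>Bounds exp (- \<theta> t) divided by the lower bound of \<open>fejer2\<close>. The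
  constant comes from squaring 1 + t \<le> C (1 + \<theta> t / 2) \<le> C exp (\<theta> t / 2) with
  C = max 1 (2 / \<theta>).\<close>

lemma exp_weight_bound:
  assumes \<theta>: "\<theta> > 0" and t: "t \<ge> 0"
  shows "exp (- (\<theta> * t)) * (t + pi)\<^sup>2 \<le> (pi * max 1 (2 / \<theta>))\<^sup>2"
proof -
  let ?C = "max 1 (2 / \<theta>)"
  have "t + pi \<le> pi * (1 + t)" using t pi_gt3 mult_right_mono[of 1 pi t] by (simp add: algebra_simps)
  also have "\<dots> \<le> pi * (?C * exp (\<theta> * t / 2))"
  proof (intro mult_left_mono)
    have "(2 / \<theta>) * (\<theta> * t / 2) \<le> ?C * (\<theta> * t / 2)" using \<theta> t by (intro mult_right_mono) auto
    hence "t \<le> ?C * (\<theta> * t / 2)" using \<theta> by simp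
    hence "1 + t \<le> ?C * 1 + ?C * (\<theta> * t / 2)" by (intro add_mono) auto
    hence "1 + t \<le> ?C * (1 + \<theta> * t / 2)" by (simp only: distrib_left)
    also have "\<dots> \<le> ?C * exp (\<theta> * t / 2)" by (intro mult_left_mono exp_ge_add_one_self) auto
    finally show "1 + t \<le> ?C * exp (\<theta> * t / 2)" .
  qed simp
  finally have "(t + pi)\<^sup>2 \<le> (pi * (?C * exp (\<theta> * t / 2)))\<^sup>2" using t by (intro power_mono) auto
  also have "\<dots> = (pi * ?C)\<^sup>2 * exp (\<theta> * t)"
    by (simp add: power_mult_distrib flip: exp_double)
  finally have "exp (- (\<theta> * t)) * (t + pi)\<^sup>2 \<le> exp (- (\<theta> * t)) * ((pi * ?C)\<^sup>2 * exp (\<theta> * t))" by simp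
  then show ?thesis by (simp add: exp_minus field_simps)
qed

lemma exp_half_line_integral:
  fixes \<theta> :: real
  assumes "\<theta> > 0"
  shows "(LINT t|lborel. indicator {0..} t * exp (- (\<theta> * t))) = 1 / \<theta>"
proof -
  have "(LINT t|lborel. \<theta> * (indicator {0..} t * exp (- (\<theta> * t)))) = 1"
  proof -
    have "prob_space (density lborel (exponential_density \<theta>))" using assms by (rule prob_space_exponential_density)
    hence "(\<integral>\<^sup>+ t. ennreal (exponential_density \<theta> t) \<partial>lborel) = 1"
      by (auto dest!: prob_space.emeasure_space_1 simp: emeasure_density)
    hence "(LINT t|lborel. exponential_density \<theta> t) = 1"
      using assms by (subst integral_eq_nn_integral) (auto simp: exponential_density_nonneg)
    moreover have "exponential_density \<theta> t = \<theta> * (indicator {0..} t * exp (- (\<theta> * t)))" for t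
      by (auto simp: exponential_density_def indicator_def mult_ac)
    ultimately show ?thesis by simp
  qed
  then show ?thesis using assms by (simp add: field_simps)
qed

section \<open>Local limit theorem for an exponential weight on the half line\<close>

context gaussian_family
begin

theorem local_limit_exponential:
  assumes \<theta>: "\<theta> > 0"
  shows "(\<lambda>N. sqrt (real N) * (LINT t|Q N. indicator {0..} t * exp (- (\<theta> * t)))) \<longlonglongrightarrow> 1 / (\<theta> * \<sigma> * sqrt (2 * pi))"
proof -
  interpret Q: real_distribution "Q N" for N by (rule Q)
  let ?h = "\<lambda>t. indicator {0..} t * exp (- (\<theta> * t)) :: real"
  define m where "m N = sqrt (real N) * (LINT t|Q N. fejer2 t)" for N
  obtain B where B: "B > 0" "\<And>t. fejer2 t \<le> B" using fejer2_bounded by blast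
  have pQ: "integrable (Q N) fejer2" for N
    using B fejer2_nonneg by (intro Q.integrable_const_bound[where B=B]) auto
  have mlim: "m \<longlonglongrightarrow> 2 * sqrt (2 * pi) / \<sigma>"
  proof -
    have "(\<lambda>N. complex_of_real (m N)) \<longlonglongrightarrow> of_real (2 * sqrt (2 * pi) / \<sigma>)"
      using kernel_limit[of 0] by (simp add: m_def tent2_0)
    then show ?thesis by (simp only: tendsto_of_real_iff)
  qed
  moreover have mpos: "2 * sqrt (2 * pi) / \<sigma> > 0" using \<sigma> by simp
  ultimately have "\<forall>\<^sub>F N in sequentially. m N > 0" by (rule order_tendstoD)
  \<comment> \<open>The kernel-weighted laws can be normalised only once their mass is positive,
    hence the shift by \<open>N0\<close>.\<close>
  then obtain N0 where N0: "\<And>N. N \<ge> N0 \<Longrightarrow> m N > 0" by (auto simp: eventually_sequentially)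
  define M where "M n = density (Q (n + N0)) (\<lambda>t. sqrt (real (n + N0)) / m (n + N0) * fejer2 t)" for n
  \<comment> \<open>The total mass of \<open>fejer2\<close> is 4 pi, which is 2 pi times the value 2
    of \<open>tent2\<close> at 0.\<close>
  define M' where "M' = density lborel (\<lambda>t. fejer2 t / (4 * pi))"
  have mp: "m (n + N0) > 0" for n by (rule N0) simp
  have nonneg: "sqrt (real (n + N0)) / m (n + N0) * fejer2 t \<ge> 0" for n t using mp[of n] fejer2_nonneg[of t] by simp
  have int4: "(LINT t|lborel. fejer2 t) = 4 * pi"
  proof -
    have "complex_of_real (LINT t|lborel. fejer2 t) = of_real (4 * pi)"
      using fejer2_fourier[of 0] by (simp add: tent2_0)
    then show ?thesis by (simp only: of_real_eq_iff)
  qed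
  have M: "real_distribution (M n)" for n
  proof -
    have "(\<integral>\<^sup>+ t. ennreal (sqrt (real (n + N0)) / m (n + N0) * fejer2 t) \<partial>Q (n + N0))
        = ennreal (LINT t|Q (n + N0). sqrt (real (n + N0)) / m (n + N0) * fejer2 t)"
      by (intro nn_integral_eq_integral integrable_mult_right pQ AE_I2 nonneg)
    also have "(LINT t|Q (n + N0). sqrt (real (n + N0)) / m (n + N0) * fejer2 t) = m (n + N0) / m (n + N0)"
      unfolding integral_mult_right_zero by (simp add: m_def)
    also have "\<dots> = 1" using mp[of n] by simp
    finally have "(\<integral>\<^sup>+ t. ennreal (sqrt (real (n + N0)) / m (n + N0) * fejer2 t) \<partial>Q (n + N0)) = 1" by simp
    hence "prob_space (M n)"
      by (intro prob_spaceI) (simp add: M_def emeasure_density)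
    then show ?thesis by (simp add: real_distribution_def real_distribution_axioms_def M_def)
  qed
  have M': "real_distribution M'"
  proof -
    have "(\<integral>\<^sup>+ t. ennreal (fejer2 t / (4 * pi)) \<partial>lborel) = ennreal 1"
      using fejer2_integrable fejer2_nonneg int4
      by (subst nn_integral_eq_integral) auto
    hence "prob_space M'"
      by (intro prob_spaceI) (simp add: M'_def emeasure_density)
    then show ?thesis by (simp add: real_distribution_def real_distribution_axioms_def M'_def)
  qed
  have intM: "(LINT t|M n. f t) = (sqrt (real (n + N0)) / m (n + N0)) *\<^sub>R (LINT t|Q (n + N0). fejer2 t *\<^sub>R f t)"
    if [measurable]: "f \<in> borel_measurable borel" for f :: "real \<Rightarrow> 'z::{banach, second_countable_topology}" and n
  proof -
    have "(LINT t|M n. f t) = (LINT t|Q (n + N0). (sqrt (real (n + N0)) / m (n + N0) * fejer2 t) *\<^sub>R f t)"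
      unfolding M_def using nonneg by (intro integral_density) auto
    also have "\<dots> = (LINT t|Q (n + N0). (sqrt (real (n + N0)) / m (n + N0)) *\<^sub>R (fejer2 t *\<^sub>R f t))" by simp
    finally show ?thesis by (simp only: integral_scaleR_right)
  qed
  have intM': "(LINT t|M'. f t) = (1 / (4 * pi)) *\<^sub>R (LINT t|lborel. fejer2 t *\<^sub>R f t)"
    if [measurable]: "f \<in> borel_measurable borel" for f :: "real \<Rightarrow> 'z::{banach, second_countable_topology}"
  proof -
    have "(LINT t|M'. f t) = (LINT t|lborel. (fejer2 t / (4 * pi)) *\<^sub>R f t)"
      unfolding M'_def using fejer2_nonneg by (intro integral_density) auto
    also have "\<dots> = (LINT t|lborel. (1 / (4 * pi)) *\<^sub>R (fejer2 t *\<^sub>R f t))" by simp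
    finally show ?thesis by (simp only: integral_scaleR_right)
  qed
  have "weak_conv_m M M'"
  proof (rule levy_continuity[OF M M'])
    fix u
    have c: "char (M n) u = of_real (1 / m (n + N0)) * (sqrt (real (n + N0)) * (LINT t|Q (n + N0). of_real (fejer2 t) * iexp (u * t)))" for n
      unfolding char_def by (subst intM) (auto simp: scaleR_conv_of_real)
    have c': "char M' u = tent2 (-u) / 2"
      unfolding char_def using fejer2_fourier[of u] by (subst intM') (auto simp: scaleR_conv_of_real)
    have "(\<lambda>N. of_real (1 / m N) * (sqrt (real N) * (LINT t|Q N. of_real (fejer2 t) * iexp (u * t))))
        \<longlonglongrightarrow> of_real (1 / (2 * sqrt (2 * pi) / \<sigma>)) * (tent2 (-u) * (sqrt (2 * pi) / \<sigma>))"
      using mpos by (intro tendsto_mult kernel_limit tendsto_of_real tendsto_divide tendsto_const mlim) auto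
    also have "of_real (1 / (2 * sqrt (2 * pi) / \<sigma>)) * (tent2 (-u) * (sqrt (2 * pi) / \<sigma>)) = char M' u"
      unfolding c' using \<sigma> by (simp add: field_simps)
    finally show "(\<lambda>n. char (M n) u) \<longlonglongrightarrow> char M' u"
      unfolding c by (rule LIMSEQ_ignore_initial_segment)
  qed
  \<comment> \<open>Bounded thanks to \<open>fejer2_lower\<close>, and continuous except at 0, which
    is a null set of the limit law. Weak convergence therefore extends to this test
    function.\<close>
  define g where "g t = ?h t / fejer2 t" for t
  have g_meas [measurable]: "g \<in> borel_measurable borel" unfolding g_def[abs_def] by measurable
  have ppos: "fejer2 t > 0" if "t \<ge> 0" for t
    using fejer2_lower[OF that] that pi_gt_zero by (smt (verit) divide_pos_pos zero_less_power)
  have pg: "fejer2 t * g t = ?h t" for t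
    using ppos[of t] by (cases "t \<ge> 0") (auto simp: g_def)
  have "(\<lambda>n. LINT t|M n. g t) \<longlonglongrightarrow> (LINT t|M'. g t)"
  proof (rule weak_conv_imp_bdd_ae_continuous_conv[OF M M' \<open>weak_conv_m M M'\<close>])
    have "isCont g t" if "t \<noteq> 0" for t
    proof (cases "t < 0")
      case True
      have "\<forall>\<^sub>F x in nhds t. g x = 0"
        using eventually_nhds_in_open[of "{..<0}" t] True by (auto elim!: eventually_mono simp: g_def)
      then show ?thesis by (subst isCont_cong[where g="\<lambda>_. 0"]) auto
    next
      case False
      hence t: "t > 0" using that by simp
      have "\<forall>\<^sub>F x in nhds t. g x = exp (- (\<theta> * x)) / fejer2 x"
        using eventually_nhds_in_open[of "{0<..}" t] t by (auto elim!: eventually_mono simp: g_def)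
      moreover have "isCont fejer2 t" using fejer2_cont by (simp add: continuous_on_eq_continuous_at)
      ultimately show ?thesis using ppos[of t] t
        by (subst isCont_cong[where g="\<lambda>x. exp (- (\<theta> * x)) / fejer2 x"]) (auto intro!: continuous_intros)
    qed
    hence sub: "{x. \<not> isCont g x} \<subseteq> {0}" by auto
    have "emeasure M' {0} = 0"
      using AE_lborel_singleton[of "0::real"] unfolding M'_def
      by (subst emeasure_density) (auto simp: nn_integral_0_iff_AE elim!: eventually_mono)
    then show "emeasure M' {x. \<not> isCont g x} = 0"
      using emeasure_mono[OF sub, of M'] by (simp add: M'_def)
    fix t
    have "g t \<ge> 0" using fejer2_nonneg[of t] by (simp add: g_def)
    moreover have "g t \<le> (pi * max 1 (2 / \<theta>))\<^sup>2 / 4"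
    proof (cases "t \<ge> 0")
      case True
      have tp: "t + pi > 0" using True pi_gt_zero by linarith
      have "g t \<le> exp (- (\<theta> * t)) / (4 / (t + pi)\<^sup>2)"
        using True fejer2_lower[OF True] tp ppos[OF True] unfolding g_def by (intro frac_le) auto
      also have "\<dots> = exp (- (\<theta> * t)) * (t + pi)\<^sup>2 / 4" by simp
      also have "\<dots> \<le> (pi * max 1 (2 / \<theta>))\<^sup>2 / 4" using exp_weight_bound[OF \<theta> True] by (intro divide_right_mono) auto
      finally show ?thesis .
    qed (simp add: g_def)
    ultimately show "norm (g t) \<le> (pi * max 1 (2 / \<theta>))\<^sup>2 / 4" by simp
  qed (rule g_meas)
  moreover have "(LINT t|M'. g t) = 1 / (4 * pi * \<theta>)"
    using intM'[OF g_meas] exp_half_line_integral[OF \<theta>] by (simp add: pg)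
  moreover have "(LINT t|M n. g t) = (sqrt (real (n + N0)) / m (n + N0)) * (LINT t|Q (n + N0). ?h t)" for n
    using intM[OF g_meas, of n] by (simp add: pg)
  ultimately have "(\<lambda>n. (sqrt (real (n + N0)) / m (n + N0)) * (LINT t|Q (n + N0). ?h t)) \<longlonglongrightarrow> 1 / (4 * pi * \<theta>)" by simp
  hence "(\<lambda>n. m (n + N0) * ((sqrt (real (n + N0)) / m (n + N0)) * (LINT t|Q (n + N0). ?h t)))
      \<longlonglongrightarrow> (2 * sqrt (2 * pi) / \<sigma>) * (1 / (4 * pi * \<theta>))"
    by (intro tendsto_mult LIMSEQ_ignore_initial_segment[OF mlim])
  moreover have "m (n + N0) * ((sqrt (real (n + N0)) / m (n + N0)) * (LINT t|Q (n + N0). ?h t))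
      = sqrt (real (n + N0)) * (LINT t|Q (n + N0). ?h t)" for n using mp[of n] by simp
  moreover have "(2 * sqrt (2 * pi) / \<sigma>) * (1 / (4 * pi * \<theta>)) = 1 / (\<theta> * \<sigma> * sqrt (2 * pi))"
  proof -
    have "4 * pi = 2 * (sqrt (2 * pi) * sqrt (2 * pi))" by simp
    then show ?thesis using \<sigma> \<theta> by (simp only:) (simp add: field_simps)
  qed
  ultimately have "(\<lambda>n. sqrt (real (n + N0)) * (LINT t|Q (n + N0). ?h t)) \<longlonglongrightarrow> 1 / (\<theta> * \<sigma> * sqrt (2 * pi))" by (simp only:)
  then show ?thesis by (rule LIMSEQ_offset)
qed

end

section \<open>Legendre transform\<close>

text \<open>The limit of \<open>\<Lambda>\<close> at \<delta> may be infinite, so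
  \<open>a_bound\<close> lives in \<open>ereal\<close>; it is the upper bound on \<open>a\<close>
  multiplied by \<delta>.\<close>

locale convex_cgf =
  fixes \<Lambda> \<Lambda>1 \<Lambda>2 :: "real \<Rightarrow> real" and \<delta> a :: real and I :: "real \<Rightarrow> real"
  assumes \<delta>: "\<delta> > 0"
    and d1: "\<And>t. \<bar>t\<bar> < \<delta> \<Longrightarrow> (\<Lambda> has_real_derivative \<Lambda>1 t) (at t)"
    and d2: "\<And>t. \<bar>t\<bar> < \<delta> \<Longrightarrow> (\<Lambda>1 has_real_derivative \<Lambda>2 t) (at t)"
    and pos: "\<And>t. \<bar>t\<bar> < \<delta> \<Longrightarrow> \<Lambda>2 t > 0"
    and zero: "\<Lambda> 0 = 0" "\<Lambda>1 0 = 0"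
    and a_pos: "a > 0"
    and a_bound: "ereal (a * \<delta>) < Lim (at_left \<delta>) (\<lambda>\<theta>. ereal (\<Lambda> \<theta>))"
    and I_def: "\<And>b. I b = (SUP \<theta>\<in>{0<..<\<delta>}. b * \<theta> - \<Lambda> \<theta>)"
begin

lemma slope_mono:
  assumes "\<bar>s\<bar> < \<delta>" "\<bar>t\<bar> < \<delta>" "s < t"
  shows "\<Lambda>1 s < \<Lambda>1 t"
proof (rule DERIV_pos_imp_increasing[OF assms(3)])
  fix x assume "s \<le> x" "x \<le> t"
  hence "\<bar>x\<bar> < \<delta>" using assms by auto
  then show "\<exists>y. (\<Lambda>1 has_real_derivative y) (at x) \<and> y > 0" using d2 pos by blast
qed

lemma slope_cont: "\<bar>t\<bar> < \<delta> \<Longrightarrow> isCont \<Lambda>1 t"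
  by (rule DERIV_isCont[OF d2])

lemma tangent:
  assumes t: "\<bar>t\<bar> < \<delta>" and \<theta>: "\<bar>\<theta>\<bar> < \<delta>" and ne: "t \<noteq> \<theta>"
  shows "\<Lambda> t > \<Lambda> \<theta> + \<Lambda>1 \<theta> * (t - \<theta>)"
proof (cases "\<theta> < t")
  case True
  obtain \<xi> where \<xi>: "\<theta> < \<xi>" "\<xi> < t" "\<Lambda> t - \<Lambda> \<theta> = (t - \<theta>) * \<Lambda>1 \<xi>"
    using MVT2[OF True, of \<Lambda> \<Lambda>1] d1 t \<theta> by force
  have "\<Lambda>1 \<theta> < \<Lambda>1 \<xi>" using \<xi> t \<theta> by (intro slope_mono) auto
  hence "(t - \<theta>) * \<Lambda>1 \<theta> < (t - \<theta>) * \<Lambda>1 \<xi>" using True by simp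
  then show ?thesis using \<xi>(3) by (simp add: mult.commute)
next
  case False
  hence lt: "t < \<theta>" using ne by simp
  obtain \<xi> where \<xi>: "t < \<xi>" "\<xi> < \<theta>" "\<Lambda> \<theta> - \<Lambda> t = (\<theta> - t) * \<Lambda>1 \<xi>"
    using MVT2[OF lt, of \<Lambda> \<Lambda>1] d1 t \<theta> by force
  have "\<Lambda>1 \<xi> < \<Lambda>1 \<theta>" using \<xi> t \<theta> by (intro slope_mono) auto
  hence "(\<theta> - t) * \<Lambda>1 \<xi> < (\<theta> - t) * \<Lambda>1 \<theta>" using lt by simp
  then show ?thesis using \<xi>(3) by (simp add: algebra_simps)
qed

lemma conjugate_at_slope:
  assumes \<theta>: "\<theta> \<in> {0<..<\<delta>}"
  shows "I (\<Lambda>1 \<theta>) = \<Lambda>1 \<theta> * \<theta> - \<Lambda> \<theta>"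
  unfolding I_def
proof (rule cSup_eq_maximum)
  show "\<Lambda>1 \<theta> * \<theta> - \<Lambda> \<theta> \<in> (\<lambda>t. \<Lambda>1 \<theta> * t - \<Lambda> t) ` {0<..<\<delta>}" using \<theta> by blast
  fix y assume "y \<in> (\<lambda>t. \<Lambda>1 \<theta> * t - \<Lambda> t) ` {0<..<\<delta>}"
  then obtain t where t: "t \<in> {0<..<\<delta>}" "y = \<Lambda>1 \<theta> * t - \<Lambda> t" by blast
  then show "y \<le> \<Lambda>1 \<theta> * \<theta> - \<Lambda> \<theta>"
    using tangent[of t \<theta>] \<theta> by (cases "t = \<theta>") (auto simp: algebra_simps)
qed

text \<open>\<open>Lim\<close> has a known value only once convergence is shown.
  \<open>\<Lambda>\<close> increases on the interval because its slope is positive there, so the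
  limit is the supremum, and \<open>a_bound\<close> becomes a statement about values of
  \<open>\<Lambda>\<close>.\<close>

lemma above_line: "\<exists>t\<in>{0<..<\<delta>}. \<Lambda> t > a * \<delta>"
proof (rule ccontr)
  assume "\<not> ?thesis"
  hence le: "\<Lambda> t \<le> a * \<delta>" if "t \<in> {0<..<\<delta>}" for t using that by force
  have mono: "\<Lambda> s \<le> \<Lambda> t" if "0 < s" "s \<le> t" "t < \<delta>" for s t
  proof (cases "s = t")
    case False
    have "\<Lambda>1 s > 0" using slope_mono[of 0 s] that zero \<delta> by auto
    hence "0 \<le> \<Lambda>1 s * (t - s)" using that by simp
    then show ?thesis using tangent[of t s] that False by auto
  qed simp
  define l where "l = (SUP t\<in>{0<..<\<delta>}. ereal (\<Lambda> t))"
  have "((\<lambda>t. ereal (\<Lambda> t)) \<longlongrightarrow> l) (at_left \<delta>)"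
  proof (rule order_tendstoI)
    fix y assume "y < l"
    then obtain s where s: "s \<in> {0<..<\<delta>}" "y < ereal (\<Lambda> s)" unfolding l_def less_SUP_iff by blast
    have "\<forall>\<^sub>F t in at_left \<delta>. t \<in> {s<..<\<delta>}" using s by (intro eventually_at_leftI) auto
    then show "\<forall>\<^sub>F t in at_left \<delta>. y < ereal (\<Lambda> t)"
    proof eventually_elim
      case (elim t)
      then have "ereal (\<Lambda> s) \<le> ereal (\<Lambda> t)" using mono[of s t] s by simp
      with s(2) show ?case by (rule less_le_trans)
    qed
  next
    fix y assume y: "l < y"
    have "\<forall>\<^sub>F t in at_left \<delta>. t \<in> {0<..<\<delta>}" using \<delta> by (intro eventually_at_leftI) auto
    then show "\<forall>\<^sub>F t in at_left \<delta>. ereal (\<Lambda> t) < y"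
    proof eventually_elim
      case (elim t)
      then have "ereal (\<Lambda> t) \<le> l" unfolding l_def by (rule SUP_upper)
      then show ?case using y by (rule le_less_trans)
    qed
  qed
  hence "Lim (at_left \<delta>) (\<lambda>t. ereal (\<Lambda> t)) = l" by (intro tendsto_Lim) (auto simp: trivial_limit_at_left_real)
  moreover have "l \<le> ereal (a * \<delta>)" unfolding l_def using le by (intro SUP_least) auto
  ultimately show False using a_bound by simp
qed

text \<open>The chord from 0 to a point with value above \<open>a * \<delta>\<close> has slope
  larger than \<open>a\<close>, hence so does some tangent. The slope at 0 is 0, and the
  intermediate value theorem does the rest.\<close>

lemma maximizer: "\<exists>\<theta>\<in>{0<..<\<delta>}. \<Lambda>1 \<theta> = a"
proof -
  obtain t where t: "t \<in> {0<..<\<delta>}" "\<Lambda> t > a * \<delta>" using above_line by blast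
  obtain \<xi> where \<xi>: "0 < \<xi>" "\<xi> < t" "\<Lambda> t - \<Lambda> 0 = (t - 0) * \<Lambda>1 \<xi>"
    using MVT2[of 0 t \<Lambda> \<Lambda>1] d1 t by force
  have "t * a < t * \<Lambda>1 \<xi>"
  proof -
    have "t * a < \<delta> * a" using t a_pos by simp
    also have "\<dots> < t * \<Lambda>1 \<xi>" using \<xi> t zero by (simp add: mult.commute)
    finally show ?thesis .
  qed
  hence big: "a < \<Lambda>1 \<xi>" using t by simp
  have "\<exists>x\<ge>0. x \<le> \<xi> \<and> \<Lambda>1 x = a"
  proof (rule IVT)
    show "\<forall>x. 0 \<le> x \<and> x \<le> \<xi> \<longrightarrow> isCont \<Lambda>1 x" using \<xi> t by (auto intro!: slope_cont)
  qed (use zero a_pos big \<xi> in auto)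
  then obtain x where x: "0 \<le> x" "x \<le> \<xi>" "\<Lambda>1 x = a" by blast
  have "x \<noteq> 0" using x zero a_pos by auto
  then show ?thesis using x \<xi> t by (intro bexI[of _ x]) auto
qed

lemma maximizer_exists: "\<exists>\<theta>\<in>{0<..<\<delta>}. I a = a * \<theta> - \<Lambda> \<theta>"
  using maximizer conjugate_at_slope by blast

text \<open>Strict convexity leaves only one maximiser, so any given one is the point of slope
  \<open>a\<close>.\<close>

lemma maximizer_slope:
  assumes \<theta>: "\<theta> \<in> {0<..<\<delta>}" and I: "I a = a * \<theta> - \<Lambda> \<theta>"
  shows "\<Lambda>1 \<theta> = a"
proof -
  obtain \<theta>' where \<theta>': "\<theta>' \<in> {0<..<\<delta>}" "\<Lambda>1 \<theta>' = a" using maximizer by blast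
  have "\<theta> = \<theta>'"
  proof (rule ccontr)
    assume "\<theta> \<noteq> \<theta>'"
    hence "\<Lambda> \<theta> > \<Lambda> \<theta>' + a * (\<theta> - \<theta>')" using tangent[of \<theta> \<theta>'] \<theta> \<theta>' by auto
    then show False using I conjugate_at_slope[OF \<theta>'(1)] \<theta>'(2) by (simp add: algebra_simps)
  qed
  then show ?thesis using \<theta>' by simp
qed

section \<open>Derivatives of the conjugate function\<close>

definition slope_inv where "slope_inv = the_inv_into {0<..<\<delta>} \<Lambda>1"

lemma slope_inv_slope: "t \<in> {0<..<\<delta>} \<Longrightarrow> slope_inv (\<Lambda>1 t) = t"
  unfolding slope_inv_def
proof (rule the_inv_into_f_f)
  show "inj_on \<Lambda>1 {0<..<\<delta>}"
  proof (rule inj_onI, rule ccontr)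
    fix x y assume "x \<in> {0<..<\<delta>}" "y \<in> {0<..<\<delta>}" "\<Lambda>1 x = \<Lambda>1 y" "x \<noteq> y"
    then show False using slope_mono[of x y] slope_mono[of y x] by (cases "x < y") auto
  qed
qed

text \<open>Differentiating \<open>slope_inv\<close> and \<open>I\<close> needs identities on a
  neighbourhood of the slope; the slopes at two surrounding points delimit one, by the intermediate
  value theorem.\<close>

lemma slope_range:
  assumes \<theta>: "\<theta> \<in> {0<..<\<delta>}"
  obtains l u where "l < \<Lambda>1 \<theta>" "\<Lambda>1 \<theta> < u" "\<And>y. l < y \<Longrightarrow> y < u \<Longrightarrow> \<exists>t\<in>{0<..<\<delta>}. y = \<Lambda>1 t"
proof -
  define s where "s = \<theta> / 2"
  define t where "t = (\<theta> + \<delta>) / 2"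
  have st: "0 < s" "s < \<theta>" "\<theta> < t" "t < \<delta>" using \<theta> by (auto simp: s_def t_def)
  show thesis
  proof (rule that[of "\<Lambda>1 s" "\<Lambda>1 t"])
    show "\<Lambda>1 s < \<Lambda>1 \<theta>" "\<Lambda>1 \<theta> < \<Lambda>1 t" using st by (auto intro!: slope_mono)
    fix y assume y: "\<Lambda>1 s < y" "y < \<Lambda>1 t"
    have "\<exists>x\<ge>s. x \<le> t \<and> \<Lambda>1 x = y"
      by (rule IVT) (use y st in \<open>auto intro!: slope_cont\<close>)
    then show "\<exists>t\<in>{0<..<\<delta>}. y = \<Lambda>1 t" using st by force
  qed
qed

lemma slope_inv_deriv:
  assumes \<theta>: "\<theta> \<in> {0<..<\<delta>}"
  shows "(slope_inv has_real_derivative inverse (\<Lambda>2 \<theta>)) (at (\<Lambda>1 \<theta>))"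
proof -
  obtain l u where lu: "l < \<Lambda>1 \<theta>" "\<Lambda>1 \<theta> < u" "\<And>y. l < y \<Longrightarrow> y < u \<Longrightarrow> \<exists>t\<in>{0<..<\<delta>}. y = \<Lambda>1 t"
    using slope_range[OF \<theta>] by blast
  define d where "d = min \<theta> (\<delta> - \<theta>) / 2"
  have d: "d > 0" "\<And>z. \<bar>z - \<theta>\<bar> \<le> d \<Longrightarrow> z \<in> {0<..<\<delta>}"
  proof -
    show "d > 0" using \<theta> by (simp add: d_def)
    fix z assume "\<bar>z - \<theta>\<bar> \<le> d"
    moreover have "d < \<theta>" "d < \<delta> - \<theta>" using \<theta> by (auto simp: d_def min_def)
    ultimately show "z \<in> {0<..<\<delta>}" by auto
  qed
  have "isCont slope_inv (\<Lambda>1 \<theta>)"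
  proof (rule isCont_inverse_function[where f=\<Lambda>1 and x=\<theta>, OF d(1)])
    fix z assume "\<bar>z - \<theta>\<bar> \<le> d"
    hence z: "z \<in> {0<..<\<delta>}" by (rule d(2))
    show "slope_inv (\<Lambda>1 z) = z" by (rule slope_inv_slope[OF z])
    show "isCont \<Lambda>1 z" using z by (intro slope_cont) auto
  qed
  moreover have "(\<Lambda>1 has_real_derivative \<Lambda>2 \<theta>) (at (slope_inv (\<Lambda>1 \<theta>)))"
    using slope_inv_slope[OF \<theta>] d2[of \<theta>] \<theta> by simp
  moreover have "\<Lambda>1 (slope_inv y) = y" if "l < y" "y < u" for y using lu(3)[OF that] slope_inv_slope by auto
  ultimately show ?thesis
    using DERIV_inverse_function[of \<Lambda>1 "\<Lambda>2 \<theta>" slope_inv "\<Lambda>1 \<theta>" l u] pos[of \<theta>] \<theta> lu(1,2) by auto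
qed

text \<open>Near the slope, I y = y s - \<Lambda> s with s = \<open>slope_inv y\<close>. The terms
  containing the derivative of s cancel because the slope of \<open>\<Lambda>\<close> at s is
  y.\<close>

lemma I_deriv:
  assumes \<theta>: "\<theta> \<in> {0<..<\<delta>}"
  shows "(I has_real_derivative \<theta>) (at (\<Lambda>1 \<theta>))"
proof -
  obtain l u where lu: "l < \<Lambda>1 \<theta>" "\<Lambda>1 \<theta> < u" "\<And>y. l < y \<Longrightarrow> y < u \<Longrightarrow> \<exists>t\<in>{0<..<\<delta>}. y = \<Lambda>1 t"
    using slope_range[OF \<theta>] by blast
  have eq: "y * slope_inv y - \<Lambda> (slope_inv y) = I y" if "y \<in> {l<..<u}" for y
    using lu(3)[of y] that conjugate_at_slope slope_inv_slope by auto
  have L: "(\<Lambda> has_real_derivative \<Lambda>1 \<theta>) (at (slope_inv (\<Lambda>1 \<theta>)))" using slope_inv_slope[OF \<theta>] d1[of \<theta>] \<theta> by simp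
  have "((\<lambda>y. y * slope_inv y - \<Lambda> (slope_inv y)) has_real_derivative
      (1 * slope_inv (\<Lambda>1 \<theta>) + inverse (\<Lambda>2 \<theta>) * \<Lambda>1 \<theta>) - \<Lambda>1 \<theta> * inverse (\<Lambda>2 \<theta>)) (at (\<Lambda>1 \<theta>))"
    by (intro DERIV_diff DERIV_mult DERIV_ident slope_inv_deriv[OF \<theta>] DERIV_chain2[OF L slope_inv_deriv[OF \<theta>]])
  hence "((\<lambda>y. y * slope_inv y - \<Lambda> (slope_inv y)) has_real_derivative \<theta>) (at (\<Lambda>1 \<theta>))" using slope_inv_slope[OF \<theta>] by (simp add: mult.commute)
  then show ?thesis
    by (rule has_field_derivative_transform_within_open[where S="{l<..<u}"]) (use lu eq in auto)
qed

text \<open>By \<open>I_deriv\<close> the derivative of \<open>I\<close> equals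
  \<open>slope_inv\<close> on a neighbourhood, so the inverse function rule gives the second
  derivative.\<close>

lemma I_second_deriv:
  assumes \<theta>: "\<theta> \<in> {0<..<\<delta>}"
  shows "deriv (deriv I) (\<Lambda>1 \<theta>) = 1 / \<Lambda>2 \<theta>"
proof -
  obtain l u where lu: "l < \<Lambda>1 \<theta>" "\<Lambda>1 \<theta> < u" "\<And>y. l < y \<Longrightarrow> y < u \<Longrightarrow> \<exists>t\<in>{0<..<\<delta>}. y = \<Lambda>1 t"
    using slope_range[OF \<theta>] by blast
  have "(deriv I has_real_derivative inverse (\<Lambda>2 \<theta>)) (at (\<Lambda>1 \<theta>))"
  proof (rule has_field_derivative_transform_within_open[OF slope_inv_deriv[OF \<theta>], where S="{l<..<u}"])
    fix y assume "y \<in> {l<..<u}"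
    then obtain t where "t \<in> {0<..<\<delta>}" "y = \<Lambda>1 t" using lu(3)[of y] by auto
    then show "slope_inv y = deriv I y" using DERIV_imp_deriv[OF I_deriv] slope_inv_slope by simp
  qed (use lu in auto)
  then show ?thesis by (simp add: DERIV_imp_deriv inverse_eq_divide)
qed

end

section \<open>Exponential tilting and the sharp asymptotics\<close>

lemma (in prob_space) exp_moment_pos:
  fixes Y :: "'a \<Rightarrow> real"
  assumes "integrable M (\<lambda>\<omega>. exp (Y \<omega>))"
  shows "expectation (\<lambda>\<omega>. exp (Y \<omega>)) > 0"
proof -
  have "expectation (\<lambda>\<omega>. exp (Y \<omega>)) \<noteq> 0"
  proof
    assume "expectation (\<lambda>\<omega>. exp (Y \<omega>)) = 0"
    hence "AE \<omega> in M. exp (Y \<omega>) = 0" using integral_nonneg_eq_0_iff_AE[OF assms] by simp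
    then show False using AE_contr by simp
  qed
  moreover have "expectation (\<lambda>\<omega>. exp (Y \<omega>)) \<ge> 0" by (rule integral_nonneg_AE) simp
  ultimately show ?thesis by linarith
qed

text \<open>Jensen's inequality for exp, obtained by integrating the tangent at the mean.\<close>

lemma (in prob_space) exp_moment_ge:
  fixes Y :: "'a \<Rightarrow> real"
  assumes Y: "integrable M Y" and E: "integrable M (\<lambda>\<omega>. exp (Y \<omega>))"
  shows "exp (expectation Y) \<le> expectation (\<lambda>\<omega>. exp (Y \<omega>))"
proof -
  let ?m = "expectation Y"
  have "expectation (\<lambda>\<omega>. exp ?m * (1 + (Y \<omega> - ?m))) \<le> expectation (\<lambda>\<omega>. exp (Y \<omega>))"
  proof (rule integral_mono)
    fix \<omega>
    have "exp ?m * (1 + (Y \<omega> - ?m)) \<le> exp ?m * exp (Y \<omega> - ?m)" by (intro mult_left_mono exp_ge_add_one_self) auto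
    then show "exp ?m * (1 + (Y \<omega> - ?m)) \<le> exp (Y \<omega>)" by (simp add: exp_diff)
  qed (use Y E in auto)
  then show ?thesis using Y by (simp add: prob_space)
qed

text \<open>The integral of a non-integrable function is 0 by convention, so Jensen's inequality
  needs integrability first. Here t |y| is at most exp (t y) + exp (- t y).\<close>

lemma (in prob_space) exp_moments_imp_integrable:
  fixes Y :: "'a \<Rightarrow> real"
  assumes [measurable]: "Y \<in> borel_measurable M" and t: "t > 0"
    and p: "integrable M (\<lambda>\<omega>. exp (t * Y \<omega>))" and n: "integrable M (\<lambda>\<omega>. exp (- t * Y \<omega>))"
  shows "integrable M Y"
proof (rule Bochner_Integration.integrable_bound)
  show "integrable M (\<lambda>\<omega>. (exp (t * Y \<omega>) + exp (- t * Y \<omega>)) / t)" using p n by simp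
  show "AE \<omega> in M. norm (Y \<omega>) \<le> norm ((exp (t * Y \<omega>) + exp (- t * Y \<omega>)) / t)"
  proof (rule AE_I2)
    fix \<omega>
    have "t * \<bar>Y \<omega>\<bar> \<le> exp (t * \<bar>Y \<omega>\<bar>)" using exp_ge_add_one_self[of "t * \<bar>Y \<omega>\<bar>"] by linarith
    also have "\<dots> \<le> exp (t * Y \<omega>) + exp (- t * Y \<omega>)" by (auto simp: abs_if)
    finally have "\<bar>Y \<omega>\<bar> \<le> (exp (t * Y \<omega>) + exp (- t * Y \<omega>)) / t" using t by (simp add: field_simps)
    then show "norm (Y \<omega>) \<le> norm ((exp (t * Y \<omega>) + exp (- t * Y \<omega>)) / t)"
      unfolding real_norm_def by (rule order_trans[OF _ abs_ge_self])
  qed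
qed simp

text \<open>The Esscher transform of the law of \<open>Y\<close>, recentred at
  \<open>b\<close>.\<close>

definition tilted_law :: "'s measure \<Rightarrow> real \<Rightarrow> ('s \<Rightarrow> real) \<Rightarrow> real \<Rightarrow> real measure" where
  "tilted_law M \<theta> Y b =
     distr (density M (\<lambda>\<omega>. exp (\<theta> * Y \<omega>) / (LINT \<omega>|M. exp (\<theta> * Y \<omega>)))) borel (\<lambda>\<omega>. Y \<omega> - b)"

lemma (in prob_space) real_distribution_tilted_law:
  fixes Y :: "'a \<Rightarrow> real"
  assumes [measurable]: "Y \<in> borel_measurable M" and E: "integrable M (\<lambda>\<omega>. exp (\<theta> * Y \<omega>))"
  shows "real_distribution (tilted_law M \<theta> Y b)"
proof -
  let ?m = "LINT \<omega>|M. exp (\<theta> * Y \<omega>)"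
  let ?D = "density M (\<lambda>\<omega>. exp (\<theta> * Y \<omega>) / ?m)"
  have m: "?m > 0" by (rule exp_moment_pos[OF E])
  have "(\<integral>\<^sup>+ \<omega>. ennreal (exp (\<theta> * Y \<omega>) / ?m) \<partial>M) = ennreal (LINT \<omega>|M. exp (\<theta> * Y \<omega>) / ?m)"
    using E m by (intro nn_integral_eq_integral) auto
  hence "(\<integral>\<^sup>+ \<omega>. ennreal (exp (\<theta> * Y \<omega>) / ?m) \<partial>M) = 1" using m by simp
  hence "prob_space ?D" by (intro prob_spaceI) (simp add: emeasure_density)
  then interpret D: prob_space ?D .
  show ?thesis unfolding tilted_law_def by (rule D.real_distribution_distr) simp
qed

lemma (in prob_space) integral_tilted_law:
  fixes Y :: "'a \<Rightarrow> real" and f :: "real \<Rightarrow> 'z::{banach, second_countable_topology}"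
  assumes [measurable]: "Y \<in> borel_measurable M" "f \<in> borel_measurable borel"
    and E: "integrable M (\<lambda>\<omega>. exp (\<theta> * Y \<omega>))"
  shows "(LINT t|tilted_law M \<theta> Y b. f t)
      = (LINT \<omega>|M. (exp (\<theta> * Y \<omega>) / (LINT \<omega>|M. exp (\<theta> * Y \<omega>))) *\<^sub>R f (Y \<omega> - b))"
proof -
  let ?m = "LINT \<omega>|M. exp (\<theta> * Y \<omega>)"
  let ?D = "density M (\<lambda>\<omega>. exp (\<theta> * Y \<omega>) / ?m)"
  have "(LINT t|tilted_law M \<theta> Y b. f t) = (LINT \<omega>|?D. f (Y \<omega> - b))"
    unfolding tilted_law_def by (rule integral_distr) auto
  also have "\<dots> = (LINT \<omega>|M. (exp (\<theta> * Y \<omega>) / ?m) *\<^sub>R f (Y \<omega> - b))"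
    using exp_moment_pos[OF E] by (intro integral_density) auto
  finally show ?thesis .
qed

theorem theorem2p7:
  fixes M :: "'s measure"
    and X :: "nat \<Rightarrow> 's \<Rightarrow> real"
    and S :: "nat \<Rightarrow> 's \<Rightarrow> real"
    and \<delta> :: real
    and v :: "'b::complex_banach"
    and ell :: "'b \<Rightarrow> complex"
    and L :: "complex \<Rightarrow> ('b \<Rightarrow>\<^sub>L 'b)"
    and lam :: "real \<Rightarrow> real"
    and Pi :: "real \<Rightarrow> ('b \<Rightarrow>\<^sub>L 'b)"
    and I :: "real \<Rightarrow> real"
    and a :: real
  assumes M: "prob_space M"
    and X_meas: "\<And>n. n \<ge> 1 \<Longrightarrow> X n \<in> borel_measurable M"
    and S_def: "\<And>N \<omega>. S N \<omega> = (\<Sum>n\<in>{1..N}. X n \<omega>)"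
    and mean: "(\<lambda>N. prob_space.expectation M (S N) / real N) \<longlonglongrightarrow> 0"
    and \<delta>_pos: "\<delta> > 0"
    and ell_lin: "clinear_functional ell"
    and L_lin: "\<And>z. \<bar>Re z\<bar> < \<delta> \<Longrightarrow> clinear_op (L z)"
    and mgf_int: "\<And>N z. N \<ge> 1 \<Longrightarrow> \<bar>Re z\<bar> < \<delta> \<Longrightarrow>
                    integrable M (\<lambda>\<omega>. exp (z * complex_of_real (S N \<omega>)))"
    and mgf: "\<And>N z. N \<ge> 1 \<Longrightarrow> \<bar>Re z\<bar> < \<delta> \<Longrightarrow>
                (LINT \<omega>|M. exp (z * complex_of_real (S N \<omega>)))
                  = ell ((blinfun_apply (L z) ^^ N) v)"
    and B1_cont: "continuous_on {z. \<bar>Re z\<bar> < \<delta>} L"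
    and B1_hol: "op_holomorphic_on L (ball 0 \<delta>)"
    and B2_pos: "\<And>\<theta>. \<bar>\<theta>\<bar> < \<delta> \<Longrightarrow> lam \<theta> > 0"
    and B2_eig: "\<And>\<theta>. \<bar>\<theta>\<bar> < \<delta> \<Longrightarrow>
                   simple_eigenprojection (L (complex_of_real \<theta>)) (complex_of_real (lam \<theta>)) (Pi \<theta>)"
    and B2_gap: "\<And>\<theta>. \<bar>\<theta>\<bar> < \<delta> \<Longrightarrow> \<exists>r < lam \<theta>.
                   op_spectrum (L (complex_of_real \<theta>)) - {complex_of_real (lam \<theta>)} \<subseteq> ball 0 r"
    and B2_one: "lam 0 = 1"
    and B3: "\<And>\<theta> s. \<bar>\<theta>\<bar> < \<delta> \<Longrightarrow> s \<noteq> 0 \<Longrightarrow>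
               op_spectrum (L (Complex \<theta> s)) \<subseteq> ball 0 (lam \<theta>)"
    and C_convex: "\<And>\<theta>. \<bar>\<theta>\<bar> < \<delta> \<Longrightarrow> deriv (deriv (\<lambda>t. ln (lam t))) \<theta> > 0"
    and C_pos: "\<And>\<theta>. \<bar>\<theta>\<bar> < \<delta> \<Longrightarrow>
                  Im (ell (blinfun_apply (Pi \<theta>) v)) = 0 \<and> Re (ell (blinfun_apply (Pi \<theta>) v)) > 0"
    and I_def: "\<And>b. I b = (SUP \<theta>\<in>{0<..<\<delta>}. b * \<theta> - ln (lam \<theta>))"
    and a_pos: "a > 0"
    and a_bound: "ereal (a * \<delta>) < Lim (at_left \<delta>) (\<lambda>\<theta>. ereal (ln (lam \<theta>)))"
  shows "(\<exists>\<theta>a\<in>{0<..<\<delta>}. I a = a * \<theta>a - ln (lam \<theta>a)) \<and>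
         (\<forall>\<theta>a\<in>{0<..<\<delta>}. I a = a * \<theta>a - ln (lam \<theta>a) \<longrightarrow>
            (\<lambda>N::nat. prob_space.prob M {\<omega>\<in>space M. S N \<omega> \<ge> a * real N} * exp (I a * real N))
              \<sim>[at_top]
            (\<lambda>N. Re (ell (blinfun_apply (Pi \<theta>a) v)) * sqrt (deriv (deriv I) a)
                   / (\<theta>a * sqrt (2 * pi * real N))))"
proof -
  interpret prob_space M by (rule M)
  interpret spectral_family \<delta> v ell L lam Pi
  proof
    show "ell (blinfun_apply (Pi \<theta>) v) \<noteq> 0" if "\<bar>\<theta>\<bar> < \<delta>" for \<theta> using C_pos[OF that] by auto
  qed (fact \<delta>_pos ell_lin L_lin B1_cont B1_hol B2_pos B2_eig B2_gap B3)+
  have \<Lambda>: "(\<lambda>t. ln (lam t)) = \<Lambda>" by (simp add: \<Lambda>_def fun_eq_iff)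
  have S_meas [measurable]: "S N \<in> borel_measurable M" for N
  proof -
    have "S N = (\<lambda>\<omega>. \<Sum>n\<in>{1..N}. X n \<omega>)" using S_def by blast
    then show ?thesis using X_meas by (simp add: borel_measurable_sum)
  qed
  have exp_int: "integrable M (\<lambda>\<omega>. exp (t * S N \<omega>))" if t: "\<bar>t\<bar> < \<delta>" for N t
  proof (cases "N \<ge> 1")
    case True
    have "integrable M (\<lambda>\<omega>. norm (exp (complex_of_real t * complex_of_real (S N \<omega>))))"
      by (rule integrable_norm[OF mgf_int[OF True]]) (use t in simp)
    then show ?thesis by simp
  next
    case False
    \<comment> \<open>The moment hypotheses start at N = 1; the remaining case is the empty sum
      \<open>S 0\<close>.\<close>
    then show ?thesis using S_def[of N] by (simp add: not_le)
  qed
  define m where "m N t = (LINT \<omega>|M. exp (t * S N \<omega>))" for N t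
  have m_pos: "m N t > 0" if "\<bar>t\<bar> < \<delta>" for N t
    unfolding m_def by (rule exp_moment_pos[OF exp_int[OF that]])
  have \<psi>m: "\<psi> N (of_real t) = of_real (m N t)" if "N \<ge> 1" "\<bar>t\<bar> < \<delta>" for N t
  proof -
    have "\<psi> N (of_real t) = (LINT \<omega>|M. complex_of_real (exp (t * S N \<omega>)))"
      using mgf[of N "of_real t"] that by (simp add: \<psi>_def exp_of_real[symmetric])
    then show ?thesis unfolding m_def by (simp only: integral_complex_of_real)
  qed
  have m_asymp: "(\<lambda>N. m N t / lam t ^ N) \<longlonglongrightarrow> Re (ell (blinfun_apply (Pi t) v))" if t: "\<bar>t\<bar> < \<delta>" for t
  proof -
    have "(\<lambda>N. Re (\<psi> N (of_real t) / of_real (lam t ^ N))) \<longlonglongrightarrow> Re (ell (blinfun_apply (Pi t) v))"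
      by (intro tendsto_Re \<psi>_real_asymp t)
    moreover have "\<forall>\<^sub>F N in sequentially. Re (\<psi> N (of_real t) / of_real (lam t ^ N)) = m N t / lam t ^ N"
      using eventually_ge_at_top[of 1] by eventually_elim (simp add: \<psi>m t flip: of_real_power of_real_divide)
    ultimately show ?thesis by (rule Lim_transform_eventually)
  qed
  \<comment> \<open>By Jensen \<open>m N t\<close> is at least exp (t E(S_N)), where the exponent is
    o(N). If \<open>\<Lambda> t\<close> were negative, the quotient of \<open>m N t\<close> by
    \<open>lam t ^ N\<close> would grow like exp (- N \<Lambda>(t) / 2) or faster, contradicting its
    convergence in \<open>m_asymp\<close>.\<close>
  have \<Lambda>_nonneg: "\<Lambda> t \<ge> 0" if t: "\<bar>t\<bar> < \<delta>" for t
  proof (rule ccontr)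
    assume "\<not> \<Lambda> t \<ge> 0"
    hence neg: "\<Lambda> t < 0" by simp
    have S_int: "integrable M (S N)" for N
    proof (rule exp_moments_imp_integrable[OF S_meas])
      show "0 < \<delta> / 2" using \<delta>_pos by simp
      show "integrable M (\<lambda>\<omega>. exp (\<delta> / 2 * S N \<omega>))" by (rule exp_int) (use \<delta>_pos in simp)
      show "integrable M (\<lambda>\<omega>. exp (- (\<delta> / 2) * S N \<omega>))" by (rule exp_int) (use \<delta>_pos in simp)
    qed
    have lower: "exp (real N * (t * (expectation (S N) / real N) - \<Lambda> t)) \<le> m N t / lam t ^ N" if "N \<ge> 1" for N
    proof -
      have l: "lam t ^ N = exp (real N * \<Lambda> t)" using exp_\<Lambda>[OF t] by (simp add: exp_of_nat_mult)
      have "exp (t * expectation (S N)) \<le> m N t"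
        unfolding m_def using exp_moment_ge[of "\<lambda>\<omega>. t * S N \<omega>"] S_int exp_int[OF t] by simp
      hence "exp (t * expectation (S N)) / lam t ^ N \<le> m N t / lam t ^ N"
        using B2_pos[OF t] by (intro divide_right_mono) auto
      moreover have "exp (t * expectation (S N)) / lam t ^ N = exp (real N * (t * (expectation (S N) / real N) - \<Lambda> t))"
        unfolding l exp_diff[symmetric] using that by (simp add: right_diff_distrib)
      ultimately show ?thesis by simp
    qed
    have "(\<lambda>N. t * (expectation (S N) / real N)) \<longlonglongrightarrow> t * 0" by (intro tendsto_intros mean)
    hence "\<forall>\<^sub>F N in sequentially. \<Lambda> t / 2 < t * (expectation (S N) / real N)"
      using neg by (intro order_tendstoD(1)) auto
    hence "\<forall>\<^sub>F N in sequentially. exp (real N * (- \<Lambda> t / 2)) \<le> m N t / lam t ^ N"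
      using eventually_ge_at_top[of 1]
    proof eventually_elim
      case (elim N)
      have "real N * (- \<Lambda> t / 2) \<le> real N * (t * (expectation (S N) / real N) - \<Lambda> t)"
      proof (rule mult_left_mono)
        show "- \<Lambda> t / 2 \<le> t * (expectation (S N) / real N) - \<Lambda> t" using elim(1) by linarith
      qed simp
      hence "exp (real N * (- \<Lambda> t / 2)) \<le> exp (real N * (t * (expectation (S N) / real N) - \<Lambda> t))" by simp
      also have "\<dots> \<le> m N t / lam t ^ N" by (rule lower[OF elim(2)])
      finally show ?case .
    qed
    moreover have "filterlim (\<lambda>N. exp (real N * (- \<Lambda> t / 2))) at_top sequentially"
      using neg by (intro filterlim_compose[OF exp_at_top] filterlim_at_top_mult_tendsto_pos[OF tendsto_const]
          filterlim_real_sequentially) auto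
    ultimately have "filterlim (\<lambda>N. m N t / lam t ^ N) at_top sequentially" by (rule filterlim_at_top_mono[rotated])
    then show False
      using not_tendsto_and_filterlim_at_infinity[OF sequentially_bot m_asymp[OF t]]
      by (simp add: filterlim_at_top_imp_at_infinity)
  qed
  have \<Lambda>_0: "\<Lambda> 0 = 0" using B2_one by (simp add: \<Lambda>_def)
  have \<Lambda>'_0: "deriv \<Lambda> 0 = 0"
    using \<Lambda>_deriv(1)[of 0] \<delta>_pos \<Lambda>_nonneg \<Lambda>_0 by (intro DERIV_local_min[of \<Lambda> _ 0 \<delta>]) auto
  interpret convex_cgf \<Lambda> "deriv \<Lambda>" "deriv (deriv \<Lambda>)" \<delta> a I
  proof
    show "deriv (deriv \<Lambda>) t > 0" if "\<bar>t\<bar> < \<delta>" for t using C_convex[OF that] unfolding \<Lambda> .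
    show "ereal (a * \<delta>) < Lim (at_left \<delta>) (\<lambda>\<theta>. ereal (\<Lambda> \<theta>))" using a_bound by (simp add: \<Lambda>_def)
    show "I b = (SUP \<theta>\<in>{0<..<\<delta>}. b * \<theta> - \<Lambda> \<theta>)" for b using I_def[of b] by (simp add: \<Lambda>_def)
  qed (fact \<delta>_pos \<Lambda>_deriv \<Lambda>_0 \<Lambda>'_0 a_pos)+
  have main: "(\<lambda>N::nat. prob {\<omega>\<in>space M. S N \<omega> \<ge> a * real N} * exp (I a * real N))
              \<sim>[at_top]
            (\<lambda>N. Re (ell (blinfun_apply (Pi \<theta>) v)) * sqrt (deriv (deriv I) a)
                   / (\<theta> * sqrt (2 * pi * real N)))"
    if \<theta>: "\<theta> \<in> {0<..<\<delta>}" and I: "I a = a * \<theta> - \<Lambda> \<theta>" for \<theta>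
  proof -
    have \<theta>\<delta>: "\<bar>\<theta>\<bar> < \<delta>" and \<theta>0: "\<theta> > 0" using \<theta> by auto
    have slope: "deriv \<Lambda> \<theta> = a" by (rule maximizer_slope[OF \<theta> I])
    let ?S2 = "deriv (deriv \<Lambda>) \<theta>"
    let ?c = "Re (ell (blinfun_apply (Pi \<theta>) v))"
    have S2: "?S2 > 0" by (rule pos[OF \<theta>\<delta>])
    have I2: "deriv (deriv I) a = 1 / ?S2" using I_second_deriv[OF \<theta>] slope by simp
    have c: "?c > 0" using C_pos[OF \<theta>\<delta>] by simp
    define Q where "Q N = tilted_law M \<theta> (S N) (a * real N)" for N
    have intQ: "(LINT t|Q N. f t) = (LINT \<omega>|M. (exp (\<theta> * S N \<omega>) / m N \<theta>) *\<^sub>R f (S N \<omega> - a * real N))"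
      if "f \<in> borel_measurable borel" for f :: "real \<Rightarrow> 'z::{banach, second_countable_topology}" and N
      unfolding Q_def m_def by (rule integral_tilted_law[OF S_meas that exp_int[OF \<theta>\<delta>]])
    have charQ: "char (Q N) s = tilted_char \<theta> N s" if N: "N \<ge> 1" for N s
    proof -
      have "char (Q N) s = (LINT \<omega>|M. (exp (\<theta> * S N \<omega>) / m N \<theta>) *\<^sub>R iexp (s * (S N \<omega> - a * real N)))"
        unfolding char_def by (rule intQ) simp
      also have "\<dots> = (LINT \<omega>|M. (iexp (- (a * real N * s)) / of_real (m N \<theta>)) * exp (Complex \<theta> s * of_real (S N \<omega>)))"
      proof (rule Bochner_Integration.integral_cong[OF refl])
        fix \<omega>
        have "exp (Complex \<theta> s * of_real (S N \<omega>)) * iexp (- (a * real N * s))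
            = of_real (exp (\<theta> * S N \<omega>)) * iexp (s * (S N \<omega> - a * real N))"
          unfolding exp_of_real[symmetric] exp_add[symmetric]
          by (rule arg_cong[where f=exp]) (simp add: complex_eq_iff algebra_simps)
        then show "(exp (\<theta> * S N \<omega>) / m N \<theta>) *\<^sub>R iexp (s * (S N \<omega> - a * real N))
            = (iexp (- (a * real N * s)) / of_real (m N \<theta>)) * exp (Complex \<theta> s * of_real (S N \<omega>))"
          by (simp add: scaleR_conv_of_real mult.commute)
      qed
      also have "\<dots> = (iexp (- (a * real N * s)) / of_real (m N \<theta>)) * \<psi> N (Complex \<theta> s)"
        using mgf[OF N, of "Complex \<theta> s"] \<theta>\<delta> by (simp add: \<psi>_def)
      finally show ?thesis using \<psi>m[OF N \<theta>\<delta>] by (simp add: tilted_char_def slope mult.commute)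
    qed
    have "gaussian_family Q (sqrt ?S2)"
    proof (rule gaussian_family.intro)
      show "real_distribution (Q N)" for N
        unfolding Q_def by (rule real_distribution_tilted_law[OF S_meas exp_int[OF \<theta>\<delta>]])
      show "\<exists>K \<kappa>. \<kappa> > 0 \<and> (\<forall>\<^sub>F N in sequentially. \<forall>s. \<bar>s\<bar> \<le> R \<longrightarrow> cmod (char (Q N) s) \<le> K * exp (- (\<kappa> * real N * s\<^sup>2)))" for R
      proof -
        obtain K \<kappa> where \<kappa>: "\<kappa> > 0" and ev: "\<forall>\<^sub>F N in sequentially. \<forall>s. \<bar>s\<bar> \<le> R \<longrightarrow> cmod (tilted_char \<theta> N s) \<le> K * exp (- (\<kappa> * real N * s\<^sup>2))"
          using tilted_char_bound[OF \<theta>\<delta> S2] by blast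
        have "\<forall>\<^sub>F N in sequentially. \<forall>s. \<bar>s\<bar> \<le> R \<longrightarrow> cmod (char (Q N) s) \<le> K * exp (- (\<kappa> * real N * s\<^sup>2))"
          using ev eventually_ge_at_top[of 1] by eventually_elim (simp add: charQ)
        then show ?thesis using \<kappa> by blast
      qed
      show "(\<lambda>N. char (Q N) (u / sqrt (real N))) \<longlonglongrightarrow> of_real (exp (- ((sqrt ?S2)\<^sup>2 * u\<^sup>2 / 2)))" for u
      proof (rule Lim_transform_eventually)
        show "(\<lambda>N. tilted_char \<theta> N (u / sqrt (real N))) \<longlonglongrightarrow> of_real (exp (- ((sqrt ?S2)\<^sup>2 * u\<^sup>2 / 2)))"
          using tilted_char_limit[OF \<theta>\<delta>, of u] S2 by simp
        show "\<forall>\<^sub>F N in sequentially. tilted_char \<theta> N (u / sqrt (real N)) = char (Q N) (u / sqrt (real N))"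
          using eventually_ge_at_top[of 1] by eventually_elim (simp add: charQ)
      qed
    qed (use S2 in simp)
    then interpret gaussian_family Q "sqrt ?S2" .
    let ?p = "\<lambda>N. prob {\<omega>\<in>space M. S N \<omega> \<ge> a * real N}"
    \<comment> \<open>The weight exp (- \<theta> t) cancels the tilting density up to the constant
      \<open>exp (\<theta> * (a * real N)) / m N \<theta>\<close>, leaving the indicator of the
      event.\<close>
    have tail: "(LINT t|Q N. indicator {0..} t * exp (- (\<theta> * t))) = exp (\<theta> * (a * real N)) / m N \<theta> * ?p N" for N
    proof -
      have "(LINT t|Q N. indicator {0..} t * exp (- (\<theta> * t)))
          = (LINT \<omega>|M. (exp (\<theta> * S N \<omega>) / m N \<theta>) *\<^sub>R (indicator {0..} (S N \<omega> - a * real N) * exp (- (\<theta> * (S N \<omega> - a * real N)))))"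
        by (rule intQ) simp
      also have "\<dots> = (LINT \<omega>|M. exp (\<theta> * (a * real N)) / m N \<theta> * indicator {\<omega>\<in>space M. S N \<omega> \<ge> a * real N} \<omega>)"
      proof (rule Bochner_Integration.integral_cong[OF refl])
        fix \<omega> assume "\<omega> \<in> space M"
        moreover have "exp (\<theta> * S N \<omega>) * exp (- (\<theta> * (S N \<omega> - a * real N))) = exp (\<theta> * (a * real N))"
          unfolding exp_add[symmetric] by (simp add: algebra_simps)
        ultimately show "(exp (\<theta> * S N \<omega>) / m N \<theta>) *\<^sub>R (indicator {0..} (S N \<omega> - a * real N) * exp (- (\<theta> * (S N \<omega> - a * real N))))
            = exp (\<theta> * (a * real N)) / m N \<theta> * indicator {\<omega>\<in>space M. S N \<omega> \<ge> a * real N} \<omega>"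
          by (auto simp: indicator_def)
      qed
      also have "\<dots> = exp (\<theta> * (a * real N)) / m N \<theta> * ?p N" by simp
      finally show ?thesis .
    qed
    let ?f = "\<lambda>N. ?p N * exp (I a * real N)"
    let ?l = "?c * (1 / (\<theta> * sqrt ?S2 * sqrt (2 * pi)))"
    \<comment> \<open>The value of \<open>I a\<close> splits the exponential into the factor of
      \<open>tail\<close> and the reciprocal of \<open>lam \<theta> ^ N\<close>. What remains
      besides the local limit integral is \<open>m N \<theta> / lam \<theta> ^ N\<close>, whose
      limit is \<open>?c\<close>.\<close>
    have f_eq: "?f N * sqrt (real N) = (m N \<theta> / lam \<theta> ^ N) * (sqrt (real N) * (LINT t|Q N. indicator {0..} t * exp (- (\<theta> * t))))" for N
    proof -
      have "lam \<theta> ^ N = exp (real N * \<Lambda> \<theta>)" using exp_\<Lambda>[OF \<theta>\<delta>] by (simp add: exp_of_nat_mult)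
      hence "exp (I a * real N) = exp (\<theta> * (a * real N)) / lam \<theta> ^ N"
        unfolding I by (simp add: algebra_simps flip: exp_diff)
      then show ?thesis unfolding tail using m_pos[OF \<theta>\<delta>, of N] by simp
    qed
    have flim: "(\<lambda>N. ?f N * sqrt (real N)) \<longlonglongrightarrow> ?l"
      unfolding f_eq by (intro tendsto_mult m_asymp[OF \<theta>\<delta>] local_limit_exponential[OF \<theta>0])
    have l: "?l \<noteq> 0" using c \<theta>0 S2 by simp
    show ?thesis
    proof (rule asymp_equivI')
      have "(\<lambda>N. (?f N * sqrt (real N)) / ?l) \<longlonglongrightarrow> ?l / ?l" by (intro tendsto_divide flim tendsto_const l)
      hence lim: "(\<lambda>N. (?f N * sqrt (real N)) / ?l) \<longlonglongrightarrow> 1" using l by simp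
      show "(\<lambda>N. ?f N / (?c * sqrt (deriv (deriv I) a) / (\<theta> * sqrt (2 * pi * real N)))) \<longlonglongrightarrow> 1"
      proof (rule Lim_transform_eventually[OF lim])
        show "\<forall>\<^sub>F N in sequentially. (?f N * sqrt (real N)) / ?l = ?f N / (?c * sqrt (deriv (deriv I) a) / (\<theta> * sqrt (2 * pi * real N)))"
          using eventually_gt_at_top[of 0]
        proof eventually_elim
          case (elim N)
          have "?c * sqrt (deriv (deriv I) a) / (\<theta> * sqrt (2 * pi * real N)) = ?l / sqrt (real N)"
            unfolding I2 by (simp add: real_sqrt_mult real_sqrt_divide mult_ac)
          then show ?case by simp
        qed
      qed
    qed
  qed
  have ln_eq: "ln (lam t) = \<Lambda> t" for t by (simp add: \<Lambda>_def)
  show ?thesis unfolding ln_eq using maximizer_exists main by blast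
qed

end
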